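(* Let $X:f=0$ be a reduced surface of degree $d\ge 3$ in $\mathbb{P}^3$ over $\mathbb{C}$, with graded Betti numbers $\mathbf d=(d_1,\dots,d_p)$, $\mathbf c=(c_1,\dots,c_q)$, $\mathbf b=(b_1,\dots,b_r)$ of its Jacobian algebra $M(f)$. If $X$ has isolated singularities, then $$5(d-1)^3-6d_1(d-1)^2\ \le\ -\sum_{i=1}^p d_i^3+\sum_{j=1}^q c_j^3-\sum_{k=1}^r b_k^3\ \le\ 5(d-1)^3-6d_1(d-d_1-1)(d-1).$$ Moreover, if $d_1+d_2\ne d-1$, in particular if $d_1>(d-1)/2$, then the last inequality is strict.
   Context: $S=\mathbb{C}[x,y,z,t]$ with its standard grading; $f\in S$ is homogeneous of degree $d$ and squarefree. $J_f=(f_x,f_y,f_z,f_t)$ is the Jacobian ideal and $M(f)=S/J_f$ the Jacobian algebra. The graded Betti numbers are the degrees in the minimal resolution $$0 \to \bigoplus_{k=1}^{r} S(1-d-b_k)\to \bigoplus_{j=1}^{q} S(1-d-c_j)\to \bigoplus_{i=1}^{p} S(1-d-d_i)\to S^4(1-d)\to S$$ of $M(f)$, where $S^4(1-d)\to S$ is given by $(f_x,f_y,f_z,f_t)$ and the remaining part is the minimal graded free resolution of its kernel, the (shifted) module of Jacobian syzygies $AR(f)=\{(a^x,a^y,a^z,a^t)\in S^4: a^xf_x+a^yf_y+a^zf_z+a^tf_t=0\}$. Here $p\ge3$, $q,r\ge 0$, and $d_1\le d_2\le\dots\le d_p$ (similarly $\mathbf c$ and $\mathbf b$ are increasing). "Isolated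 singularities" means that the singular subscheme $\Sigma$ of $X$ defined by $J_f$ has dimension $0$. *)

theory Defs
  imports
    "HOL-Library.Poly_Mapping"
    "HOL-Library.Numeral_Type"
    "HOL-Library.Extended_Real"
    "HOL-Computational_Algebra.Squarefree"
    "HOL-Algebra.Algebraic_Closure_Type"
    "Jordan_Normal_Form.Matrix_Kernel"
begin

text \<open>
  The polynomial ring \<open>S = \<complex>[x,y,z,t]\<close>: the variables are indexed by the four-element
  type \<open>4\<close>, with \<open>x, y, z, t\<close> corresponding to \<open>0, 1, 2, 3\<close>, and a polynomial is a finitely
  supported map from exponent vectors to coefficients, with convolution as product.
\<close>

type_synonym monom4 = "4 \<Rightarrow>\<^sub>0 nat"
type_synonym poly4 = "monom4 \<Rightarrow>\<^sub>0 complex"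

abbreviation S_ring :: "poly4 ring" where
  "S_ring \<equiv> ring_of_type_algebra"

definition mon_degree :: "monom4 \<Rightarrow> nat" where
  "mon_degree m = (\<Sum>i\<in>UNIV. Poly_Mapping.lookup m i)"

text \<open>As usual, \<open>0\<close> is homogeneous of every degree.\<close>

definition homogeneous :: "nat \<Rightarrow> poly4 \<Rightarrow> bool" where
  "homogeneous n p \<longleftrightarrow> (\<forall>m\<in>Poly_Mapping.keys p. mon_degree m = n)"

definition var :: "4 \<Rightarrow> poly4" where
  "var i = Poly_Mapping.single (Poly_Mapping.single i 1) 1"

text \<open>
  Exponents are subtracted with truncation, but where this matters (exponent \<open>0\<close> in
  variable \<open>i\<close>) the coefficient vanishes.
\<close>

definition partial :: "4 \<Rightarrow> poly4 \<Rightarrow> poly4" where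
  "partial i p = (\<Sum>m\<in>Poly_Mapping.keys p.
     Poly_Mapping.single (m - Poly_Mapping.single i 1)
       (of_nat (Poly_Mapping.lookup m i) * Poly_Mapping.lookup p m))"

definition irrelevant_ideal :: "poly4 set" where
  "irrelevant_ideal = genideal S_ring (range var)"

definition jacobian_ideal :: "poly4 \<Rightarrow> poly4 set" where
  "jacobian_ideal f = genideal S_ring (range (\<lambda>i. partial i f))"


subsection \<open>Dimension of projective subschemes\<close>

definition homogeneous_ideal :: "poly4 set \<Rightarrow> bool" where
  "homogeneous_ideal I \<longleftrightarrow>
     ideal I S_ring \<and> I = genideal S_ring {p \<in> I. \<exists>n. homogeneous n p}"

text \<open>The points of the subscheme \<open>Proj (S/I)\<close> of \<open>\<bbbP>\<^sup>3\<close>.\<close>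

definition Proj_points :: "poly4 set \<Rightarrow> poly4 set set" where
  "Proj_points I = {P. primeideal P S_ring \<and> homogeneous_ideal P \<and> I \<subseteq> P
                       \<and> \<not> irrelevant_ideal \<subseteq> P}"

text \<open>
  The dimension of \<open>Proj (S/I)\<close> is the supremum of the lengths \<open>n\<close> of chains
  \<open>P\<^sub>0 \<subset> \<dots> \<subset> P\<^sub>n\<close> of points (equivalently, of chains of irreducible closed subsets);
  the empty scheme gets dimension \<open>- \<infinity>\<close>, being the supremum of the empty set.
\<close>

definition Proj_dim :: "poly4 set \<Rightarrow> ereal" where
  "Proj_dim I = (SUP Ps \<in> {Ps. Ps \<noteq> [] \<and> set Ps \<subseteq> Proj_points I \<and> sorted_wrt (\<subset>) Ps}.
                   ereal (real (length Ps - 1)))"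

definition isolated_singularities :: "poly4 \<Rightarrow> bool" where
  "isolated_singularities f \<longleftrightarrow> Proj_dim (jacobian_ideal f) = 0"


subsection \<open>Graded free resolutions\<close>

text \<open>
  A matrix \<open>A\<close> acting on column vectors is a degree-preserving homomorphism
  \<open>\<Oplus>\<^sub>j S(-b\<^sub>j) \<rightarrow> \<Oplus>\<^sub>i S(-a\<^sub>i)\<close>: its entry \<open>(i,j)\<close> is homogeneous of degree \<open>b\<^sub>j - a\<^sub>i\<close>, hence
  zero if that integer is negative.
\<close>

definition graded_hom :: "int list \<Rightarrow> int list \<Rightarrow> poly4 mat \<Rightarrow> bool" where
  "graded_hom b a A \<longleftrightarrow> A \<in> carrier_mat (length a) (length b) \<and>
     (\<forall>i<length a. \<forall>j<length b. \<forall>m\<in>Poly_Mapping.keys (A $$ (i, j)).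
        int (mon_degree m) = b ! j - a ! i)"

definition mat_image :: "poly4 mat \<Rightarrow> poly4 vec set" where
  "mat_image A = (\<lambda>v. A *\<^sub>v v) ` carrier_vec (dim_col A)"

text \<open>The image of \<open>A\<close> lies in the irrelevant ideal times the target module.\<close>

definition minimal_mat :: "poly4 mat \<Rightarrow> bool" where
  "minimal_mat A \<longleftrightarrow> elements_mat A \<subseteq> irrelevant_ideal"

definition gradient_row :: "poly4 \<Rightarrow> poly4 mat" where
  "gradient_row f = mat_of_rows_list 4 [[partial 0 f, partial 1 f, partial 2 f, partial 3 f]]"

definition AR :: "poly4 \<Rightarrow> poly4 vec set" where
  "AR f = {a \<in> carrier_vec 4.
     a $ 0 * partial 0 f + a $ 1 * partial 1 f + a $ 2 * partial 2 f + a $ 3 * partial 3 f = 0}"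

text \<open>
  \<open>graded_betti d f ds cs bs\<close>: there is an exact complex
  \<open>0 \<rightarrow> \<Oplus>\<^sub>k S(1-d-b\<^sub>k) \<rightarrow> \<Oplus>\<^sub>j S(1-d-c\<^sub>j) \<rightarrow> \<Oplus>\<^sub>i S(1-d-d\<^sub>i) \<rightarrow> S(1-d)\<^sup>4 \<rightarrow> S\<close>
  whose last map is given by the partial derivatives of \<open>f\<close> (so that its cokernel is
  \<open>M(f) = S / J\<^sub>f\<close>), and whose remaining part is a minimal graded free resolution of the kernel
  \<open>AR f\<close> of that map.  Minimality is therefore not required of \<open>A\<close>, which has nonzero
  constant entries if the partial derivatives are linearly dependent.
\<close>

definition graded_betti ::
  "nat \<Rightarrow> poly4 \<Rightarrow> int list \<Rightarrow> int list \<Rightarrow> int list \<Rightarrow> bool" where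
  "graded_betti d f ds cs bs \<longleftrightarrow> sorted ds \<and> sorted cs \<and> sorted bs \<and>
     (let e = int d - 1; sh = map (\<lambda>a. e + a) in
      graded_hom (replicate 4 e) [0] (gradient_row f) \<and>
      (\<exists>A B C. graded_hom (sh ds) (replicate 4 e) A \<and>
               graded_hom (sh cs) (sh ds) B \<and>
               graded_hom (sh bs) (sh cs) C \<and>
               mat_image A = AR f \<and>
               mat_kernel A = mat_image B \<and>
               mat_kernel B = mat_image C \<and>
               mat_kernel C = {0\<^sub>v (length bs)} \<and>
               minimal_mat B \<and> minimal_mat C))"

end

theory Submission
  imports
    Defs
    "HOL-Analysis.Continuum_Not_Denumerable"
    "HOL-Library.Function_Algebras"
    "HOL-Computational_Algebra.Fundamental_Theorem_Algebra"
    "HOL-Computational_Algebra.Polynomial_Factorial"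
    "HOL-Computational_Algebra.Field_as_Ring"
begin

text \<open>
  Write \<open>e = d - 1\<close>, \<open>r = d\<^sub>1\<close>.  The resolution expresses the Hilbert function of \<open>M(f)\<close> in large degrees as a
  cubic polynomial whose coefficients are signed power sums of the Betti numbers.  If \<open>\<Sigma>\<close> has dimension \<open>0\<close> this
  polynomial is a constant \<open>\<tau>\<close>, and comparing coefficients turns the alternating sum of cubes into
  \<open>6 \<tau> - e\<^sup>3\<close>.  The claim becomes the inequality \<open>e\<^sup>2 (e - r) \<le> \<tau> \<le> e\<^sup>3 - r e (e - r)\<close> of du Plessis and Wall.

  For the lower bound let \<open>g\<^sub>1, g\<^sub>2, g\<^sub>3, g\<^sub>4\<close> be general combinations of the partial derivatives.  Then
  \<open>\<tau> = e\<^sup>3 - deg ((g\<^sub>1, g\<^sub>2, g\<^sub>3) : g\<^sub>4)\<close>, and the colon ideal contains a complete intersection of degrees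
  \<open>r, e, e\<close>, since the last coefficient of a syzygy of degree \<open>r\<close> lies in it.

  For the upper bound let \<open>\<rho>\<close> be a syzygy of minimal degree \<open>r\<close>; its entries have no common factor.  Modulo a
  suitable \<open>g\<^sub>1\<close>, the cross product of the remaining entries of \<open>\<rho>\<close> and of another syzygy is a multiple of
  \<open>(g\<^sub>2, g\<^sub>3, g\<^sub>4)\<close>.  The multipliers form an ideal and multiplier \<open>0\<close> means being a multiple of \<open>\<rho>\<close>, so that
  counting dimensions gives the bound.  In the case of equality the ideal contains all forms of large degree,
  hence \<open>1\<close> by a depth argument; this produces a syzygy of degree \<open>e - r\<close> that is not a multiple of \<open>\<rho>\<close>, and
  \<open>d\<^sub>1 + d\<^sub>2 = e\<close>.

  Instead of prime decomposition, general position is obtained from the uncountability of \<open>\<complex>\<close>, and unmixedness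
  from an exchange argument for regular elements.
\<close>

text \<open>Dimension theory is replaced by Hilbert functions: a bounded \<open>codim I\<close>
  stands for a scheme of dimension at most 0. Depth is expressed by \<open>socfree\<close>, a
  condition on a set of elements, so that it is available before a single regular element has been
  chosen. The obstacle in the upper bound is that \<open>g1\<close> has to be in good position to
  two loci at once, the singular scheme and the zero locus of the last three entries of the syzygy.
  The latter may contain curves, and it moves with the generators: replacing the generators by
  combinations changes the entries of the syzygy contragrediently. The constant
  \<open>e ^ 3 - r * e * (e - r)\<close> comes out of a dimension count: in large degrees the ideal
  of multipliers has codimension \<open>e ^ 3 - r * e * (e - r) - \<tau>\<close>, which cannot be
  negative. In the case of equality the new syzygy gives only \<open>d2 \<le> e - r\<close>. The
  opposite inequality is a matter of degrees: a syzygy of degree below \<open>e - r\<close> has a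
  multiplier of negative degree, hence multiplier 0.\<close>

section \<open>Linear algebra of finite-dimensional subspaces\<close>

context vector_space
begin

text \<open>\<open>dim\<close> is a cardinality, hence 0 for infinite-dimensional sets. The
  polynomial ring is infinite-dimensional, so comparisons of dimensions carry this condition on the
  subsets involved.\<close>

definition findim :: "'b set \<Rightarrow> bool" where
  "findim S \<longleftrightarrow> (\<exists>B. finite B \<and> S \<subseteq> local.span B)"

end

text \<open>The context is left and entered again because the declaration makes \<open>findim\<close> refer to the instance for real
  vector spaces, which shadows the local constant.\<close>

context vector_space
begin

lemma findim_mono: "findim T \<Longrightarrow> S \<subseteq> T \<Longrightarrow> findim S"
  unfolding findim_def by blast

lemma findim_independent_finite: "findim S \<Longrightarrow> local.independent B \<Longrightarrow> B \<subseteq> S \<Longrightarrow> finite B"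
  unfolding findim_def using independent_span_bound by blast

lemma findim_basis:
  assumes "findim S"
  obtains B where "B \<subseteq> S" "local.independent B" "S \<subseteq> local.span B" "finite B" "card B = local.dim S"
  using basis_exists[of S] findim_independent_finite[OF assms] by metis

lemma findim_card_le_dim:
  assumes "findim S" "local.independent B" "B \<subseteq> S"
  shows "finite B \<and> card B \<le> local.dim S"
proof -
  obtain C where C: "C \<subseteq> S" "local.independent C" "S \<subseteq> local.span C" "finite C" "card C = local.dim S"
    using findim_basis[OF assms(1)] .
  show ?thesis
    using independent_span_bound[OF C(4) assms(2)] C assms(3) by auto
qed

lemma dim_mono_findim:
  assumes "findim T" "S \<subseteq> T"
  shows "local.dim S \<le> local.dim T"
proof -
  obtain B where "B \<subseteq> S" "local.independent B" "card B = local.dim S"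
    using findim_basis[OF findim_mono[OF assms]] by metis
  thus ?thesis using findim_card_le_dim[OF assms(1), of B] assms(2) by auto
qed

lemma dim_eq_imp_eq:
  assumes "findim T" "S \<subseteq> T" "local.subspace S" "local.dim S = local.dim T"
  shows "S = T"
proof (rule ccontr)
  assume "S \<noteq> T"
  then obtain x where x: "x \<in> T" "x \<notin> S" using assms(2) by blast
  obtain B where B: "B \<subseteq> S" "local.independent B" "S \<subseteq> local.span B" "finite B" "card B = local.dim S"
    using findim_basis[OF findim_mono[OF assms(1,2)]] .
  have "local.span B = S" using B assms(3) span_minimal by blast
  hence "local.independent (insert x B)" using x B by (intro independent_insertI) auto
  hence "card (insert x B) \<le> local.dim T" using findim_card_le_dim[OF assms(1)] B x assms(2) by auto
  thus False using B x assms(4) by (subst (asm) card_insert_disjoint) auto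
qed

text \<open>Identity minus a projection onto \<open>T\<close>. Such an endomorphism serves as the
  quotient map by \<open>T\<close>, so that no quotient spaces are formed.\<close>

lemma exists_linear_with_kernel:
  assumes "local.subspace T"
  shows "\<exists>g. Vector_Spaces.linear scale scale g \<and> (\<forall>x. g x = 0 \<longleftrightarrow> x \<in> T)"
proof -
  interpret pr: vector_space_pair scale scale by unfold_locales
  have "Vector_Spaces.linear scale scale (\<lambda>x. x)" by (rule linear_ident)
  then obtain p where p: "p ` UNIV \<subseteq> T" "Vector_Spaces.linear scale scale p" "\<forall>v\<in>T. p v = v"
    using pr.linear_exists_left_inverse_on[of "\<lambda>x. x" T] assms by auto
  have "Vector_Spaces.linear scale scale (\<lambda>x. x - p x)"
    using p(2) by (intro pr.linear_compose_sub linear_ident)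
  moreover have "x - p x = 0 \<longleftrightarrow> x \<in> T" for x using p by (metis right_minus_eq range_subsetD)
  ultimately show ?thesis by (intro exI[of _ "\<lambda>x. x - p x"]) auto
qed

end

context vector_space_pair
begin

lemma rank_nullity:
  assumes lin: "Vector_Spaces.linear s1 s2 f" and U: "vs1.subspace U" "vs1.findim U"
  shows "vs1.dim U = vs2.dim (f ` U) + vs1.dim {x \<in> U. f x = 0}"
proof -
  interpret f: Vector_Spaces.linear s1 s2 f by (rule lin)
  let ?K = "{x \<in> U. f x = 0}"
  have subK: "vs1.subspace ?K"
    using U(1) by (auto simp: vs1.subspace_def f.add f.scale f.zero)
  obtain B where B: "B \<subseteq> ?K" "vs1.independent B" "?K \<subseteq> vs1.span B" "card B = vs1.dim ?K"
    using vs1.basis_exists by blast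
  obtain C where C: "B \<subseteq> C" "C \<subseteq> U" "vs1.independent C" "U \<subseteq> vs1.span C"
    using vs1.maximal_independent_subset_extend[of B U] B by blast
  have finC: "finite C" using vs1.findim_independent_finite[OF U(2) C(3,2)] .
  have spC: "vs1.span C = U" using C U(1) vs1.span_minimal by blast
  have spB: "vs1.span B = ?K" using B subK vs1.span_minimal by blast
  have dimU: "vs1.dim U = card C" using vs1.basis_card_eq_dim[OF C(2,4,3)] by simp
  let ?D = "C - B"
  have indD: "vs1.independent ?D" using C(3) vs1.independent_mono by blast
  have inj: "inj_on f (vs1.span ?D)"
  proof (subst f.inj_on_iff_eq_0[OF vs1.subspace_span], intro ballI impI)
    fix x assume x: "x \<in> vs1.span ?D" "f x = 0"
    have "x \<in> U" using x vs1.span_mono[of ?D C] spC by blast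
    hence "x \<in> vs1.span B" using x spB by auto
    moreover note x(1)
    \<comment> \<open>Both representations agree with the one in \<open>C\<close>, so it is
      supported in \<open>B\<close> and in \<open>C - B\<close> and vanishes.\<close>
    ultimately have "vs1.representation B x = vs1.representation ?D x"
      using vs1.representation_extend[OF C(3) _ C(1)] vs1.representation_extend[OF C(3), of x ?D] x
      by simp
    hence "vs1.representation ?D x b = 0" for b
      using vs1.representation_ne_zero[of B x b] vs1.representation_ne_zero[of ?D x b] by auto
    thus "x = 0" using vs1.sum_nonzero_representation_eq[OF indD x(1)] by simp
  qed
  have indf: "vs2.independent (f ` ?D)"
    using f.independent_injective_image[OF indD inj] .
  have "f ` U = vs2.span (f ` C)" using f.span_image[of C] spC by simp
  also have "\<dots> = vs2.span (f ` ?D)"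
  proof
    show "vs2.span (f ` ?D) \<subseteq> vs2.span (f ` C)" by (intro vs2.span_mono) auto
    have "f ` C \<subseteq> insert 0 (f ` ?D)" using B(1) by auto
    thus "vs2.span (f ` C) \<subseteq> vs2.span (f ` ?D)"
      using vs2.span_mono[of "f ` C" "insert 0 (f ` ?D)"] by simp
  qed
  finally have "vs2.dim (f ` U) = card (f ` ?D)"
    using vs2.dim_span_eq_card_independent[OF indf] by simp
  also have "\<dots> = card ?D"
    by (intro card_image inj_on_subset[OF inj] vs1.span_superset)
  also have "\<dots> = card C - card B" by (intro card_Diff_subset finite_subset[OF C(1) finC] C(1))
  finally show ?thesis using dimU B(4) card_mono[OF finC C(1)] by simp
qed

lemma findim_image: "Vector_Spaces.linear s1 s2 f \<Longrightarrow> vs1.findim U \<Longrightarrow> vs2.findim (f ` U)"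
proof -
  assume lin: "Vector_Spaces.linear s1 s2 f" and "vs1.findim U"
  interpret f: Vector_Spaces.linear s1 s2 f by (rule lin)
  from \<open>vs1.findim U\<close> obtain B where "finite B" "U \<subseteq> vs1.span B" unfolding vs1.findim_def by blast
  thus ?thesis unfolding vs2.findim_def using f.span_image[of B] by (intro exI[of _ "f ` B"]) auto
qed

text \<open>Rank-nullity for the map induced by \<open>f\<close> on \<open>U\<close> with values in the quotient by \<open>A\<close>.\<close>

lemma rank_nullity_mod:
  assumes lin: "Vector_Spaces.linear s1 s2 f" and U: "vs1.subspace U" "vs1.findim U"
    and A: "vs2.subspace A" "vs2.findim A"
  shows "vs1.dim U + vs2.dim A = vs1.dim {x \<in> U. f x \<in> A} + vs2.dim {a + f x | a x. a \<in> A \<and> x \<in> U}"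
proof -
  interpret f: Vector_Spaces.linear s1 s2 f by (rule lin)
  interpret p2: vector_space_pair s2 s2 by unfold_locales
  obtain g where g: "Vector_Spaces.linear s2 s2 g" "\<And>x. g x = 0 \<longleftrightarrow> x \<in> A"
    using vs2.exists_linear_with_kernel[OF A(1)] by blast
  interpret g: Vector_Spaces.linear s2 s2 g by (rule g(1))
  have lin': "Vector_Spaces.linear s1 s2 (\<lambda>x. g (f x))"
    using Vector_Spaces.linear_compose[OF lin g(1)] by (simp add: o_def)
  have 1: "vs1.dim U = vs2.dim ((\<lambda>x. g (f x)) ` U) + vs1.dim {x \<in> U. f x \<in> A}"
    using rank_nullity[OF lin' U] by (simp add: g(2))
  let ?S = "{a + f x | a x. a \<in> A \<and> x \<in> U}"
  have subS: "vs2.subspace ?S"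
    using vs2.subspace_sums[OF A(1) f.subspace_image[OF U(1)]] 
    by (rule back_subst[of "vs2.subspace"]) auto
  have fdS: "vs2.findim ?S"
  proof -
    obtain B1 B2 where "finite B1" "A \<subseteq> vs2.span B1" "finite B2" "f ` U \<subseteq> vs2.span B2"
      using A(2) findim_image[OF lin U(2)] unfolding vs2.findim_def by blast
    moreover from this have "?S \<subseteq> vs2.span (B1 \<union> B2)"
      using vs2.span_mono[of B1 "B1 \<union> B2"] vs2.span_mono[of B2 "B1 \<union> B2"]
      by (auto intro!: vs2.span_add)
    ultimately show ?thesis unfolding vs2.findim_def by blast
  qed
  have z: "0 \<in> A" "0 \<in> U" using A(1) U(1) vs2.subspace_0 vs1.subspace_0 by auto
  have im: "g ` ?S = (\<lambda>x. g (f x)) ` U"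
  proof
    have "g (a + f x) = g (f x)" if "a \<in> A" for a x using that g(2)[of a] by (simp add: g.add)
    thus "g ` ?S \<subseteq> (\<lambda>x. g (f x)) ` U" by auto
    show "(\<lambda>x. g (f x)) ` U \<subseteq> g ` ?S"
    proof (clarify)
      fix x assume "x \<in> U"
      have "0 + f x \<in> ?S" using z \<open>x \<in> U\<close> by blast
      thus "g (f x) \<in> g ` ?S" by simp
    qed
  qed
  have ker: "{y \<in> ?S. g y = 0} = A"
  proof
    show "{y \<in> ?S. g y = 0} \<subseteq> A" using g(2) by auto
    show "A \<subseteq> {y \<in> ?S. g y = 0}"
    proof
      fix a assume "a \<in> A"
      moreover have "a + f 0 \<in> ?S" using z \<open>a \<in> A\<close> by blast
      ultimately show "a \<in> {y \<in> ?S. g y = 0}" using g(2) by (simp add: f.zero)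
    qed
  qed
  have "vs2.dim ?S = vs2.dim ((\<lambda>x. g (f x)) ` U) + vs2.dim A"
    using p2.rank_nullity[OF g(1) subS fdS] im ker by simp
  thus ?thesis using 1 by simp
qed

end

section \<open>Polynomials in four variables and homogeneous components\<close>

lemma UNIV_4': "(UNIV :: 4 set) = {0, 1, 2, 3}"
proof -
  have "x = 0 \<or> x = 1 \<or> x = 2 \<or> x = 3" for x :: 4
  proof (induct x)
    case (of_int z)
    hence "0 \<le> z" "z < 4" by simp_all
    hence "z = 0 \<or> z = 1 \<or> z = 2 \<or> z = 3" by arith
    thus ?case by auto
  qed
  thus ?thesis by auto
qed

lemma sum_UNIV_4: "(\<Sum>i\<in>(UNIV :: 4 set). g i) = g 0 + g 1 + g 2 + g 3"
  unfolding UNIV_4' by (simp add: ac_simps)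

lemma all_4: "(\<forall>i::4. P i) \<longleftrightarrow> P 0 \<and> P 1 \<and> P 2 \<and> P 3"
  by (metis UNIV_4' UNIV_I empty_iff insert_iff)

definition const :: "complex \<Rightarrow> poly4" where
  "const c = Poly_Mapping.single 0 c"

lemma const_simps [simp]:
  "const 0 = 0" "const 1 = 1" "const (a + b) = const a + const b" "const (a * b) = const a * const b"
  "const (- a) = - const a" "const (a - b) = const a - const b"
  by (simp_all add: const_def single_add mult_single single_uminus single_diff)

lemma const_eq_0_iff [simp]: "const a = 0 \<longleftrightarrow> a = 0"
  by (metis const_def const_simps(1) lookup_single_eq)

lemma const_inverse: "a \<noteq> 0 \<Longrightarrow> const (inverse a) * const a = 1"
  by (simp flip: const_simps(4))

lemma lookup_const_mult: "Poly_Mapping.lookup (const c * p) m = c * Poly_Mapping.lookup p m"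
  unfolding const_def mult_map_scale_conv_mult[symmetric]
  by (cases "c = 0") (auto simp: Poly_Mapping.map.rep_eq when_def in_keys_iff)

definition cscale :: "complex \<Rightarrow> poly4 \<Rightarrow> poly4" where
  "cscale c p = const c * p"

global_interpretation V: vector_space cscale
  by unfold_locales (simp_all add: cscale_def algebra_simps)

text \<open>Degrees are integers, so that shifts such as \<open>k - n\<close> need no side
  conditions; in negative degrees only the zero polynomial is left.\<close>

definition H :: "int \<Rightarrow> poly4 set" where
  "H k = {p. \<forall>m\<in>Poly_Mapping.keys p. int (mon_degree m) = k}"

lemma mon_degree_add: "mon_degree (a + b) = mon_degree a + mon_degree b"
  by (simp add: mon_degree_def lookup_add sum.distrib)

lemma mon_degree_0 [simp]: "mon_degree 0 = 0"
  by (simp add: mon_degree_def)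

lemma H_0 [simp]: "0 \<in> H k"
  by (simp add: H_def)

lemma H_add: "p \<in> H k \<Longrightarrow> q \<in> H k \<Longrightarrow> p + q \<in> H k"
  using Poly_Mapping.keys_add[of p q] by (auto simp: H_def)

lemma H_uminus: "p \<in> H k \<Longrightarrow> - p \<in> H k"
  by (auto simp: H_def in_keys_iff)

lemma H_diff: "p \<in> H k \<Longrightarrow> q \<in> H k \<Longrightarrow> p - q \<in> H k"
  using H_add[of p k "- q"] H_uminus[of q k] by simp

lemma H_mult: "p \<in> H k \<Longrightarrow> q \<in> H l \<Longrightarrow> p * q \<in> H (k + l)"
  using keys_mult[of p q] by (fastforce simp: H_def mon_degree_add)

lemma H_mult': "p \<in> H k \<Longrightarrow> q \<in> H l \<Longrightarrow> n = k + l \<Longrightarrow> p * q \<in> H n"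
  using H_mult by auto

lemma H_const [simp]: "const c \<in> H 0"
  by (simp add: H_def const_def)

lemma H_1 [simp]: "1 \<in> H 0"
  using H_const[of 1] by simp

lemma H_const_mult: "p \<in> H k \<Longrightarrow> const c * p \<in> H k"
  using H_mult[OF H_const, of p k c] by simp

lemma H_sum: "(\<And>i. i \<in> A \<Longrightarrow> p i \<in> H k) \<Longrightarrow> sum p A \<in> H k"
  by (induction A rule: infinite_finite_induct) (auto intro: H_add)

lemma mon_degree_single [simp]: "mon_degree (Poly_Mapping.single i n) = n"
  by (simp add: mon_degree_def lookup_single when_def)

lemma H_var [simp]: "var i \<in> H 1"
  by (simp add: H_def var_def)

lemma H_power: "p \<in> H k \<Longrightarrow> p ^ n \<in> H (int n * k)"
  by (induction n) (auto intro!: H_mult' simp: algebra_simps)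

lemma H_neg: "k < 0 \<Longrightarrow> H k = {0}"
proof -
  assume "k < 0"
  hence "p = 0" if "p \<in> H k" for p using that by (force simp: H_def)
  thus ?thesis by auto
qed

lemma H_nonneg: "p \<in> H k \<Longrightarrow> p \<noteq> 0 \<Longrightarrow> 0 \<le> k"
  using H_neg[of k] by (cases "k < 0") auto

definition hcomp :: "int \<Rightarrow> poly4 \<Rightarrow> poly4" where
  "hcomp k p = Poly_Mapping.mapp (\<lambda>m c. if int (mon_degree m) = k then c else 0) p"

lemma lookup_hcomp:
  "Poly_Mapping.lookup (hcomp k p) m = (if int (mon_degree m) = k then Poly_Mapping.lookup p m else 0)"
  by (auto simp: hcomp_def lookup_mapp when_def in_keys_iff)

lemma hcomp_in_H [simp]: "hcomp k p \<in> H k"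
  by (auto simp: H_def in_keys_iff lookup_hcomp split: if_splits)

lemma hcomp_add: "hcomp k (p + q) = hcomp k p + hcomp k q"
  by (rule poly_mapping_eqI) (simp add: lookup_hcomp lookup_add)

lemma hcomp_0 [simp]: "hcomp k 0 = 0"
  by (rule poly_mapping_eqI) (simp add: lookup_hcomp)

lemma hcomp_diff: "hcomp k (p - q) = hcomp k p - hcomp k q"
  by (rule poly_mapping_eqI) (simp add: lookup_hcomp lookup_minus)

lemma hcomp_sum: "hcomp k (sum f A) = (\<Sum>i\<in>A. hcomp k (f i))"
  by (induction A rule: infinite_finite_induct) (auto simp: hcomp_add)

lemma hcomp_H: "p \<in> H k \<Longrightarrow> hcomp j p = (if j = k then p else 0)"
  by (rule poly_mapping_eqI) (auto simp: lookup_hcomp H_def in_keys_iff)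

lemma sum_hcomp:
  obtains K where "finite K" "p = (\<Sum>k\<in>K. hcomp k p)" "\<And>k. k \<notin> K \<Longrightarrow> hcomp k p = 0"
proof -
  let ?K = "(\<lambda>m. int (mon_degree m)) ` Poly_Mapping.keys p"
  have "p = (\<Sum>k\<in>?K. hcomp k p)"
    by (rule poly_mapping_eqI)
       (auto simp: lookup_sum lookup_hcomp in_keys_iff sum.delta')
  moreover have "hcomp k p = 0" if "k \<notin> ?K" for k
    using that by (intro poly_mapping_eqI) (auto simp: lookup_hcomp in_keys_iff)
  ultimately show ?thesis using that[of ?K] by auto
qed

lemma hcomp_mult_H:
  assumes "g \<in> H n"
  shows "hcomp k (a * g) = hcomp (k - n) a * g"
proof -
  obtain K where K: "finite K" "a = (\<Sum>j\<in>K. hcomp j a)" "\<And>j. j \<notin> K \<Longrightarrow> hcomp j a = 0"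
    using sum_hcomp[of a] by metis
  have "hcomp k (a * g) = (\<Sum>j\<in>K. hcomp k (hcomp j a * g))"
    by (subst K(2)) (simp add: sum_distrib_right hcomp_sum)
  also have "\<dots> = (\<Sum>j\<in>K. if j = k - n then hcomp j a * g else 0)"
    by (intro sum.cong refl, subst hcomp_H[OF H_mult[OF hcomp_in_H assms]]) auto
  also have "\<dots> = hcomp (k - n) a * g" using K(1,3) by (auto simp: sum.delta)
  finally show ?thesis .
qed

lemma dvd_H:
  assumes "a \<in> H k" "b \<in> H n" "a = c * b"
  shows "a = hcomp (k - n) c * b"
  using assms(3) hcomp_mult_H[OF assms(2), of k c] hcomp_H[OF assms(1), of k] by metis

lemma H_dvd:
  assumes "c * b \<in> H k" "b \<in> H n" "b \<noteq> 0"
  shows "c \<in> H (k - n)"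
proof -
  have "c * b = hcomp (k - n) c * b" using dvd_H[OF assms(1,2) refl] .
  hence "c = hcomp (k - n) c" using assms(3) by simp
  thus ?thesis by (metis hcomp_in_H)
qed

subsection \<open>Hilbert functions\<close>

lemma subspace_H: "V.subspace (H k)"
  by (auto simp: V.subspace_def cscale_def intro: H_add H_const_mult)

text \<open>Exponent vectors correspond to lists of four natural numbers with a given sum, counted
  by stars and bars.\<close>

lemma finite_mon: "finite {m :: monom4. int (mon_degree m) = k}"
  and card_mon: "k \<ge> 0 \<Longrightarrow> card {m :: monom4. int (mon_degree m) = k} = (nat k + 3) choose 3"
proof -
  let ?M = "{m :: monom4. int (mon_degree m) = k}"
  let ?L = "{l :: nat list. size l = 4 \<and> int (sum_list l) = k}"
  let ?f = "\<lambda>m. map (Poly_Mapping.lookup m) [0, 1, 2, 3 :: 4]"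
  have bij: "bij_betw ?f ?M ?L"
  proof (rule bij_betw_imageI)
    show "inj_on ?f ?M"
    proof (rule inj_onI)
      fix a b assume "?f a = ?f b"
      hence "\<forall>i. Poly_Mapping.lookup a i = Poly_Mapping.lookup b i" by (simp add: all_4)
      thus "a = b" by (auto intro: poly_mapping_eqI)
    qed
    show "?f ` ?M = ?L"
    proof (intro equalityI subsetI)
      fix l assume "l \<in> ?f ` ?M"
      thus "l \<in> ?L" by (auto simp: mon_degree_def sum_UNIV_4)
    next
      fix l assume l: "l \<in> ?L"
      then obtain a b c d where l4: "l = [a, b, c, d]"
        by (auto simp: numeral_eq_Suc length_Suc_conv)
      define m :: monom4 where "m = Abs_poly_mapping (\<lambda>i. if i = 0 then a else if i = 1 then b
        else if i = 2 then c else d)"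
      have lm: "Poly_Mapping.lookup m = (\<lambda>i. if i = 0 then a else if i = 1 then b
        else if i = 2 then c else d)"
        unfolding m_def by (rule lookup_Abs_poly_mapping) simp
      have "?f m = l" by (simp add: lm l4)
      moreover have "m \<in> ?M" using l by (simp add: mon_degree_def sum_UNIV_4 lm l4)
      ultimately show "l \<in> ?f ` ?M" by force
    qed
  qed
  have "?L = {l. size l = 4 \<and> sum_list l = nat k}" if "k \<ge> 0" using that by auto
  hence cL: "k \<ge> 0 \<Longrightarrow> card ?L = (nat k + 4 - 1) choose (nat k)" 
    using card_length_sum_list[of 4 "nat k"] by simp
  have "finite {l. set l \<subseteq> {..nat k} \<and> length l = 4}" by (intro finite_lists_length_eq) auto
  hence "finite ?L" by (rule finite_subset[rotated]) (use member_le_sum_list in force)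
  thus "finite ?M" using bij bij_betw_finite by blast
  show "card ?M = (nat k + 3) choose 3" if "k \<ge> 0"
    using bij_betw_same_card[OF bij] cL[OF that] binomial_symmetric[of "nat k" "nat k + 3"]
    by (simp add: add.commute)
qed

definition mon :: "monom4 \<Rightarrow> poly4" where
  "mon m = Poly_Mapping.single m 1"

lemma poly_eq_sum_mon: "p = (\<Sum>m\<in>Poly_Mapping.keys p. const (Poly_Mapping.lookup p m) * mon m)"
  by (rule poly_mapping_eqI)
     (simp add: lookup_sum lookup_const_mult mon_def lookup_single when_def in_keys_iff if_distrib
        sum.delta cong: if_cong)

lemma mon_H: "mon m \<in> H (int (mon_degree m))"
  by (simp add: mon_def H_def)

lemma inj_mon: "inj mon"
  by (auto simp: inj_def mon_def) (metis lookup_single_eq lookup_single_not_eq zero_neq_one)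

lemma H_span: "H k = V.span (mon ` {m. int (mon_degree m) = k})"
proof
  show "H k \<subseteq> V.span (mon ` {m. int (mon_degree m) = k})"
  proof
    fix p assume "p \<in> H k"
    thus "p \<in> V.span (mon ` {m. int (mon_degree m) = k})"
      by (subst poly_eq_sum_mon, intro V.span_sum)
         (auto simp: H_def simp flip: cscale_def intro: V.span_scale V.span_base)
  qed
  show "V.span (mon ` {m. int (mon_degree m) = k}) \<subseteq> H k"
    by (rule V.span_minimal) (use mon_H subspace_H in auto)
qed

lemma independent_mon: "V.independent (mon ` M)"
proof
  assume "V.dependent (mon ` M)"
  then obtain t u where t: "finite t" "t \<subseteq> mon ` M" "(\<Sum>v\<in>t. cscale (u v) v) = 0" "\<exists>v\<in>t. u v \<noteq> 0"
    unfolding V.dependent_explicit by blast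
  then obtain v where v: "v \<in> t" "u v \<noteq> 0" by blast
  then obtain m where m: "v = mon m" using t by blast
  have "0 = Poly_Mapping.lookup (\<Sum>v\<in>t. cscale (u v) v) m" using t by simp
  also have "\<dots> = (\<Sum>w\<in>t. if w = v then u v else 0)"
    unfolding lookup_sum
  proof (intro sum.cong refl)
    fix w assume "w \<in> t"
    then obtain n where "w = mon n" using t by blast
    thus "Poly_Mapping.lookup (cscale (u w) w) m = (if w = v then u v else 0)"
      using m injD[OF inj_mon, of n m]
      by (cases "n = m") (auto simp: cscale_def lookup_const_mult mon_def lookup_single when_def)
  qed
  also have "\<dots> = u v" using v t by simp
  finally show False using v by simp
qed

definition hilb :: "int \<Rightarrow> int" where
  "hilb k = int (V.dim (H k))"

lemma findim_H: "V.findim (H k)"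
  unfolding V.findim_def by (rule exI[of _ "mon ` {m. int (mon_degree m) = k}"])
    (use H_span finite_mon in auto)

lemma hilb_neg: "k < 0 \<Longrightarrow> hilb k = 0"
  using V.dim_span_eq_card_independent[OF V.independent_empty] by (simp add: hilb_def H_neg V.span_empty)

lemma hilb_nonneg: "0 \<le> hilb k"
  by (simp add: hilb_def)

text \<open>The cubic has the zeros -1, -2, -3, so it remains correct in these three negative
  degrees. This slack provides the term -3 in the degree bounds for complete intersections.\<close>

lemma hilb_eq:
  assumes "k \<ge> -3"
  shows "6 * hilb k = (k + 1) * (k + 2) * (k + 3)"
proof (cases "k \<ge> 0")
  case True
  have "V.dim (H k) = card (mon ` {m. int (mon_degree m) = k})"
    unfolding H_span by (rule V.dim_span_eq_card_independent[OF independent_mon])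
  also have "\<dots> = (nat k + 3) choose 3"
    using card_mon[OF True] by (subst card_image) (auto intro: inj_on_subset[OF inj_mon])
  finally have d: "V.dim (H k) = (nat k + 3) choose 3" .
  have ch: "6 * ((n + 3) choose 3) = (n + 1) * (n + 2) * (n + 3)" for n :: nat
  proof (induction n)
    case (Suc n)
    have "even ((n + 3) * (n + 2))" by simp
    hence c2: "2 * ((n + 3) choose 2) = (n + 3) * (n + 2)" using choose_two[of "n + 3"] by auto
    have "(Suc n + 3) choose 3 = ((n + 3) choose 3) + ((n + 3) choose 2)"
      by (simp add: numeral_3_eq_3 numeral_2_eq_2)
    hence "6 * ((Suc n + 3) choose 3) = (n + 1) * (n + 2) * (n + 3) + 3 * ((n + 3) * (n + 2))"
      using Suc c2 by simp
    thus ?case by (simp add: algebra_simps)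
  qed simp
  have "6 * hilb k = int (6 * ((nat k + 3) choose 3))" by (simp add: hilb_def d)
  also have "\<dots> = (k + 1) * (k + 2) * (k + 3)" unfolding ch using True by (simp add: algebra_simps)
  finally show ?thesis .
next
  case False
  hence "k = -1 \<or> k = -2 \<or> k = -3" using assms by auto
  thus ?thesis using hilb_neg[of k] False by auto
qed


subsection \<open>Homogeneous ideals\<close>

definition hideal :: "poly4 set \<Rightarrow> bool" where
  "hideal I \<longleftrightarrow> 0 \<in> I \<and> (\<forall>p\<in>I. \<forall>q\<in>I. p + q \<in> I) \<and> (\<forall>p\<in>I. \<forall>a. a * p \<in> I) \<and>
     (\<forall>p\<in>I. \<forall>k. hcomp k p \<in> I)"

definition addgen :: "poly4 set \<Rightarrow> poly4 \<Rightarrow> poly4 set" where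
  "addgen I g = {p + a * g | p a. p \<in> I}"

definition colon :: "poly4 set \<Rightarrow> poly4 \<Rightarrow> poly4 set" where
  "colon I g = {u. u * g \<in> I}"

text \<open>The Hilbert function of \<open>S / I\<close>.\<close>

definition codim :: "poly4 set \<Rightarrow> int \<Rightarrow> int" where
  "codim I k = hilb k - int (V.dim (I \<inter> H k))"

lemma hideal_0 [simp]: "hideal I \<Longrightarrow> 0 \<in> I"
  and hideal_add: "hideal I \<Longrightarrow> p \<in> I \<Longrightarrow> q \<in> I \<Longrightarrow> p + q \<in> I"
  and hideal_mult: "hideal I \<Longrightarrow> p \<in> I \<Longrightarrow> a * p \<in> I"
  and hideal_hcomp: "hideal I \<Longrightarrow> p \<in> I \<Longrightarrow> hcomp k p \<in> I"
  by (auto simp: hideal_def)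

lemma hideal_mult': "hideal I \<Longrightarrow> p \<in> I \<Longrightarrow> p * a \<in> I"
  using hideal_mult[of I p a] by (simp add: mult.commute)

lemma hideal_uminus: "hideal I \<Longrightarrow> p \<in> I \<Longrightarrow> - p \<in> I"
  using hideal_mult[of I p "-1"] by simp

lemma hideal_diff: "hideal I \<Longrightarrow> p \<in> I \<Longrightarrow> q \<in> I \<Longrightarrow> p - q \<in> I"
  using hideal_add[of I p "- q"] hideal_uminus[of I q] by simp

lemma hideal_sum: "hideal I \<Longrightarrow> (\<And>i. i \<in> A \<Longrightarrow> p i \<in> I) \<Longrightarrow> sum p A \<in> I"
  by (induction A rule: infinite_finite_induct) (auto intro: hideal_add)

lemma hideal_zero: "hideal {0}"
  by (simp add: hideal_def)

lemma addgenI2: "p \<in> I \<Longrightarrow> q = p + a * g \<Longrightarrow> q \<in> addgen I g"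
  by (auto simp: addgen_def)

lemma hideal_addgen:
  assumes "hideal I" "g \<in> H n"
  shows "hideal (addgen I g)"
  unfolding hideal_def
proof (intro conjI ballI allI)
  show "0 \<in> addgen I g" unfolding addgen_def using assms(1) by (force intro: exI[of _ 0])
next
  fix p q assume "p \<in> addgen I g" "q \<in> addgen I g"
  then obtain p' q' a b where "p = p' + a * g" "q = q' + b * g" "p' \<in> I" "q' \<in> I"
    by (auto simp: addgen_def)
  thus "p + q \<in> addgen I g"
    using hideal_add[OF assms(1), of p' q']
    by (intro addgenI2[of "p' + q'" _ _ "a + b"]) (auto simp: algebra_simps)
next
  fix p b assume "p \<in> addgen I g"
  then obtain p' a where "p = p' + a * g" "p' \<in> I"
    by (auto simp: addgen_def)
  thus "b * p \<in> addgen I g"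
    using hideal_mult[OF assms(1), of p' b]
    by (intro addgenI2[of "b * p'" _ _ "b * a"]) (auto simp: algebra_simps)
next
  fix p k assume "p \<in> addgen I g"
  then obtain p' a where "p = p' + a * g" "p' \<in> I"
    by (auto simp: addgen_def)
  thus "hcomp k p \<in> addgen I g" unfolding addgen_def
    using hideal_hcomp[OF assms(1), of p' k] hcomp_mult_H[OF assms(2), of k a]
    by (auto simp: hcomp_add)
qed

lemma addgen_sub: "I \<subseteq> addgen I g"
  unfolding addgen_def by (force intro: exI[of _ 0])

lemma addgen_gen: "hideal I \<Longrightarrow> g \<in> addgen I g"
  unfolding addgen_def by (force intro: exI[of _ 0] exI[of _ 1])

lemma addgen_gen_mult: "hideal I \<Longrightarrow> a * g \<in> addgen I g"
  unfolding addgen_def by (force intro: exI[of _ 0])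

lemma addgen_minimal: "hideal I' \<Longrightarrow> I \<subseteq> I' \<Longrightarrow> g \<in> I' \<Longrightarrow> addgen I g \<subseteq> I'"
  by (auto simp: addgen_def intro!: hideal_add hideal_mult)

lemma addgen_homE:
  assumes "hideal I" "g \<in> H n" "p \<in> addgen I g" "p \<in> H k"
  obtains a where "a \<in> H (k - n)" "p - a * g \<in> I"
proof -
  obtain p' a where p: "p = p' + a * g" "p' \<in> I"
    using assms(3) by (auto simp: addgen_def)
  have "p = hcomp k p' + hcomp (k - n) a * g"
    using hcomp_H[OF assms(4), of k] p(1) hcomp_mult_H[OF assms(2), of k a] by (simp add: hcomp_add)
  thus ?thesis using that[of "hcomp (k - n) a"] hideal_hcomp[OF assms(1) p(2), of k]
    by (metis add_diff_cancel_right' hcomp_in_H)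
qed

lemma addgenI: "p - a * g \<in> I \<Longrightarrow> p \<in> addgen I g"
  by (rule addgenI2[of "p - a * g" _ _ a]) auto

lemma hideal_colon:
  assumes "hideal I" "g \<in> H n"
  shows "hideal (colon I g)"
  unfolding hideal_def colon_def
proof (intro conjI ballI allI; clarsimp)
  show "0 \<in> I" using assms by simp
  show "(p + q) * g \<in> I" if "p * g \<in> I" "q * g \<in> I" for p q
    using that assms(1) by (simp add: algebra_simps hideal_add)
  show "a * p * g \<in> I" if "p * g \<in> I" for p a
    using hideal_mult[OF assms(1) that, of a] by (simp add: mult.assoc)
  show "hcomp k p * g \<in> I" if "p * g \<in> I" for p k
    using hideal_hcomp[OF assms(1) that, of "k + n"] hcomp_mult_H[OF assms(2), of "k + n" p] by simp
qed

lemma colon_sub: "hideal I \<Longrightarrow> I \<subseteq> colon I g"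
  by (auto simp: colon_def intro: hideal_mult')

lemma subspace_hideal: "hideal I \<Longrightarrow> V.subspace (I \<inter> H k)"
  using subspace_H[of k]
  by (auto simp: V.subspace_def cscale_def intro: hideal_add hideal_mult)

lemma findim_Int_H: "V.findim (I \<inter> H k)"
  using V.findim_mono[OF findim_H, of "I \<inter> H k" k] by auto

lemma codim_mono: "I \<subseteq> I' \<Longrightarrow> codim I' k \<le> codim I k"
  unfolding codim_def using V.dim_mono_findim[OF findim_Int_H, of "I \<inter> H k" I' k] by auto

lemma codim_nonneg: "0 \<le> codim I k"
  unfolding codim_def hilb_def using V.dim_mono_findim[OF findim_H, of "I \<inter> H k" k] by auto

lemma codim_le: "codim I k \<le> hilb k"
  by (simp add: codim_def)

lemma codim_neg: "k < 0 \<Longrightarrow> codim I k = 0"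
  using codim_nonneg[of I k] codim_le[of I k] hilb_neg[of k] by simp

lemma codim_eq_imp_eq:
  assumes "hideal I" "I \<subseteq> I'" "codim I k = codim I' k"
  shows "I \<inter> H k = I' \<inter> H k"
  by (rule V.dim_eq_imp_eq[OF findim_Int_H]) (use assms subspace_hideal in \<open>auto simp: codim_def\<close>)

lemma codim_eq_0_iff: "hideal I \<Longrightarrow> codim I k = 0 \<longleftrightarrow> H k \<subseteq> I"
  using codim_eq_imp_eq[of I UNIV k] by (auto simp: codim_def hilb_def Int_absorb1)

lemma codim_zero: "codim {0} k = hilb k"
proof -
  have "{0} \<inter> H k = V.span {}" by (auto simp: V.span_empty)
  thus ?thesis using V.dim_span_eq_card_independent[OF V.independent_empty] by (simp add: codim_def)
qed

lemma linear_mult: "Vector_Spaces.linear cscale cscale (\<lambda>u. u * g)"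
  by unfold_locales (simp_all add: cscale_def algebra_simps)

global_interpretation VV: vector_space_pair cscale cscale ..

text \<open>Additivity along \<open>0 \<rightarrow> (S / (I : g))(-n) \<rightarrow> S / I
  \<rightarrow> S / (I + (g)) \<rightarrow> 0\<close>, obtained from rank-nullity for multiplication
  by \<open>g\<close> modulo \<open>I\<close>.\<close>

lemma codim_addgen:
  assumes I: "hideal I" and g: "g \<in> H n"
  shows "codim (addgen I g) k = codim I k - codim (colon I g) (k - n)"
proof -
  have 1: "{u \<in> H (k - n). u * g \<in> I \<inter> H k} = colon I g \<inter> H (k - n)"
    using H_mult[OF _ g, of _ "k - n"] by (auto simp: colon_def)
  have 2: "{a + u * g | a u. a \<in> I \<inter> H k \<and> u \<in> H (k - n)} = addgen I g \<inter> H k"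
  proof (intro equalityI subsetI)
    fix p assume "p \<in> addgen I g \<inter> H k"
    then obtain a where "a \<in> H (k - n)" "p - a * g \<in> I" using addgen_homE[OF I g] by blast
    moreover have "p - a * g \<in> H k" "p = (p - a * g) + a * g"
      using \<open>p \<in> addgen I g \<inter> H k\<close> H_mult[OF \<open>a \<in> H (k - n)\<close> g] by (auto intro: H_diff)
    ultimately show "p \<in> {a + u * g | a u. a \<in> I \<inter> H k \<and> u \<in> H (k - n)}" by blast
  next
    fix p assume "p \<in> {a + u * g | a u. a \<in> I \<inter> H k \<and> u \<in> H (k - n)}"
    then obtain a u where "p = a + u * g" "a \<in> I" "a \<in> H k" "u \<in> H (k - n)" by blast
    thus "p \<in> addgen I g \<inter> H k" using H_mult[OF \<open>u \<in> H (k - n)\<close> g]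
      by (auto simp: addgen_def intro: H_add)
  qed
  show ?thesis
    using VV.rank_nullity_mod[OF linear_mult[of g] subspace_H findim_H[of "k - n"] subspace_hideal[OF I] findim_Int_H, where k1=k]
    unfolding 1 2 codim_def hilb_def by linarith
qed

subsection \<open>Regular elements and generic linear combinations\<close>

text \<open>No nonzero homogeneous element of \<open>S / I\<close> is killed by all of \<open>Z\<close>; for \<open>Z = {x}\<close> this says that \<open>x\<close> is
  regular on \<open>S / I\<close>.\<close>

definition socfree :: "poly4 set \<Rightarrow> poly4 set \<Rightarrow> bool" where
  "socfree I Z \<longleftrightarrow> (\<forall>k. \<forall>u\<in>H k. (\<forall>x\<in>Z. x * u \<in> I) \<longrightarrow> u \<in> I)"

lemma socfreeD: "socfree I Z \<Longrightarrow> u \<in> H k \<Longrightarrow> (\<And>x. x \<in> Z \<Longrightarrow> x * u \<in> I) \<Longrightarrow> u \<in> I"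
  by (auto simp: socfree_def)

lemma socfreeI: "(\<And>k u. u \<in> H k \<Longrightarrow> (\<And>x. x \<in> Z \<Longrightarrow> x * u \<in> I) \<Longrightarrow> u \<in> I) \<Longrightarrow> socfree I Z"
  by (auto simp: socfree_def)

lemma socfree_mono: "socfree I Z \<Longrightarrow> Z \<subseteq> Y \<Longrightarrow> socfree I Y"
  unfolding socfree_def by blast

lemma socfree_drop:
  assumes "hideal I" "socfree I (insert y Z)" "y \<in> I"
  shows "socfree I Z"
  by (rule socfreeI) (use socfreeD[OF assms(2)] hideal_mult'[OF assms(1,3)] in blast)

lemma socfree1D: "socfree I {x} \<Longrightarrow> u \<in> H k \<Longrightarrow> x * u \<in> I \<Longrightarrow> u \<in> I"
  by (auto simp: socfree_def)

text \<open>Numerical form of: the subscheme of projective space defined by \<open>I\<close> is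
  finite or empty.\<close>

definition bdd_codim :: "poly4 set \<Rightarrow> bool" where
  "bdd_codim I \<longleftrightarrow> (\<exists>B. \<forall>k. codim I k \<le> B)"

lemma bdd_codim_mono: "bdd_codim I \<Longrightarrow> I \<subseteq> I' \<Longrightarrow> bdd_codim I'"
  unfolding bdd_codim_def using codim_mono order_trans by metis

lemma bdd_codim_eventuallyI:
  assumes "\<And>k. k \<ge> k0 \<Longrightarrow> codim I k \<le> B"
  shows "bdd_codim I"
  unfolding bdd_codim_def
proof (rule exI, intro allI)
  fix k
  let ?S = "\<Sum>j\<in>{0..k0}. hilb j"
  have S: "?S \<ge> 0" by (intro sum_nonneg hilb_nonneg)
  consider "k \<ge> k0" | "k < 0" | "0 \<le> k" "k < k0" by linarith
  thus "codim I k \<le> \<bar>B\<bar> + ?S"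
  proof cases
    case 3
    have "codim I k \<le> hilb k" by (rule codim_le)
    also have "hilb k \<le> ?S" using 3 by (intro member_le_sum) (auto simp: hilb_nonneg)
    finally show ?thesis by simp
  qed (use assms[of k] S codim_neg[of k I] in auto)
qed

lemma codim_regular:
  assumes "hideal I" "g \<in> H n" "socfree I {g}"
  shows "codim (addgen I g) k = codim I k - codim I (k - n)"
proof -
  have "colon I g \<inter> H (k - n) = I \<inter> H (k - n)"
    using colon_sub[OF assms(1), of g] socfree1D[OF assms(3)]
    by (auto simp: colon_def mult.commute)
  hence "codim (colon I g) (k - n) = codim I (k - n)" by (simp add: codim_def)
  thus ?thesis using codim_addgen[OF assms(1,2)] by simp
qed

lemma socfree_zero: "x \<noteq> 0 \<Longrightarrow> socfree {0} {x}"
  by (auto simp: socfree_def)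

lemma socfree_zero_neq: "socfree {0} {x} \<Longrightarrow> x \<noteq> 0"
  using socfree1D[of "{0}" x 1 0] by auto

text \<open>The generators adjoined last come first: \<open>q1, q2, q3\<close> is a regular sequence if \<open>q1 \<noteq> 0\<close>,
  \<open>socfree (gen [q1]) {q2}\<close> and \<open>socfree (gen [q2, q1]) {q3}\<close>.\<close>

primrec gen :: "poly4 list \<Rightarrow> poly4 set" where
  "gen [] = {0}"
| "gen (g # gs) = addgen (gen gs) g"

definition hlist :: "poly4 list \<Rightarrow> bool" where
  "hlist gs \<longleftrightarrow> (\<forall>g\<in>set gs. \<exists>n. g \<in> H n)"

lemma hlist_simps [simp]: "hlist []" "hlist (g # gs) \<longleftrightarrow> (\<exists>n. g \<in> H n) \<and> hlist gs"
  by (auto simp: hlist_def)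

lemma hideal_gen [simp]: "hlist gs \<Longrightarrow> hideal (gen gs)"
  by (induction gs) (auto intro: hideal_addgen hideal_zero)

declare hideal_zero [simp, intro] hideal_addgen [intro]

lemma gen_gens: "hlist gs \<Longrightarrow> set gs \<subseteq> gen gs"
  by (induction gs) (use addgen_gen hideal_gen addgen_sub in \<open>auto simp: subset_iff\<close>)

lemma gen_minimal: "hideal I \<Longrightarrow> set gs \<subseteq> I \<Longrightarrow> gen gs \<subseteq> I"
  by (induction gs) (auto dest: addgen_minimal)

lemma gen_mono: "hlist ys \<Longrightarrow> set xs \<subseteq> gen ys \<Longrightarrow> gen xs \<subseteq> gen ys"
  by (intro gen_minimal) auto

lemma gen_set_eq: "hlist xs \<Longrightarrow> set xs = set ys \<Longrightarrow> gen xs = gen ys"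
proof -
  assume *: "hlist xs" "set xs = set ys"
  hence "hlist ys" by (simp add: hlist_def)
  thus ?thesis using * gen_gens gen_mono by (metis equalityI)
qed

lemma const_cancel: "hideal I \<Longrightarrow> c \<noteq> 0 \<Longrightarrow> const c * p \<in> I \<Longrightarrow> p \<in> I"
  using hideal_mult[of I "const c * p" "const (inverse c)"]
  by (simp add: const_inverse flip: mult.assoc)

lemma linear_dependence_mod:
  assumes I: "hideal I" and fin: "finite T" and u: "\<And>s. s \<in> T \<Longrightarrow> u s \<in> H k"
    and card: "int (card T) > codim I k"
  obtains a where "\<exists>s\<in>T. a s \<noteq> 0" "(\<Sum>s\<in>T. const (a s) * u s) \<in> I"
proof -
  have subI: "V.subspace I" using I by (auto simp: V.subspace_def cscale_def hideal_add hideal_mult)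
  obtain g where g: "Vector_Spaces.linear cscale cscale g" "\<And>x. g x = 0 \<longleftrightarrow> x \<in> I"
    using V.exists_linear_with_kernel[OF subI] by blast
  interpret g: Vector_Spaces.linear cscale cscale g by (rule g(1))
  have "{x \<in> H k. g x = 0} = I \<inter> H k" using g(2) by auto
  hence dim: "int (V.dim (g ` H k)) = codim I k"
    using VV.rank_nullity[OF g(1) subspace_H findim_H, of k] by (simp add: codim_def hilb_def)
  have fdg: "V.findim (g ` H k)" using VV.findim_image[OF g(1) findim_H] .
  show ?thesis
  proof (cases "inj_on (\<lambda>s. g (u s)) T")
    case False
    then obtain s t where st: "s \<in> T" "t \<in> T" "s \<noteq> t" "g (u s) = g (u t)" by (auto simp: inj_on_def)
    define a where "a = (\<lambda>r. if r = s then 1 else if r = t then -1 else (0::complex))"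
    have "(\<Sum>r\<in>T. const (a r) * u r) = (\<Sum>r\<in>{s, t}. const (a r) * u r)"
      using st fin by (intro sum.mono_neutral_right) (auto simp: a_def)
    also have "\<dots> = u s - u t" using st by (simp add: a_def)
    finally have "(\<Sum>r\<in>T. const (a r) * u r) \<in> I" using g.diff[of "u s" "u t"] g(2) st by simp
    moreover have "a s \<noteq> 0" by (simp add: a_def)
    ultimately show ?thesis using that st by blast
  next
    case True
    let ?W = "(\<lambda>s. g (u s)) ` T"
    have cW: "card ?W = card T" using card_image[OF True] .
    have "?W \<subseteq> g ` H k" using u by auto
    hence "V.dependent ?W" using V.findim_card_le_dim[OF fdg, of ?W] dim cW card by auto
    then obtain b where b: "\<exists>v\<in>?W. b v \<noteq> 0" "(\<Sum>v\<in>?W. cscale (b v) v) = 0"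
      using V.dependent_finite[of ?W] fin by auto
    have "(\<Sum>s\<in>T. cscale (b (g (u s))) (g (u s))) = 0"
      using b(2) by (simp add: sum.reindex[OF True])
    hence "g (\<Sum>s\<in>T. cscale (b (g (u s))) (u s)) = 0" by (simp add: g.sum g.scale)
    hence "(\<Sum>s\<in>T. const (b (g (u s))) * u s) \<in> I" by (simp add: g(2) cscale_def)
    thus ?thesis using that[of "\<lambda>s. b (g (u s))"] b(1) by blast
  qed
qed

text \<open>The \<open>q i\<close> are treated one after another: multiplying by the highest power
  of \<open>q i\<close> that does not kill the element keeps everything achieved for the earlier
  ones.\<close>

lemma nilpotent_killed:
  assumes I: "hideal I" and u: "u \<in> H k" "u \<notin> I"
    and A: "finite A" "\<And>i. i \<in> A \<Longrightarrow> q i \<in> H (n i)" "\<And>i. i \<in> A \<Longrightarrow> \<exists>N. q i ^ N * u \<in> I"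
  shows "\<exists>b k'. b * u \<in> H k' \<and> b * u \<notin> I \<and> (\<forall>i\<in>A. q i * (b * u) \<in> I)"
  using A
proof (induction A rule: finite_induct)
  case empty
  thus ?case using u by (intro exI[of _ 1] exI[of _ k]) auto
next
  case (insert a A)
  then obtain b k' where b: "b * u \<in> H k'" "b * u \<notin> I" "\<And>i. i \<in> A \<Longrightarrow> q i * (b * u) \<in> I" by auto
  obtain M where "q a ^ M * u \<in> I" using insert.prems by blast
  hence ex: "q a ^ M * (b * u) \<in> I" using hideal_mult[OF I, of "q a ^ M * u" b] by (simp add: mult_ac)
  define N where "N = (LEAST N. q a ^ N * (b * u) \<in> I)"
  have N: "q a ^ N * (b * u) \<in> I" unfolding N_def
    by (rule LeastI[of "\<lambda>N. q a ^ N * (b * u) \<in> I" M]) (rule ex)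
  hence "N \<noteq> 0" using b by (metis mult_1 power_0)
  then obtain L where L: "N = Suc L" using not0_implies_Suc by blast
  have nL: "q a ^ L * (b * u) \<notin> I" using not_less_Least[of L "\<lambda>N. q a ^ N * (b * u) \<in> I"] L N_def by auto
  show ?case
  proof (intro exI[of _ "q a ^ L * b"] exI[of _ "int L * n a + k'"] conjI ballI)
    show "q a ^ L * b * u \<in> H (int L * n a + k')"
      using H_mult[OF H_power[OF insert.prems(1)[of a]] b(1)] by (simp add: mult.assoc)
    show "q a ^ L * b * u \<notin> I" using nL by (simp add: mult.assoc)
    fix i assume "i \<in> insert a A"
    thus "q i * (q a ^ L * b * u) \<in> I"
      using N L hideal_mult[OF I b(3), of i "q a ^ L"] by (auto simp: mult_ac)
  qed
qed

text \<open>Infinitely many bad parameters \<open>s\<close> give, in one degree, infinitely many elements \<open>u\<^sub>s\<close> of the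
  finite-dimensional space \<open>H k / I\<close>, killed by \<open>p + s q\<close>.  Multiplying a linear relation between them by
  all but one of the \<open>p + s q\<close> isolates one \<open>u\<^sub>s\<close>, on which \<open>p\<close> acts as \<open>- s q\<close>; hence \<open>q\<close> is nilpotent on it.\<close>

lemma socfree_pencil:
  assumes I: "hideal I" and A: "finite A" "\<And>i. i \<in> A \<Longrightarrow> q i \<in> H (n i)"
    and socfree: "socfree I (Z \<union> p ` A \<union> q ` A)"
  shows "countable {s. \<not> socfree I (Z \<union> (\<lambda>i. p i + const s * q i) ` A)}" (is "countable ?S")
proof (rule ccontr)
  assume unc: "uncountable ?S"
  define Q where "Q s k u \<longleftrightarrow> u \<in> H k \<and> u \<notin> I \<and> (\<forall>x\<in>Z. x * u \<in> I) \<and>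
      (\<forall>i\<in>A. (p i + const s * q i) * u \<in> I)" for s k u
  have "\<forall>s\<in>?S. \<exists>ku. Q s (fst ku) (snd ku)"
    unfolding socfree_def Q_def by auto
  from bchoice[OF this] obtain F where "\<forall>s\<in>?S. Q s (fst (F s)) (snd (F s))" by blast
  moreover define K U where "K = fst \<circ> F" and "U = snd \<circ> F"
  ultimately have "\<And>s. s \<in> ?S \<Longrightarrow> Q s (K s) (U s)" by simp
  hence KU: "U s \<in> H (K s) \<and> U s \<notin> I \<and> (\<forall>x\<in>Z. x * U s \<in> I) \<and>
      (\<forall>i\<in>A. (p i + const s * q i) * U s \<in> I)" if "s \<in> ?S" for s
    using that unfolding Q_def by blast
  \<comment> \<open>There are only countably many degrees; uncountability serves to find infinitely
    many bad parameters in one of them.\<close>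
  have "\<exists>k. infinite {s \<in> ?S. K s = k}"
  proof (rule ccontr)
    assume "\<nexists>k. infinite {s \<in> ?S. K s = k}"
    hence "countable (\<Union>k. {s \<in> ?S. K s = k})" by (intro countable_UN) (auto intro: countable_finite)
    moreover have "(\<Union>k. {s \<in> ?S. K s = k}) = ?S" by auto
    ultimately show False using unc by simp
  qed
  then obtain k where k: "infinite {s \<in> ?S. K s = k}" by blast
  obtain T where T: "finite T" "T \<subseteq> {s \<in> ?S. K s = k}" "card T = Suc (nat (codim I k))"
    using infinite_arbitrarily_large[OF k] by blast
  have TS: "s \<in> ?S" "K s = k" if "s \<in> T" for s using T(2) that by auto
  have U: "U s \<in> H k" "U s \<notin> I" "\<And>x. x \<in> Z \<Longrightarrow> x * U s \<in> I"
    "\<And>i. i \<in> A \<Longrightarrow> (p i + const s * q i) * U s \<in> I" if "s \<in> T" for s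
    using KU[OF TS(1)[OF that]] TS(2)[OF that] by auto
  obtain a where a: "\<exists>s\<in>T. a s \<noteq> 0" "(\<Sum>s\<in>T. const (a s) * U s) \<in> I"
    using linear_dependence_mod[OF I T(1), of U k] U(1) T(3) codim_nonneg[of I k] by auto
  then obtain s0 where s0: "s0 \<in> T" "a s0 \<noteq> 0" by blast
  let ?u = "U s0"
  have nil: "\<exists>N. q i ^ N * ?u \<in> I" if i: "i \<in> A" for i
  proof -
    let ?l = "\<lambda>s. p i + const s * q i"
    let ?P = "\<lambda>F. \<Prod>t\<in>F. ?l t"
    let ?F = "T - {s0}"
    have fin: "finite ?F" using T(1) by simp
    have kill: "?P ?F * U s \<in> I" if "s \<in> ?F" for s
    proof -
      have "?P ?F * U s = ?P (?F - {s}) * (?l s * U s)"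
        using prod.remove[OF fin that, of ?l] by (simp add: mult_ac)
      moreover have "?l s * U s \<in> I" using that i U(4) by blast
      ultimately show ?thesis by (simp only: hideal_mult[OF I])
    qed
    have "?P ?F * (\<Sum>s\<in>T. const (a s) * U s) \<in> I" by (rule hideal_mult[OF I a(2)])
    also have "?P ?F * (\<Sum>s\<in>T. const (a s) * U s) = (\<Sum>s\<in>T. const (a s) * (?P ?F * U s))"
      unfolding sum_distrib_left by (intro sum.cong refl mult.left_commute)
    also have "\<dots> = const (a s0) * (?P ?F * ?u) + (\<Sum>s\<in>?F. const (a s) * (?P ?F * U s))"
      by (rule sum.remove[OF T(1) s0(1)])
    finally have "const (a s0) * (?P ?F * ?u) \<in> I"
      using hideal_sum[OF I, of ?F "\<lambda>s. const (a s) * (?P ?F * U s)"] kill hideal_mult[OF I]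
        hideal_diff[OF I] by (metis (no_types, lifting) add_diff_cancel_right')
    hence PF: "?P ?F * ?u \<in> I" using s0(2) const_cancel[OF I] by blast
    have "?P F * ?u - const (\<Prod>t\<in>F. t - s0) * q i ^ card F * ?u \<in> I" if "finite F" for F
      using that
    proof (induction F rule: finite_induct)
      case (insert t F)
      let ?c = "const (\<Prod>t\<in>F. t - s0)"
      have "?P (insert t F) * ?u - const (\<Prod>t\<in>insert t F. t - s0) * q i ^ card (insert t F) * ?u =
        ?l t * (?P F * ?u - ?c * q i ^ card F * ?u) + ?c * q i ^ card F * (?l s0 * ?u)"
        using insert(1,2) by (simp add: algebra_simps)
      thus ?case using hideal_add[OF I hideal_mult[OF I insert(3)] hideal_mult[OF I U(4)[OF s0(1) i]]]
        by metis
    qed (simp add: I)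
    from hideal_diff[OF I PF this[OF fin]]
    have "const (\<Prod>t\<in>?F. t - s0) * (q i ^ card ?F * ?u) \<in> I" by (simp add: mult.assoc)
    moreover have "(\<Prod>t\<in>?F. t - s0) \<noteq> 0" using fin by (simp add: prod_zero_iff)
    ultimately show ?thesis using const_cancel[OF I] by blast
  qed
  obtain b k' where b: "b * ?u \<in> H k'" "b * ?u \<notin> I" "\<And>i. i \<in> A \<Longrightarrow> q i * (b * ?u) \<in> I"
    using nilpotent_killed[OF I U(1,2)[OF s0(1)], of A q n] A nil by blast
  have "x * (b * ?u) \<in> I" if "x \<in> Z \<union> p ` A \<union> q ` A" for x
  proof -
    from that consider "x \<in> Z" | i where "i \<in> A" "x = q i" | i where "i \<in> A" "x = p i" by blast
    thus ?thesis
    proof cases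
      case 1
      thus ?thesis using hideal_mult[OF I U(3)[OF s0(1)], of x b] by (simp add: mult_ac)
    next
      case 3
      have "p i * (b * ?u) = b * ((p i + const s0 * q i) * ?u) - const s0 * (q i * (b * ?u))"
        by (simp add: algebra_simps)
      thus ?thesis using 3 hideal_diff[OF I hideal_mult[OF I U(4)[OF s0(1) 3(1)]] hideal_mult[OF I b(3)[OF 3(1)]]]
        by metis
    qed (use b in auto)
  qed
  thus False using socfreeD[OF socfree b(1)] b(2) by blast
qed

lemma socfree_pencil1:
  assumes "hideal I" "q \<in> H n" "socfree I (insert p (insert q Z))"
  shows "countable {s. \<not> socfree I (insert (p + const s * q) Z)}"
  using socfree_pencil[OF assms(1), of "{()}" "\<lambda>_. q" "\<lambda>_. n" Z "\<lambda>_. p"] assms(2,3)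
  by (simp add: insert_commute)

lemma complex_avoid_countable:
  assumes "countable (S :: complex set)"
  shows "\<exists>s. s \<notin> S"
proof (rule ccontr)
  assume "\<nexists>s. s \<notin> S"
  hence "S = UNIV" by auto
  hence "countable (range complex_of_real)" using assms countable_subset[of "range complex_of_real" UNIV] by simp
  hence "countable (UNIV :: real set)" using countable_image_inj_on[of complex_of_real UNIV]
    by (simp add: inj_on_def)
  thus False using uncountable_UNIV_real by simp
qed

lemma socfree_pencil_ex:
  assumes "hideal I" "q \<in> H n" "socfree I (insert p (insert q Z))"
  shows "\<exists>s. socfree I (insert (p + const s * q) Z)"
  using complex_avoid_countable[OF socfree_pencil1[OF assms]] by simp

lemma socfree_combination:
  assumes "hideal I" "q2 \<in> H n" "q3 \<in> H n" "q4 \<in> H n" "socfree I {q1, q2, q3, q4}"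
  shows "\<exists>s2 s3 s4. socfree I {q1 + const s2 * q2 + const s3 * q3 + const s4 * q4}"
proof -
  obtain s2 where "socfree I {q1 + const s2 * q2, q3, q4}"
    using socfree_pencil_ex[OF assms(1,2), of q1 "{q3, q4}"] assms(5) by auto
  then obtain s3 where "socfree I {q1 + const s2 * q2 + const s3 * q3, q4}"
    using socfree_pencil_ex[OF assms(1,3), of "q1 + const s2 * q2" "{q4}"] by auto
  then obtain s4 where "socfree I {q1 + const s2 * q2 + const s3 * q3 + const s4 * q4}"
    using socfree_pencil_ex[OF assms(1,4), of "q1 + const s2 * q2 + const s3 * q3" "{}"] by auto
  thus ?thesis by blast
qed

subsection \<open>Exchange of regular elements\<close>

lemma addgen_commute: "addgen (addgen A x) y = addgen (addgen A y) x"
proof -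
  have "addgen (addgen A x) y \<subseteq> addgen (addgen A y) x" for x y
  proof
    fix p assume "p \<in> addgen (addgen A x) y"
    then obtain q a b where "p = q + a * x + b * y" "q \<in> A" by (auto simp: addgen_def)
    thus "p \<in> addgen (addgen A y) x"
      by (intro addgenI2[of "q + b * y" _ _ a] addgenI2[of q]) (auto simp: algebra_simps)
  qed
  thus ?thesis by blast
qed

text \<open>Write \<open>x * u = w * y\<close> modulo \<open>A\<close>. As \<open>y\<close> is
  regular modulo \<open>(A, x)\<close>, \<open>w\<close> is a multiple of \<open>x\<close> modulo
  \<open>A\<close>, and \<open>x\<close> cancels.\<close>

lemma socfree_swap:
  assumes A: "hideal A" "x \<in> H a" "y \<in> H b" and socfree: "socfree A {x}" "socfree (addgen A x) {y}"
  shows "socfree (addgen A y) {x}"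
proof (rule socfreeI)
  fix k u assume u: "u \<in> H k" and "\<And>z. z \<in> {x} \<Longrightarrow> z * u \<in> addgen A y"
  hence "x * u \<in> addgen A y" by simp
  then obtain w where w: "w \<in> H (a + k - b)" "x * u - w * y \<in> A"
    using addgen_homE[OF A(1,3) _ H_mult[OF A(2) u]] by blast
  have "y * w \<in> addgen A x"
    using hideal_uminus[OF A(1) w(2)] by (intro addgenI[of _ u]) (simp add: algebra_simps)
  hence "w \<in> addgen A x" using socfree1D[OF socfree(2) w(1)] by blast
  then obtain v where v: "v \<in> H (a + k - b - a)" "w - v * x \<in> A"
    using addgen_homE[OF A(1,2) _ w(1)] by blast
  have "x * (u - v * y) = (x * u - w * y) + y * (w - v * x)" by (simp add: algebra_simps)
  hence "x * (u - v * y) \<in> A" using hideal_add[OF A(1) w(2) hideal_mult[OF A(1) v(2)]] by simp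
  moreover have "u - v * y \<in> H k" by (intro H_diff u H_mult'[OF v(1) A(3)]) simp
  ultimately have "u - v * y \<in> A" using socfree1D[OF socfree(1)] by blast
  thus "u \<in> addgen A y" by (rule addgenI)
qed

text \<open>From \<open>y u = x v\<close> modulo \<open>A\<close>: \<open>v\<close> replaces \<open>u\<close> when \<open>x\<close> is exchanged for \<open>y\<close>.\<close>

lemma exchange:
  assumes A: "hideal A" "x \<in> H a" "y \<in> H b" and socfree: "socfree A {x}" "socfree A {y}"
    and Z: "\<And>z. z \<in> Z \<Longrightarrow> \<exists>n. z \<in> H n" "\<And>z. z \<in> Z \<Longrightarrow> z * u \<in> addgen A x" "y \<in> Z"
    and u: "u \<in> H k" "u \<notin> addgen A x"
  obtains v k' where "v \<in> H k'" "v \<notin> addgen A y" "\<And>z. z \<in> Z \<Longrightarrow> z * v \<in> addgen A y"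
proof -
  obtain v where v: "v \<in> H (b + k - a)" "y * u - v * x \<in> A"
    using addgen_homE[OF A(1,2) Z(2)[OF Z(3)] H_mult[OF A(3) u(1)]] by blast
  have "v \<notin> addgen A y"
  proof
    assume "v \<in> addgen A y"
    then obtain w where w: "w \<in> H (b + k - a - b)" "v - w * y \<in> A"
      using addgen_homE[OF A(1,3) _ v(1)] by blast
    have "y * (u - w * x) = (y * u - v * x) + x * (v - w * y)" by (simp add: algebra_simps)
    hence "y * (u - w * x) \<in> A" using hideal_add[OF A(1) v(2) hideal_mult[OF A(1) w(2)]] by simp
    moreover have "u - w * x \<in> H k" by (intro H_diff u H_mult'[OF w(1) A(2)]) simp
    ultimately have "u - w * x \<in> A" using socfree1D[OF socfree(2)] by blast
    thus False using u(2) addgenI by blast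
  qed
  moreover have "z * v \<in> addgen A y" if z: "z \<in> Z" for z
  proof -
    obtain n where n: "z \<in> H n" using Z(1)[OF z] by blast
    obtain w where w: "w \<in> H (n + k - a)" "z * u - w * x \<in> A"
      using addgen_homE[OF A(1,2) Z(2)[OF z] H_mult[OF n u(1)]] by blast
    have "x * (z * v - w * y) = y * (z * u - w * x) - z * (y * u - v * x)" by (simp add: algebra_simps)
    hence "x * (z * v - w * y) \<in> A"
      using hideal_diff[OF A(1) hideal_mult[OF A(1) w(2)] hideal_mult[OF A(1) v(2)]] by simp
    moreover have "z * v - w * y \<in> H (n + b + k - a)"
      by (intro H_diff H_mult'[OF n v(1)] H_mult'[OF w(1) A(3)]) simp_all
    ultimately have "z * v - w * y \<in> A" using socfree1D[OF socfree(1)] by blast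
    thus ?thesis by (rule addgenI)
  qed
  ultimately show ?thesis using that v(1) by blast
qed


subsection \<open>Coordinate systems and points\<close>

lemma mon_mult: "mon (a + b) = mon a * mon b"
  by (simp add: mon_def mult_single)

lemma mon_split:
  assumes "mon_degree m \<noteq> 0"
  shows "\<exists>i m'. mon m = mon m' * var i \<and> mon_degree m = Suc (mon_degree m')"
proof -
  obtain i where i: "Poly_Mapping.lookup m i \<noteq> 0" using assms by (auto simp: mon_degree_def)
  define m' where "m' = m - Poly_Mapping.single i 1"
  have m: "m = m' + Poly_Mapping.single i 1" unfolding m'_def
    using i by (intro poly_mapping_eqI) (auto simp: lookup_add lookup_minus lookup_single when_def)
  have "mon_degree m = Suc (mon_degree m')" unfolding m by (simp add: mon_degree_add)
  moreover have "mon m = mon m' * var i" using m by (metis mon_mult mon_def var_def)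
  ultimately show ?thesis by blast
qed

lemma H_sub_vars:
  assumes "hideal I" "\<And>i. var i \<in> I" "k \<ge> 1"
  shows "H k \<subseteq> I"
proof
  fix p assume p: "p \<in> H k"
  have "mon m \<in> I" if "m \<in> Poly_Mapping.keys p" for m
  proof -
    have "mon_degree m \<noteq> 0" using p that assms(3) by (auto simp: H_def)
    thus ?thesis using mon_split[of m] hideal_mult[OF assms(1,2)] by auto
  qed
  thus "p \<in> I"
    by (subst poly_eq_sum_mon) (intro hideal_sum hideal_mult assms(1))
qed

text \<open>Adjoining a linear form lowers the Hilbert function at most to its first difference, with equality only
  if the form is regular.\<close>

lemma regular_step:
  assumes I: "hideal I" "y \<in> H 1"
    and b': "\<And>k. codim (addgen I y) k \<le> b' k"
    and b: "\<And>k. b k = b' k + b (k - 1)" "\<And>k. k < 0 \<Longrightarrow> b k = 0"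
  shows "codim I k \<le> b k"
    and "(\<And>k. codim I k = b k) \<Longrightarrow> (\<forall>k. codim (addgen I y) k = b' k) \<and> socfree I {y}"
proof -
  have le: "codim (colon I y) j \<le> codim I j" for j by (intro codim_mono colon_sub I)
  have rec: "codim I k = codim (addgen I y) k + codim (colon I y) (k - 1)" for k
    using codim_addgen[OF I] by simp
  have "codim I k \<le> b k" if "k \<ge> -1" for k
    using that
  proof (induction k rule: int_ge_induct)
    case base
    thus ?case using codim_neg[of "-1" I] b(2)[of "-1"] by simp
  next
    case (step k)
    thus ?case using rec[of "k + 1"] le[of k] b' b(1)[of "k + 1"] by (smt (verit) add_diff_cancel_right')
  qed
  thus "codim I k \<le> b k" using codim_neg[of k I] b(2)[of k] by (cases "k \<ge> -1") auto
  assume eq: "\<And>k. codim I k = b k"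
  have e: "codim (addgen I y) k = b' k" and e2: "codim (colon I y) (k - 1) = codim I (k - 1)" for k
    using rec[of k] le[of "k - 1"] b'[of k] b(1)[of k] eq[of k] eq[of "k - 1"] by linarith+
  have "u \<in> I" if "u \<in> H k" "y * u \<in> I" for k u
    using codim_eq_imp_eq[OF I(1) colon_sub[OF I(1)], of k y] e2[of "k + 1"] that
    by (auto simp: colon_def mult.commute)
  thus "(\<forall>k. codim (addgen I y) k = b' k) \<and> socfree I {y}" using e by (auto simp: socfree_def)
qed

text \<open>Linear coordinate systems, encoded by the ideal that they generate; this avoids changes
  of variables as ring automorphisms.\<close>

definition coords :: "poly4 \<Rightarrow> poly4 \<Rightarrow> poly4 \<Rightarrow> poly4 \<Rightarrow> bool" where
  "coords y1 y2 y3 y4 \<longleftrightarrow> y1 \<in> H 1 \<and> y2 \<in> H 1 \<and> y3 \<in> H 1 \<and> y4 \<in> H 1 \<and>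
     (\<forall>i. var i \<in> gen [y4, y3, y2, y1])"

lemma coords_H: "coords y1 y2 y3 y4 \<Longrightarrow> y1 \<in> H 1 \<and> y2 \<in> H 1 \<and> y3 \<in> H 1 \<and> y4 \<in> H 1"
  by (simp add: coords_def)

text \<open>The last quotient is at most one-dimensional, concentrated in degree 0. Summing up, this
  bounds the Hilbert functions of the earlier quotients; for the zero ideal the bound is
  \<open>hilb\<close> and is attained, so every step is an equality, which forces
  regularity.\<close>

lemma coords_regular:
  assumes "coords y1 y2 y3 y4"
  shows "y1 \<noteq> 0" "socfree (gen [y1]) {y2}" "socfree (gen [y2, y1]) {y3}" "socfree (gen [y3, y2, y1]) {y4}"
proof -
  have y: "y1 \<in> H 1" "y2 \<in> H 1" "y3 \<in> H 1" "y4 \<in> H 1" and v: "\<And>i. var i \<in> gen [y4, y3, y2, y1]"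
    using assms by (auto simp: coords_def)
  have hl: "\<exists>n. y1 \<in> H n" "\<exists>n. y2 \<in> H n" "\<exists>n. y3 \<in> H n" "\<exists>n. y4 \<in> H n" using y by blast+
  note hi = hideal_zero hideal_gen[of "[y1]"] hideal_gen[of "[y2, y1]"] hideal_gen[of "[y3, y2, y1]"]
    hideal_gen[of "[y4, y3, y2, y1]"]
  \<comment> \<open>The iterated differences of \<open>hilb\<close> are the Hilbert functions to be
    expected for a regular sequence of linear forms.\<close>
  define b1 b2 b3 b4 where "b1 k = hilb k - hilb (k - 1)" and "b2 k = b1 k - b1 (k - 1)"
    and "b3 k = b2 k - b2 (k - 1)" and "b4 k = b3 k - b3 (k - 1)" for k
  have neg: "hilb k = 0" "b1 k = 0" "b2 k = 0" "b3 k = 0" "b4 k = 0" if "k < 0" for k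
    using that hilb_neg by (auto simp: b1_def b2_def b3_def b4_def)
  have c4: "codim (gen [y4, y3, y2, y1]) k \<le> b4 k" for k
  proof -
    consider "k < 0" | "k = 0" | "k \<ge> 1" by linarith
    thus ?thesis
    proof cases
      case 1
      thus ?thesis using codim_neg neg by simp
    next
      case 2
      have "b4 0 = hilb 0" using hilb_neg by (simp add: b1_def b2_def b3_def b4_def)
      thus ?thesis using codim_le 2 by metis
    next
      case 3
      hence "codim (gen [y4, y3, y2, y1]) k = 0"
        using codim_eq_0_iff[OF hi(5)] H_sub_vars[OF hi(5) v] hl by (simp del: gen.simps)
      \<comment> \<open>The fourth difference of a cubic; the lowest argument is
        \<open>k - 4 \<ge> -3\<close>, just within the range of \<open>hilb_eq\<close>.\<close>
      moreover have "6 * b4 k = 0"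
        unfolding b1_def b2_def b3_def b4_def right_diff_distrib
        using 3 by (subst hilb_eq, simp)+ (simp add: algebra_simps)
      ultimately show ?thesis by simp
    qed
  qed
  have r3: "b3 k = b4 k + b3 (k - 1)" and r2: "b2 k = b3 k + b2 (k - 1)" and r1: "b1 k = b2 k + b1 (k - 1)"
    and r0: "hilb k = b1 k + hilb (k - 1)" for k
    by (simp_all add: b4_def b3_def b2_def b1_def)
  note s3 = regular_step[of "gen [y3, y2, y1]" y4 b4 b3, OF hi(4) y(4) _ r3 neg(4)]
  note s2 = regular_step[of "gen [y2, y1]" y3 b3 b2, OF hi(3) y(3) _ r2 neg(3)]
  note s1 = regular_step[of "gen [y1]" y2 b2 b1, OF hi(2) y(2) _ r1 neg(2)]
  note s0 = regular_step[of "gen []" y1 b1 hilb, OF _ y(1) _ r0 neg(1)]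
  have c3: "codim (gen [y3, y2, y1]) k \<le> b3 k" for k using s3(1) c4 hl by simp
  have c2: "codim (gen [y2, y1]) k \<le> b2 k" for k using s2(1) c3 hl by simp
  have c1: "codim (gen [y1]) k \<le> b1 k" for k using s1(1) c2 hl by simp
  \<comment> \<open>Equality holds for the zero ideal and is now passed on from each quotient to the
    next.\<close>
  have e1: "codim (gen [y1]) k = b1 k" "socfree {0} {y1}" for k
    using s0(2) c1 codim_zero hideal_zero by auto
  have e2: "codim (gen [y2, y1]) k = b2 k" "socfree (gen [y1]) {y2}" for k
    using s1(2)[OF _ c2[unfolded gen.simps(2)[of y2]]] e1 hl by auto
  have e3: "codim (gen [y3, y2, y1]) k = b3 k" "socfree (gen [y2, y1]) {y3}" for k
    using s2(2)[OF _ c3[unfolded gen.simps(2)[of y3]]] e2 hl by auto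
  show "y1 \<noteq> 0" using e1(2) socfree_zero_neq by blast
  show "socfree (gen [y1]) {y2}" by fact
  show "socfree (gen [y2, y1]) {y3}" by fact
  show "socfree (gen [y3, y2, y1]) {y4}"
    using s3(2)[OF _ c4[unfolded gen.simps(2)[of y4]]] e3 hl by auto
qed

lemma coordsI:
  assumes "y1 \<in> H 1" "y2 \<in> H 1" "y3 \<in> H 1" "y4 \<in> H 1"
    and "\<And>I. hideal I \<Longrightarrow> {y1, y2, y3, y4} \<subseteq> I \<Longrightarrow> range var \<subseteq> I"
  shows "coords y1 y2 y3 y4"
proof -
  have "hlist [y4, y3, y2, y1]" using assms by (auto simp: hlist_def)
  thus ?thesis unfolding coords_def
    using assms(5)[of "gen [y4, y3, y2, y1]"] gen_gens[of "[y4, y3, y2, y1]"] assms(1-4)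
    by (auto simp del: gen.simps)
qed

lemma coords_combination:
  assumes "coords y1 y2 y3 y4"
  shows "coords (y1 + const s * y2 + const t * y3 + const r * y4) y2 y3 y4"
proof (rule coordsI)
  note y = coords_H[OF assms]
  show "y1 + const s * y2 + const t * y3 + const r * y4 \<in> H 1" using y by (intro H_add H_const_mult) auto
  fix I assume I: "hideal I" "{y1 + const s * y2 + const t * y3 + const r * y4, y2, y3, y4} \<subseteq> I"
  have "(y1 + const s * y2 + const t * y3 + const r * y4) - const s * y2 - const t * y3 - const r * y4 \<in> I"
    using I by (intro hideal_diff hideal_mult) auto
  hence "set [y4, y3, y2, y1] \<subseteq> I" using I by simp
  hence "gen [y4, y3, y2, y1] \<subseteq> I" by (rule gen_minimal[OF I(1)])
  thus "range var \<subseteq> I" using assms by (auto simp: coords_def)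
qed (use coords_H[OF assms] in auto)

lemma coords_perm:
  assumes "coords y1 y2 y3 y4" "{z1, z2, z3, z4} = {y1, y2, y3, y4}"
  shows "coords z1 z2 z3 z4"
proof (rule coordsI)
  have "x \<in> H 1" if "x \<in> {z1, z2, z3, z4}" for x using that coords_H[OF assms(1)] assms(2) by auto
  thus "z1 \<in> H 1" "z2 \<in> H 1" "z3 \<in> H 1" "z4 \<in> H 1" by auto
  fix I assume I: "hideal I" "{z1, z2, z3, z4} \<subseteq> I"
  hence "set [y4, y3, y2, y1] \<subseteq> I" using assms(2) by auto
  hence "gen [y4, y3, y2, y1] \<subseteq> I" by (rule gen_minimal[OF I(1)])
  thus "range var \<subseteq> I" using assms(1) by (auto simp: coords_def)
qed

section \<open>Eigenvectors modulo an ideal with bounded Hilbert function\<close>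

definition homogenization :: "nat \<Rightarrow> poly4 \<Rightarrow> poly4 \<Rightarrow> complex poly \<Rightarrow> poly4" where
  "homogenization D x l P = (\<Sum>j\<le>D. const (coeff P j) * x ^ j * l ^ (D - j))"

lemma homogenization_H:
  assumes "x \<in> H 1" "l \<in> H 1"
  shows "homogenization D x l P \<in> H (int D)"
  unfolding homogenization_def
proof (intro H_sum)
  fix j assume "j \<in> {..D}"
  thus "const (coeff P j) * x ^ j * l ^ (D - j) \<in> H (int D)"
    using H_mult[OF H_const_mult[OF H_power[OF assms(1)]] H_power[OF assms(2)], of "coeff P j" j "D - j"]
    by simp
qed

lemma homogenization_mult:
  assumes "degree Q \<le> D"
  shows "homogenization (Suc D) x l ([:- z, 1:] * Q) = (x - const z * l) * homogenization D x l Q"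
proof -
  have 1: "homogenization (Suc D) x l (pCons 0 Q) = x * homogenization D x l Q"
    unfolding homogenization_def sum.atMost_Suc_shift by (simp add: sum_distrib_left mult_ac)
  have "(\<Sum>j\<le>D. const (coeff Q j) * x ^ j * l ^ (Suc D - j)) = l * homogenization D x l Q"
    unfolding homogenization_def sum_distrib_left
    by (intro sum.cong refl) (auto simp: Suc_diff_le mult_ac)
  moreover have "coeff Q (Suc D) = 0" using assms by (simp add: coeff_eq_0)
  ultimately have 2: "homogenization (Suc D) x l Q = l * homogenization D x l Q"
    unfolding homogenization_def by simp
  have "[:- z, 1:] * Q = pCons 0 Q - smult z Q" by (simp add: algebra_simps)
  hence "homogenization (Suc D) x l ([:- z, 1:] * Q) = homogenization (Suc D) x l (pCons 0 Q) - const z * homogenization (Suc D) x l Q"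
    unfolding homogenization_def by (simp add: algebra_simps sum_subtractf sum_distrib_left)
  thus ?thesis by (simp add: 1 2 algebra_simps)
qed

lemma socfree_power:
  assumes "socfree I {l}" "l \<in> H 1" "u \<in> H k" "l ^ n * u \<in> I"
  shows "u \<in> I"
  using assms(4)
proof (induction n)
  case (Suc n)
  have "l ^ n * u \<in> I"
    using socfree1D[OF assms(1) H_mult[OF H_power[OF assms(2)] assms(3)], of n] Suc.prems by (simp add: mult.assoc)
  thus ?case by (rule Suc.IH)
qed simp

text \<open>\<open>homogenization D x l P\<close> is \<open>l ^ D * P (x / l)\<close>, and
  \<open>P\<close> splits over the complex numbers. Factors \<open>x - z * l\<close> are split off
  as long as the remaining product still kills \<open>w\<close>; once it does not, it multiplies
  \<open>w\<close> to an eigenvector. If \<open>P\<close> becomes constant, a power of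
  \<open>l\<close> would kill \<open>w\<close>, against regularity.\<close>

lemma homogenization_root:
  assumes I: "hideal I" "socfree I {l}" and x: "x \<in> H 1" "l \<in> H 1"
    and P: "P \<noteq> 0" "degree P \<le> D" "homogenization D x l P * w \<in> I" and w: "w \<in> H k" "w \<notin> I"
  shows "\<exists>b k' c. b * w \<in> H k' \<and> b * w \<notin> I \<and> (x - const c * l) * (b * w) \<in> I"
  using P
proof (induction D arbitrary: P)
  case 0
  then obtain c where c: "P = [:c:]" using degree_eq_zeroE[of P] by auto
  have c0: "c \<noteq> 0" using 0(1) c by simp
  have "const c * w \<in> I" using 0(3) c by (simp add: homogenization_def)
  hence "w \<in> I" by (rule const_cancel[OF I(1) c0])
  thus ?case using w by simp
next
  case (Suc D)
  show ?case
  proof (cases "degree P = 0")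
    case True
    then obtain c where c: "P = [:c:]" using degree_eq_zeroE[of P] by auto
    have c0: "c \<noteq> 0" using Suc.prems(1) c by simp
    have "homogenization (Suc D) x l P = const c * l ^ Suc D"
      unfolding homogenization_def sum.atMost_Suc_shift using c by simp
    hence "const c * (l ^ Suc D * w) \<in> I" using Suc.prems(3) by (simp add: mult_ac)
    hence "l ^ Suc D * w \<in> I" by (rule const_cancel[OF I(1) c0])
    hence "w \<in> I" by (rule socfree_power[OF I(2) x(2) w(1)])
    thus ?thesis using w by blast
  next
    case False
    then obtain z where "poly P z = 0"
      using fundamental_theorem_of_algebra[of P] by (auto simp: constant_degree)
    then obtain Q where Q: "P = [:- z, 1:] * Q" by (metis dvdE poly_eq_0_iff_dvd)
    have "Q \<noteq> 0" using Q Suc.prems(1) by auto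
    moreover from this have dQ: "degree Q \<le> D" using Suc.prems(2) unfolding Q by (subst (asm) degree_mult_eq) auto
    moreover note Suc.IH[of Q]
    moreover have "(x - const z * l) * (homogenization D x l Q * w) \<in> I"
      using Suc.prems(3) homogenization_mult[OF dQ, of x l z] by (simp only: Q mult.assoc)
    moreover have "homogenization D x l Q * w \<in> H (int D + k)" by (rule H_mult[OF homogenization_H[OF x] w(1)])
    ultimately show ?thesis by blast
  qed
qed

text \<open>The \<open>D + 1\<close> elements \<open>x ^ j * l ^ (D - j) * w\<close> lie in one
  degree, where \<open>S / I\<close> has dimension at most \<open>D\<close>. A relation between them
  is the homogenization of a polynomial annihilating \<open>w\<close>.\<close>

lemma bdd_codim_eigenvector:
  assumes I: "hideal I" "bdd_codim I" "socfree I {l}" and x: "x \<in> H 1" "l \<in> H 1" and w: "w \<in> H k" "w \<notin> I"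
  shows "\<exists>b k' c. b * w \<in> H k' \<and> b * w \<notin> I \<and> (x - const c * l) * (b * w) \<in> I"
proof -
  obtain B where B: "\<And>k. codim I k \<le> B" using I(2) by (auto simp: bdd_codim_def)
  have "B \<ge> 0" using B[of 0] codim_nonneg[of I 0] by linarith
  define D where "D = nat B"
  let ?u = "\<lambda>j. x ^ j * l ^ (D - j) * w"
  have "?u j \<in> H (int D + k)" if "j \<in> {..D}" for j
    using H_mult[OF H_mult[OF H_power[OF x(1)] H_power[OF x(2)]] w(1), of j "D - j"] that by simp
  moreover have "codim I (int D + k) < int (card {..D})" using B[of "int D + k"] \<open>B \<ge> 0\<close> by (simp add: D_def)
  ultimately obtain a where a: "\<exists>j\<in>{..D}. a j \<noteq> 0" "(\<Sum>j\<le>D. const (a j) * ?u j) \<in> I"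
    using linear_dependence_mod[OF I(1) finite_atMost, of D ?u "int D + k"] by blast
  define P where "P = (\<Sum>j\<le>D. monom (a j) j)"
  have cP: "coeff P j = (if j \<le> D then a j else 0)" for j
    by (simp add: P_def coeff_sum sum.delta' if_distrib cong: if_cong)
  have P0: "P \<noteq> 0" using a(1) cP by (metis atMost_iff coeff_0)
  have dP: "degree P \<le> D" using cP by (intro degree_le) auto
  have eq: "homogenization D x l P * w = (\<Sum>j\<le>D. const (a j) * ?u j)"
    by (simp add: homogenization_def cP sum_distrib_right mult.assoc)
  hence "homogenization D x l P * w \<in> I" using a(2) by (simp only:)
  thus ?thesis using homogenization_root[OF I(1,3) x P0 dP _ w] by blast
qed


text \<open>After saturation with respect to a non-nilpotent variable \<open>l\<close>, the operators \<open>x\<^sub>j / l\<close> have a common eigenvector.\<close>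

lemma bdd_codim_point:
  assumes I: "hideal I" "bdd_codim I" "1 \<notin> I"
  obtains y1 y2 y3 y4 w k where "coords y1 y2 y3 y4" "w \<in> H k" "w \<notin> I"
    "y1 * w \<in> I" "y2 * w \<in> I" "y3 * w \<in> I"
proof (cases "\<forall>i. \<exists>N. var i ^ N \<in> I")
  case True
  \<comment> \<open>With all variables nilpotent there is even an element killed by all of them, and
    any coordinates will do.\<close>
  then obtain w k where "w \<in> H k" "w \<notin> I" "\<And>i. var i * w \<in> I"
    using nilpotent_killed[OF I(1) H_1 I(3), of UNIV var "\<lambda>_. 1"] by auto
  moreover have "coords (var 0) (var 1) (var 2) (var 3)"
    by (rule coordsI) (simp_all add: UNIV_4')
  ultimately show ?thesis using that by blast
next
  case False
  then obtain i where i: "\<And>N. var i ^ N \<notin> I" by blast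
  define l where "l = var i"
  define J where "J = {p. \<exists>N. l ^ N * p \<in> I}"
  have J_mono: "l ^ M * p \<in> I" if "l ^ N * p \<in> I" "N \<le> M" for N M p
    using hideal_mult[OF I(1) that(1), of "l ^ (M - N)"] that(2)
    by (simp flip: mult.assoc power_add)
  have IJ: "I \<subseteq> J" unfolding J_def by (auto intro: exI[of _ 0])
  have J: "hideal J"
    unfolding hideal_def
  proof (intro conjI ballI allI)
    show "0 \<in> J" using IJ hideal_0[OF I(1)] by blast
    fix p assume "p \<in> J"
    then obtain N where N: "l ^ N * p \<in> I" by (auto simp: J_def)
    show "a * p \<in> J" for a
      using hideal_mult[OF I(1) N, of a] by (auto simp: J_def mult_ac)
    show "hcomp k p \<in> J" for k
      using hideal_hcomp[OF I(1) N, of "k + int N"] hcomp_mult_H[OF H_power[OF H_var[of i]], of "k + int N" p N]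
      by (auto simp: J_def mult_ac l_def)
    fix q assume "q \<in> J"
    then obtain M where M: "l ^ M * q \<in> I" by (auto simp: J_def)
    have "l ^ max N M * (p + q) \<in> I"
      using hideal_add[OF I(1) J_mono[OF N, of "max N M"] J_mono[OF M, of "max N M"]]
      by (simp add: algebra_simps)
    thus "p + q \<in> J" by (auto simp: J_def)
  qed
  have bJ: "bdd_codim J" using bdd_codim_mono[OF I(2) IJ] .
  have sfJ: "socfree J {l}"
    unfolding socfree_def J_def
  proof clarsimp
    fix u N assume "l ^ N * (l * u) \<in> I"
    hence "l ^ Suc N * u \<in> I" by (simp add: mult_ac)
    thus "\<exists>N. l ^ N * u \<in> I" by blast
  qed
  have J1: "1 \<notin> J" using i by (auto simp: J_def l_def)
  have "\<exists>w k c. w \<in> H k \<and> w \<notin> J \<and> (\<forall>j\<in>A. (var j - const (c j) * l) * w \<in> J)"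
    if "finite A" for A :: "4 set"
    using that
  proof (induction A rule: finite_induct)
    case empty
    thus ?case using J1 by (intro exI[of _ 1] exI[of _ 0]) auto
  next
    case (insert a A)
    then obtain w k c where w: "w \<in> H k" "w \<notin> J" "\<And>j. j \<in> A \<Longrightarrow> (var j - const (c j) * l) * w \<in> J"
      by blast
    obtain b k' z where b: "b * w \<in> H k'" "b * w \<notin> J" "(var a - const z * l) * (b * w) \<in> J"
      using bdd_codim_eigenvector[OF J bJ sfJ H_var[of a] _ w(1,2)] by (auto simp: l_def)
    have "(var j - const ((c(a := z)) j) * l) * (b * w) \<in> J" if "j \<in> insert a A" for j
      using that b(3) hideal_mult[OF J w(3), of j b] insert(2) by (auto simp: mult.left_commute)
    thus ?case using b(1,2) by blast
  qed
  from this[of UNIV] obtain w k c where w: "w \<in> H k" "w \<notin> J" "\<And>j. (var j - const (c j) * l) * w \<in> J"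
    by auto
  hence "\<forall>j. \<exists>N. l ^ N * ((var j - const (c j) * l) * w) \<in> I" by (auto simp: J_def)
  then obtain N where N: "\<And>j. l ^ N j * ((var j - const (c j) * l) * w) \<in> I" by metis
  \<comment> \<open>A common power of \<open>l\<close> brings all four relations back from the
    saturation \<open>J\<close> to \<open>I\<close>.\<close>
  define M where "M = (\<Sum>j\<in>UNIV. N j)"
  have "N j \<le> M" for j unfolding M_def by (rule member_le_sum) auto
  hence "l ^ M * ((var j - const (c j) * l) * w) \<in> I" for j using J_mono[OF N] by blast
  hence v: "(var j - const (c j) * l) * (l ^ M * w) \<in> I" for j by (simp add: mult.left_commute)
  have v2: "l ^ M * w \<notin> I" "l ^ M * w \<in> H (int M + k)"
    using w H_mult[OF H_power[OF H_var[of i]] w(1), of M] by (auto simp: J_def l_def)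
  obtain a b d where abd: "(UNIV :: 4 set) = {i, a, b, d}"
  proof -
    have "i \<in> {0, 1, 2, 3}" using UNIV_4' by auto
    thus ?thesis using that[of 1 2 3] that[of 0 2 3] that[of 0 1 3] that[of 0 1 2]
      unfolding UNIV_4' by (auto simp: insert_commute)
  qed
  have "coords (var a - const (c a) * l) (var b - const (c b) * l) (var d - const (c d) * l) l"
  proof (rule coordsI)
    fix J assume J: "hideal J"
      "{var a - const (c a) * l, var b - const (c b) * l, var d - const (c d) * l, l} \<subseteq> J"
    have "var j \<in> J" if "var j - const (c j) * l \<in> J" for j
      using hideal_add[OF J(1) that hideal_mult[OF J(1), of l "const (c j)"]] J(2) by simp
    thus "range var \<subseteq> J" unfolding abd using J(2) by (auto simp: l_def)
  qed (auto simp: l_def intro!: H_diff H_const_mult)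
  thus ?thesis using that v v2 by blast
qed

subsection \<open>Unmixedness of complete intersections\<close>

text \<open>The colon ideal \<open>Q : u\<close> contains \<open>J\<close>, hence has bounded
  codimension, and it is proper; the element found for it is multiplied by \<open>u\<close>.
  Geometrically, three of the coordinates generate the ideal of a point, at which \<open>Q\<close>
  would have an embedded or isolated component.\<close>

lemma socfree_unmixed_aux:
  assumes Q: "hideal Q" and J: "hideal J" "bdd_codim J"
    and u: "u \<in> H k" "u \<notin> Q" "\<And>x. x \<in> J \<Longrightarrow> x * u \<in> Q"
  obtains y1 y2 y3 y4 w k where "coords y1 y2 y3 y4" "w \<in> H k" "w \<notin> Q"
    "y1 * w \<in> Q" "y2 * w \<in> Q" "y3 * w \<in> Q"
proof -
  have "J \<subseteq> colon Q u" using u(3) by (auto simp: colon_def)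
  hence "bdd_codim (colon Q u)" using bdd_codim_mono J(2) by blast
  moreover have "1 \<notin> colon Q u" using u(2) by (simp add: colon_def)
  ultimately obtain y1 y2 y3 y4 w k' where w: "coords y1 y2 y3 y4" "w \<in> H k'" "w \<notin> colon Q u"
    "y1 * w \<in> colon Q u" "y2 * w \<in> colon Q u" "y3 * w \<in> colon Q u"
    using bdd_codim_point[OF hideal_colon[OF Q u(1)]] by metis
  show ?thesis
    using that[OF w(1) H_mult[OF w(2) u(1)]] w(3-) by (simp add: colon_def mult.assoc)
qed

lemma socfree_unmixed0:
  assumes J: "hideal J" "bdd_codim J"
  shows "socfree {0} J"
proof (rule socfreeI)
  fix k u assume u: "u \<in> H k" and k: "\<And>x. x \<in> J \<Longrightarrow> x * u \<in> {0}"
  show "u \<in> {0}"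
  proof (rule ccontr)
    assume "u \<notin> {0}"
    hence "J \<subseteq> {0}" using k by auto
    then obtain B where B: "\<And>k. hilb k \<le> B"
      using bdd_codim_mono[OF J(2)] codim_zero unfolding bdd_codim_def by metis
    define n where "n = max B 1"
    have n: "n \<ge> 1" "B \<le> n" by (auto simp: n_def)
    have "2 * 3 * (n + 3) \<le> (n + 1) * (n + 2) * (n + 3)" using n(1) by (intro mult_mono) auto
    moreover have "6 * n < 2 * 3 * (n + 3)" by simp
    ultimately have "6 * n < (n + 1) * (n + 2) * (n + 3)" by (rule less_le_trans[rotated])
    hence "6 * n < 6 * hilb n" using hilb_eq[of n] n(1) by simp
    thus False using B[of n] n by simp
  qed
qed

text \<open>Exchanging \<open>q\<close> for \<open>y1\<close> would give a nonzero element modulo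
  \<open>y1\<close> that is killed by \<open>y2\<close>.\<close>

lemma socfree_point1:
  assumes q: "q \<in> H a" "q \<noteq> 0" and y: "coords y1 y2 y3 y4"
  shows "socfree (gen [q]) {y1, y2}"
proof (rule socfreeI, rule ccontr)
  fix k u assume u: "u \<in> H k" "\<And>x. x \<in> {y1, y2} \<Longrightarrow> x * u \<in> gen [q]" "u \<notin> gen [q]"
  note yH = coords_H[OF y]
  obtain v k' where v: "v \<in> H k'" "v \<notin> addgen {0} y1" "\<And>x. x \<in> {y1, y2} \<Longrightarrow> x * v \<in> addgen {0} y1"
    by (rule exchange[of "{0}" q a y1 1 "{y1, y2}" u k])
       (use u yH q coords_regular(1)[OF y] in \<open>auto intro: hideal_zero socfree_zero\<close>)
  thus False using socfree1D[OF coords_regular(2)[OF y]] by auto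
qed

lemma socfree_unmixed1:
  assumes q: "q \<in> H a" "q \<noteq> 0" and J: "hideal J" "bdd_codim J"
  shows "socfree (gen [q]) J"
proof (rule socfreeI, rule ccontr)
  fix k u assume u: "u \<in> H k" "\<And>x. x \<in> J \<Longrightarrow> x * u \<in> gen [q]" "u \<notin> gen [q]"
  have hi: "hideal (gen [q])" using q by auto
  obtain y1 y2 y3 y4 w k' where "coords y1 y2 y3 y4" "w \<in> H k'" "w \<notin> gen [q]"
    "y1 * w \<in> gen [q]" "y2 * w \<in> gen [q]" "y3 * w \<in> gen [q]"
    using socfree_unmixed_aux[OF hi J u(1,3,2)] by metis
  thus False using socfreeD[OF socfree_point1[OF q]] by blast
qed

text \<open>An element killed by \<open>J\<close> yields one killed by three linear forms; exchange \<open>(q2, q1)\<close> for two of them.\<close>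

lemma socfree_unmixed2:
  assumes q: "q1 \<in> H a" "q1 \<noteq> 0" "q2 \<in> H b" "socfree (gen [q1]) {q2}" and J: "hideal J" "bdd_codim J"
  shows "socfree (gen [q2, q1]) J"
proof (rule socfreeI, rule ccontr)
  fix k u assume u: "u \<in> H k" "\<And>x. x \<in> J \<Longrightarrow> x * u \<in> gen [q2, q1]" "u \<notin> gen [q2, q1]"
  have hi: "hideal (gen [q2, q1])" "hideal (gen [q1])" using q by auto
  obtain y1 y2 y3 y4 w k' where y: "coords y1 y2 y3 y4" and w: "w \<in> H k'" "w \<notin> gen [q2, q1]"
    "y1 * w \<in> gen [q2, q1]" "y2 * w \<in> gen [q2, q1]" "y3 * w \<in> gen [q2, q1]"
    using socfree_unmixed_aux[OF hi(1) J u(1,3,2)] by metis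
  note yH = coords_H[OF y]
  \<comment> \<open>Padding with 0 keeps \<open>y4\<close> out of the combination, so that it still
    kills \<open>w\<close>.\<close>
  have "socfree (gen [q1]) {y1, y2, y3, 0}" using socfree_mono[OF socfree_point1[OF q(1,2) y]] by auto
  then obtain s2 s3 s4 where s: "socfree (gen [q1]) {y1 + const s2 * y2 + const s3 * y3 + const s4 * 0}"
    using socfree_combination[OF hi(2), of y2 1 y3 0 y1] yH by auto
  define y where "y = y1 + const s2 * y2 + const s3 * y3 + const 0 * y4"
  have sy: "socfree (gen [q1]) {y}" using s by (simp add: y_def)
  have yc: "coords y y2 y3 y4" unfolding y_def by (rule coords_combination[OF y])
  note yr = coords_regular[OF yc]
  have yH1: "y \<in> H 1" using coords_H[OF yc] by blast
  have yw: "y * w \<in> gen [q2, q1]"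
  proof -
    have "y * w = y1 * w + const s2 * (y2 * w) + const s3 * (y3 * w)" by (simp add: y_def algebra_simps)
    thus ?thesis using hideal_add[OF hi(1) hideal_add[OF hi(1) w(3) hideal_mult[OF hi(1) w(4)]]
        hideal_mult[OF hi(1) w(5)]] by metis
  qed
  obtain v m where v: "v \<in> H m" "v \<notin> addgen (gen [q1]) y"
    "\<And>x. x \<in> {y, y2, y3} \<Longrightarrow> x * v \<in> addgen (gen [q1]) y"
    by (rule exchange[of "gen [q1]" q2 b y 1 "{y, y2, y3}" w k'])
       (use w q hi yH yH1 sy yw in auto)
  \<comment> \<open>Now \<open>y\<close> is moved to the first place of the sequence, so that the
    second exchange replaces \<open>q1\<close> by \<open>y2\<close> modulo \<open>y\<close>.\<close>
  have c: "addgen (gen [q1]) y = addgen (gen [y]) q1" by (simp add: addgen_commute)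
  have sq: "socfree (gen [y]) {q1}"
    using socfree_swap[of "{0}" q1 a y 1] q(1,2) yH1 sy by (simp add: hideal_zero socfree_zero)
  obtain v' m' where v': "v' \<in> H m'" "v' \<notin> addgen (gen [y]) y2"
    "\<And>x. x \<in> {y, y2, y3} \<Longrightarrow> x * v' \<in> addgen (gen [y]) y2"
    by (rule exchange[of "gen [y]" q1 a y2 1 "{y, y2, y3}" v m])
       (use v q yH yH1 yr sq c in \<open>auto intro: hideal_addgen hideal_zero\<close>)
  thus False using socfree1D[OF yr(3)] by auto
qed

lemma bdd_codim_vars: "hideal I \<Longrightarrow> range var \<subseteq> I \<Longrightarrow> bdd_codim I"
proof (rule bdd_codim_eventuallyI[of 1 _ 0])
  fix k :: int assume "hideal I" "range var \<subseteq> I" "1 \<le> k"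
  thus "codim I k \<le> 0" using codim_eq_0_iff[of I k] H_sub_vars[of I k] by (auto simp: subset_iff)
qed

lemma coords_var: "coords (var 0) (var 1) (var 2) (var 3)"
  by (rule coordsI) (simp_all add: UNIV_4')

lemma coords_gen: "coords y1 y2 y3 y4 \<Longrightarrow> hideal (gen [y4, y3, y2, y1]) \<and> bdd_codim (gen [y4, y3, y2, y1])"
  by (auto simp: coords_def simp del: gen.simps intro!: hideal_gen bdd_codim_vars)

lemma socfree_gens:
  assumes I: "hideal I" and socfree: "socfree I (gen gs)"
  shows "socfree I (set gs)"
proof (rule socfreeI)
  fix k u assume u: "u \<in> H k" "\<And>x. x \<in> set gs \<Longrightarrow> x * u \<in> I"
  have "set gs \<subseteq> colon I u" using u by (auto simp: colon_def)
  hence "gen gs \<subseteq> colon I u" by (rule gen_minimal[OF hideal_colon[OF I u(1)]])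
  thus "u \<in> I" using socfreeD[OF socfree u(1)] by (auto simp: colon_def)
qed

text \<open>Supplies the depth used in the descent for multipliers. The forms \<open>y1\<close> and
  \<open>y2\<close> are general. For the last clause \<open>g\<close> is exchanged for
  \<open>y3\<close> modulo \<open>(y1, y2)\<close>, where a violation would contradict the
  regularity of \<open>y4\<close> modulo \<open>(y1, y2, y3)\<close>.\<close>

lemma exists_linear_regular2:
  assumes g: "g \<in> H e" "g \<noteq> 0"
  obtains y1 y2 y3 y4 where "coords y1 y2 y3 y4" "socfree (gen [g]) {y1}" "socfree (gen [y1, g]) {y2}"
    "socfree (gen [y2, y1, g]) {y3, y4}"
proof -
  let ?x = "\<lambda>i. var i"
  have hi: "hideal (gen [g])" using g by auto
  have "socfree (gen [g]) {?x 0, ?x 1, ?x 2, ?x 3}"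
    using socfree_gens[OF hi socfree_unmixed1[OF g], of "[?x 3, ?x 2, ?x 1, ?x 0]"] coords_gen[OF coords_var]
    by (auto simp: insert_commute)
  then obtain s2 s3 s4 where s: "socfree (gen [g]) {?x 0 + const s2 * ?x 1 + const s3 * ?x 2 + const s4 * ?x 3}"
    using socfree_combination[OF hi H_var H_var H_var] by blast
  define y1 where "y1 = ?x 0 + const s2 * ?x 1 + const s3 * ?x 2 + const s4 * ?x 3"
  have c1: "coords y1 (?x 1) (?x 2) (?x 3)" unfolding y1_def by (rule coords_combination[OF coords_var])
  hence y1: "y1 \<in> H 1" using coords_H by blast
  have hi2: "hideal (gen [y1, g])" using g y1 by auto
  have sy1: "socfree (gen [g]) {y1}" using s by (simp add: y1_def)
  have "socfree (gen [y1, g]) {y1, ?x 1, ?x 2, ?x 3}"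
    using socfree_gens[OF hi2 socfree_unmixed2[OF g y1 sy1], of "[?x 3, ?x 2, ?x 1, y1]"] coords_gen[OF c1]
    by (auto simp: insert_commute)
  moreover have "y1 \<in> gen [y1, g]" using addgen_gen[OF hi] by simp
  ultimately have "socfree (gen [y1, g]) {?x 1, ?x 2, ?x 3}" by (rule socfree_drop[OF hi2])
  hence "socfree (gen [y1, g]) {?x 1, ?x 2, ?x 3, 0}" by (rule socfree_mono) auto
  then obtain t2 t3 t4 where t: "socfree (gen [y1, g]) {?x 1 + const t2 * ?x 2 + const t3 * ?x 3 + const t4 * 0}"
    using socfree_combination[OF hi2 H_var H_var H_0] by blast
  define y2 where "y2 = ?x 1 + const t2 * ?x 2 + const t3 * ?x 3 + const 0 * y1"
  have sy2: "socfree (gen [y1, g]) {y2}" using t by (simp add: y2_def)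
  have "coords y2 (?x 2) (?x 3) y1" unfolding y2_def
    by (rule coords_combination[OF coords_perm[OF c1]]) auto
  hence c: "coords y1 y2 (?x 2) (?x 3)" by (rule coords_perm) auto
  have y2: "y2 \<in> H 1" using coords_H[OF c] by blast
  note r = coords_regular[OF c]
  have "socfree (gen [y1]) {g}" using socfree_swap[of "{0}" g e y1 1] g y1 sy1 by (simp add: hideal_zero socfree_zero)
  hence sg: "socfree (gen [y2, y1]) {g}"
    using socfree_swap[of "gen [y1]" g e y2 1] g y1 y2 sy2 by (simp add: hideal_addgen hideal_zero addgen_commute)
  have hi3: "hideal (gen [y2, y1])" using y1 y2 by auto
  have eq: "gen [y2, y1, g] = addgen (gen [y2, y1]) g" by (simp add: addgen_commute)
  have "socfree (addgen (gen [y2, y1]) g) {?x 2, ?x 3}"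
  proof (rule socfreeI, rule ccontr)
    fix k u assume u: "u \<in> H k" "\<And>x. x \<in> {?x 2, ?x 3} \<Longrightarrow> x * u \<in> addgen (gen [y2, y1]) g"
      "u \<notin> addgen (gen [y2, y1]) g"
    obtain v k' where v: "v \<in> H k'" "v \<notin> addgen (gen [y2, y1]) (?x 2)"
      "\<And>x. x \<in> {?x 2, ?x 3} \<Longrightarrow> x * v \<in> addgen (gen [y2, y1]) (?x 2)"
      by (rule exchange[of "gen [y2, y1]" g e "?x 2" 1 "{?x 2, ?x 3}" u k])
         (use u g hi3 sg r in \<open>auto intro: H_var\<close>)
    thus False using socfree1D[OF r(4)] by auto
  qed
  thus ?thesis using that[OF c sy1 sy2] eq by simp
qed

lemma codim_ci1:
  assumes "q1 \<in> H a" "q1 \<noteq> 0"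
  shows "codim (gen [q1]) k = hilb k - hilb (k - a)"
  using codim_regular[OF hideal_zero assms(1) socfree_zero[OF assms(2)]] by (simp add: codim_zero)

text \<open>Bezout's number as a triple difference of the cubic. The smallest argument of
  \<open>hilb\<close> in it is \<open>k - a - b - c\<close>, whence the bound on
  \<open>k\<close>.\<close>

lemma codim_ci3:
  assumes q: "q1 \<in> H a" "q1 \<noteq> 0" "q2 \<in> H b" "socfree (gen [q1]) {q2}" "q3 \<in> H c" "socfree (gen [q2, q1]) {q3}"
    and nn: "a \<ge> 0" "b \<ge> 0" "c \<ge> 0" and k: "k \<ge> a + b + c - 3"
  shows "codim (gen [q3, q2, q1]) k = a * b * c"
proof -
  have hi: "hideal (gen [q1])" "hideal (gen [q2, q1])" using q by auto
  note c1 = codim_ci1[OF q(1,2)]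
  have c2: "codim (gen [q2, q1]) k = codim (gen [q1]) k - codim (gen [q1]) (k - b)" for k
    using codim_regular[OF hi(1) q(3,4)] by simp
  have c3: "codim (gen [q3, q2, q1]) k = codim (gen [q2, q1]) k - codim (gen [q2, q1]) (k - c)" for k
    using codim_regular[OF hi(2) q(5,6)] by simp
  have "6 * codim (gen [q3, q2, q1]) k = 6 * (a * b * c)"
    unfolding c3 c2 c1 right_diff_distrib using k nn
    by (subst hilb_eq, simp)+ (simp add: algebra_simps)
  thus ?thesis by simp
qed

lemma bdd_codim_ci3:
  assumes q: "q1 \<in> H a" "q1 \<noteq> 0" "q2 \<in> H b" "socfree (gen [q1]) {q2}" "q3 \<in> H c" "socfree (gen [q2, q1]) {q3}"
    and nn: "a \<ge> 0" "b \<ge> 0" "c \<ge> 0"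
  shows "bdd_codim (gen [q3, q2, q1])"
  using codim_ci3[OF q nn] by (intro bdd_codim_eventuallyI[of "a + b + c - 3" _ "a * b * c"]) auto

subsection \<open>Components of products\<close>

text \<open>Applied to the top and to the bottom components, where only one pair can
  contribute.\<close>

lemma hcomp_mult_unique:
  assumes "\<And>i j. i + j = k + l \<Longrightarrow> hcomp i a \<noteq> 0 \<Longrightarrow> hcomp j b \<noteq> 0 \<Longrightarrow> i = k \<and> j = l"
  shows "hcomp (k + l) (a * b) = hcomp k a * hcomp l b"
proof -
  obtain K where K: "finite K" "a = (\<Sum>i\<in>K. hcomp i a)" "\<And>i. i \<notin> K \<Longrightarrow> hcomp i a = 0"
    using sum_hcomp[of a] by metis
  have "hcomp (k + l) (a * b) = (\<Sum>i\<in>K. hcomp (k + l) (hcomp i a * b))"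
    by (subst K(2)) (simp add: sum_distrib_right hcomp_sum)
  also have "\<dots> = (\<Sum>i\<in>K. if i = k then hcomp k a * hcomp l b else 0)"
  proof (intro sum.cong refl)
    fix i assume "i \<in> K"
    have "hcomp (k + l) (hcomp i a * b) = hcomp (k + l - i) b * hcomp i a"
      using hcomp_mult_H[OF hcomp_in_H, of "k + l" b i a] by (simp add: mult.commute)
    thus "hcomp (k + l) (hcomp i a * b) = (if i = k then hcomp k a * hcomp l b else 0)"
      using assms[of i "k + l - i"] by (auto simp: mult.commute)
  qed
  also have "\<dots> = hcomp k a * hcomp l b" using K by (auto simp: sum.delta)
  finally show ?thesis .
qed

lemma finite_hcomp_support: "finite {k. hcomp k p \<noteq> 0}"
proof -
  obtain K where "finite K" "\<And>k. k \<notin> K \<Longrightarrow> hcomp k p = 0" using sum_hcomp[of p] by metis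
  thus ?thesis by (intro finite_subset[of "{k. hcomp k p \<noteq> 0}" K]) auto
qed

lemma hcomp_support_nonempty: "p \<noteq> 0 \<Longrightarrow> {k. hcomp k p \<noteq> 0} \<noteq> {}"
  using sum_hcomp[of p] by (metis (mono_tags, lifting) Collect_empty_eq sum.neutral)

lemma top_hcomp:
  assumes "p \<noteq> 0"
  obtains k where "hcomp k p \<noteq> 0" "\<And>i. hcomp i p \<noteq> 0 \<Longrightarrow> i \<le> k"
  using that[of "Max {k. hcomp k p \<noteq> 0}"] Max_in[OF finite_hcomp_support hcomp_support_nonempty[OF assms]]
    Max_ge[OF finite_hcomp_support] by blast

lemma bot_hcomp:
  assumes "p \<noteq> 0"
  obtains k where "hcomp k p \<noteq> 0" "\<And>i. hcomp i p \<noteq> 0 \<Longrightarrow> k \<le> i"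
  using that[of "Min {k. hcomp k p \<noteq> 0}"] Min_in[OF finite_hcomp_support hcomp_support_nonempty[OF assms]]
    Min_le[OF finite_hcomp_support] by blast

text \<open>In a domain the products of the top and of the bottom components do not vanish, so both
  have degree \<open>n\<close>; hence the top and bottom degrees of \<open>a\<close>
  coincide.\<close>

lemma homogeneous_factor:
  assumes "a * b \<in> H n" "a * b \<noteq> 0"
  shows "\<exists>k. a \<in> H k"
proof -
  have ab: "a \<noteq> 0" "b \<noteq> 0" using assms(2) by auto
  obtain k where k: "hcomp k a \<noteq> 0" "\<And>i. hcomp i a \<noteq> 0 \<Longrightarrow> i \<le> k" using top_hcomp[OF ab(1)] by metis
  obtain l where l: "hcomp l b \<noteq> 0" "\<And>i. hcomp i b \<noteq> 0 \<Longrightarrow> i \<le> l" using top_hcomp[OF ab(2)] by metis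
  obtain k' where k': "hcomp k' a \<noteq> 0" "\<And>i. hcomp i a \<noteq> 0 \<Longrightarrow> k' \<le> i" using bot_hcomp[OF ab(1)] by metis
  obtain l' where l': "hcomp l' b \<noteq> 0" "\<And>i. hcomp i b \<noteq> 0 \<Longrightarrow> l' \<le> i" using bot_hcomp[OF ab(2)] by metis
  have "hcomp (k + l) (a * b) = hcomp k a * hcomp l b"
    by (rule hcomp_mult_unique) (use k(2) l(2) in fastforce)
  hence 1: "k + l = n" using hcomp_H[OF assms(1), of "k + l"] k l by (auto split: if_splits)
  have "hcomp (k' + l') (a * b) = hcomp k' a * hcomp l' b"
    by (rule hcomp_mult_unique) (use k'(2) l'(2) in fastforce)
  hence 2: "k' + l' = n" using hcomp_H[OF assms(1), of "k' + l'"] k' l' by (auto split: if_splits)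
  have eq: "k = k'" using 1 2 k(2)[OF k'(1)] l(2)[OF l'(1)] by linarith
  obtain K where K: "finite K" "a = (\<Sum>i\<in>K. hcomp i a)" using sum_hcomp[of a] by metis
  have "a \<in> H k" by (subst K(2), intro H_sum) (use eq k(2) k'(2) in \<open>metis H_0 antisym hcomp_in_H\<close>)
  thus ?thesis by blast
qed

text \<open>The top component of \<open>a * b\<close> is the product of the top components. The one
  that lies in \<open>P\<close> is subtracted, which lowers the number of components.\<close>

lemma homogeneous_prime:
  assumes P: "hideal P"
    and prime: "\<And>a b k l. a \<in> H k \<Longrightarrow> b \<in> H l \<Longrightarrow> a * b \<in> P \<Longrightarrow> a \<in> P \<or> b \<in> P"
  shows "a * b \<in> P \<Longrightarrow> a \<in> P \<or> b \<in> P"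
proof (induction "card {k. hcomp k a \<noteq> 0} + card {k. hcomp k b \<noteq> 0}" arbitrary: a b rule: less_induct)
  case less
  show ?case
  proof (cases "a = 0 \<or> b = 0")
    case True
    thus ?thesis using hideal_0[OF P] by auto
  next
    case False
    obtain k where k: "hcomp k a \<noteq> 0" "\<And>i. hcomp i a \<noteq> 0 \<Longrightarrow> i \<le> k" using top_hcomp[of a] False by metis
    obtain l where l: "hcomp l b \<noteq> 0" "\<And>i. hcomp i b \<noteq> 0 \<Longrightarrow> i \<le> l" using top_hcomp[of b] False by metis
    have smaller: "card {i. hcomp i (p - hcomp k p) \<noteq> 0} < card {i. hcomp i p \<noteq> 0}"
      if "hcomp k p \<noteq> 0" for k p
    proof (rule psubset_card_mono[OF finite_hcomp_support])
      have "hcomp i (p - hcomp k p) = (if i = k then 0 else hcomp i p)" for i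
        using hcomp_H[OF hcomp_in_H, of i k p] by (simp add: hcomp_diff)
      thus "{i. hcomp i (p - hcomp k p) \<noteq> 0} \<subset> {i. hcomp i p \<noteq> 0}" using that by auto
    qed
    have "hcomp (k + l) (a * b) = hcomp k a * hcomp l b"
      by (rule hcomp_mult_unique) (use k(2) l(2) in fastforce)
    hence "hcomp k a * hcomp l b \<in> P" using hideal_hcomp[OF P less.prems] by metis
    from prime[OF hcomp_in_H hcomp_in_H this] show ?thesis
    proof
      assume *: "hcomp k a \<in> P"
      have "(a - hcomp k a) * b \<in> P"
        using hideal_diff[OF P less.prems hideal_mult'[OF P *]] by (simp add: algebra_simps)
      hence "a - hcomp k a \<in> P \<or> b \<in> P" using smaller[OF k(1)] by (intro less.hyps) auto
      thus ?thesis using * hideal_add[OF P, of "a - hcomp k a" "hcomp k a"] by auto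
    next
      assume *: "hcomp l b \<in> P"
      have "a * (b - hcomp l b) \<in> P"
        using hideal_diff[OF P less.prems hideal_mult[OF P *]] by (simp add: algebra_simps)
      hence "a \<in> P \<or> b - hcomp l b \<in> P" using smaller[OF l(1)] by (intro less.hyps) auto
      thus ?thesis using * hideal_add[OF P, of "b - hcomp l b" "hcomp l b"] by auto
    qed
  qed
qed

subsection \<open>Dimension zero implies a bounded Hilbert function\<close>

interpretation S: cring S_ring
  by (rule cring_from_type_algebra)

lemma S_ring_simps [simp]:
  "carrier S_ring = UNIV" "a \<otimes>\<^bsub>S_ring\<^esub> b = a * b" "a \<oplus>\<^bsub>S_ring\<^esub> b = a + b"
  "\<one>\<^bsub>S_ring\<^esub> = 1" "\<zero>\<^bsub>S_ring\<^esub> = 0"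
  by (simp_all add: ring_of_type_algebra_def)

lemma a_inv_S [simp]: "a_inv S_ring a = - a"
  by (rule S.minus_equality) auto

lemma ideal_hideal: "hideal P \<Longrightarrow> ideal P S_ring"
proof (rule idealI)
  assume P: "hideal P"
  show "subgroup P (add_monoid S_ring)"
  proof (rule S.add.subgroupI)
    show "P \<noteq> {}" using hideal_0[OF P] by blast
  qed (use P hideal_uminus hideal_add in \<open>auto simp flip: a_inv_def\<close>)
qed (auto simp: hideal_mult hideal_mult' S.ring_axioms)

lemma ideal_sum: "ideal P S_ring \<Longrightarrow> (\<And>i. i \<in> A \<Longrightarrow> f i \<in> P) \<Longrightarrow> sum f A \<in> P"
proof (induction A rule: infinite_finite_induct)
  case (insert x F)
  thus ?case using additive_subgroup.a_closed[OF ideal.axioms(1), of P S_ring "f x" "sum f F"] by simp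
qed (use additive_subgroup.zero_closed[OF ideal.axioms(1)] in force)+

lemma homogeneous_ideal_hideal:
  assumes P: "hideal P"
  shows "homogeneous_ideal P"
  unfolding homogeneous_ideal_def
proof (intro conjI ideal_hideal[OF P] equalityI)
  show "genideal S_ring {p \<in> P. \<exists>n. homogeneous n p} \<subseteq> P"
    by (rule S.genideal_minimal[OF ideal_hideal[OF P]]) auto
  show "P \<subseteq> genideal S_ring {p \<in> P. \<exists>n. homogeneous n p}"
  proof
    fix p assume p: "p \<in> P"
    obtain K where K: "finite K" "p = (\<Sum>i\<in>K. hcomp i p)" using sum_hcomp[of p] by metis
    have "hcomp i p \<in> genideal S_ring {p \<in> P. \<exists>n. homogeneous n p}" for i
    proof -
      have "homogeneous (nat i) (hcomp i p)"
        using hcomp_in_H[of i p] by (auto simp: homogeneous_def H_def)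
      thus ?thesis using hideal_hcomp[OF P p] by (intro subsetD[OF S.genideal_self]) auto
    qed
    moreover have "ideal (genideal S_ring {p \<in> P. \<exists>n. homogeneous n p}) S_ring"
      by (rule S.genideal_ideal) simp
    ultimately show "p \<in> genideal S_ring {p \<in> P. \<exists>n. homogeneous n p}"
      by (subst K(2)) (rule ideal_sum)
  qed
qed

lemma Proj_pointsI:
  assumes P: "hideal P" "I \<subseteq> P" "var i \<notin> P"
    and prime: "\<And>a b k l. a \<in> H k \<Longrightarrow> b \<in> H l \<Longrightarrow> a * b \<in> P \<Longrightarrow> a \<in> P \<or> b \<in> P"
  shows "P \<in> Proj_points I"
proof -
  have "primeideal P S_ring"
  proof (rule primeidealI[OF ideal_hideal[OF P(1)] S.is_cring])
    show "carrier S_ring \<noteq> P" using P(3) by auto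
    fix a b assume "a \<otimes>\<^bsub>S_ring\<^esub> b \<in> P"
    thus "a \<in> P \<or> b \<in> P" using homogeneous_prime[OF P(1) prime] by simp
  qed
  moreover have "\<not> irrelevant_ideal \<subseteq> P"
    using P(3) S.genideal_self[of "range var"] unfolding irrelevant_ideal_def by auto
  ultimately show ?thesis using P homogeneous_ideal_hideal[OF P(1)] by (simp add: Proj_points_def)
qed

text \<open>Zorn's lemma. The hypothesis \<open>fin\<close> takes the place of the Noetherian
  property: \<open>G\<close> has to pass from the union of a chain to one of its members.\<close>

lemma maximal_hideal:
  assumes I0: "hideal I0" "\<not> G I0"
    and fin: "\<And>C. C \<noteq> {} \<Longrightarrow> subset.chain UNIV C \<Longrightarrow> hideal (\<Union>C) \<Longrightarrow> (\<And>I. I \<in> C \<Longrightarrow> hideal I) \<Longrightarrow>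
      G (\<Union>C) \<Longrightarrow> \<exists>I\<in>C. G I"
  obtains P where "hideal P" "I0 \<subseteq> P" "\<not> G P" "\<And>I. hideal I \<Longrightarrow> P \<subset> I \<Longrightarrow> G I"
proof -
  define A where "A = {I. hideal I \<and> I0 \<subseteq> I \<and> \<not> G I}"
  have "\<exists>M\<in>A. \<forall>N\<in>A. M \<subseteq> N \<longrightarrow> N = M"
  proof (rule subset_Zorn_nonempty)
    show "A \<noteq> {}" using I0 by (auto simp: A_def)
    fix C assume C: "C \<noteq> {}" "subset.chain A C"
    have CA: "I \<in> A" if "I \<in> C" for I using C(2) that by (auto simp: subset_chain_def)
    have tot: "I \<subseteq> I' \<or> I' \<subseteq> I" if "I \<in> C" "I' \<in> C" for I I'
      using C(2) that by (auto simp: subset_chain_def)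
    have hi: "hideal I" if "I \<in> C" for I using CA[OF that] by (simp add: A_def)
    have hU: "hideal (\<Union>C)"
      unfolding hideal_def
    proof (intro conjI ballI allI)
      show "0 \<in> \<Union>C" using C(1) hi hideal_0 by blast
      fix p assume "p \<in> \<Union>C"
      then obtain I where I: "I \<in> C" "p \<in> I" by blast
      show "a * p \<in> \<Union>C" for a using I hideal_mult[OF hi] by blast
      show "hcomp k p \<in> \<Union>C" for k using I hideal_hcomp[OF hi] by blast
      fix q assume "q \<in> \<Union>C"
      then obtain I' where I': "I' \<in> C" "q \<in> I'" by blast
      show "p + q \<in> \<Union>C" using tot[OF I(1) I'(1)] I I' hideal_add[OF hi] by blast
    qed
    have "subset.chain UNIV C" using C(2) by (auto simp: subset_chain_def)
    hence "\<not> G (\<Union>C)" using fin[OF C(1) _ hU hi] CA by (auto simp: A_def)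
    moreover have "I0 \<subseteq> \<Union>C" using C(1) CA by (auto simp: A_def)
    ultimately show "\<Union>C \<in> A" using hU by (simp add: A_def)
  qed
  then obtain P where P: "P \<in> A" "\<And>N. N \<in> A \<Longrightarrow> P \<subseteq> N \<Longrightarrow> N = P" by blast
  show ?thesis
  proof (rule that[of P])
    fix I assume "hideal I" "P \<subset> I"
    thus "G I" using P by (auto simp: A_def)
  qed (use P(1) in \<open>auto simp: A_def\<close>)
qed

text \<open>A sufficient condition for \<open>bdd_codim\<close> that concerns a single
  finite-dimensional space \<open>H k\<close> and therefore passes from the union of a chain to a
  member. The form \<open>l = 0\<close> is allowed, so ideals of finite colength are
  included.\<close>

definition finite_mod_linear :: "poly4 set \<Rightarrow> bool" where
  "finite_mod_linear I \<longleftrightarrow> (\<exists>l\<in>H 1. \<exists>k\<ge>0. H k \<subseteq> addgen I l)"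

lemma H_Suc_sub:
  assumes I: "hideal I" and k: "k \<ge> 0" "H k \<subseteq> I" "j \<ge> k"
  shows "H j \<subseteq> I"
  using k(3)
proof (induction j rule: int_ge_induct)
  case base
  thus ?case by (rule k(2))
next
  case (step j)
  show ?case
  proof
    fix p assume p: "p \<in> H (j + 1)"
    have "mon m \<in> I" if "m \<in> Poly_Mapping.keys p" for m
    proof -
      have d: "int (mon_degree m) = j + 1" using p that by (auto simp: H_def)
      hence "mon_degree m \<noteq> 0" using step(1) k(1) by auto
      then obtain i m' where m': "mon m = mon m' * var i" "mon_degree m = Suc (mon_degree m')"
        using mon_split by blast
      hence "mon m' \<in> I" using mon_H[of m'] step(2) d by auto
      thus ?thesis using m'(1) hideal_mult'[OF I] by simp
    qed
    thus "p \<in> I" by (subst poly_eq_sum_mon) (intro hideal_sum hideal_mult I)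
  qed
qed

text \<open>From degree \<open>k\<close> on, multiplication by \<open>l\<close> is onto the next
  degree of \<open>S / I\<close>, so that the Hilbert function no longer grows.\<close>

lemma finite_mod_linear_bdd_codim:
  assumes I: "hideal I" "finite_mod_linear I"
  shows "bdd_codim I"
proof -
  obtain l k where l: "l \<in> H 1" "k \<ge> 0" "H k \<subseteq> addgen I l" using I(2) by (auto simp: finite_mod_linear_def)
  have hi: "hideal (addgen I l)" using hideal_addgen[OF I(1) l(1)] .
  have step: "codim I (j + 1) \<le> codim I j" if "j \<ge> k" for j
  proof -
    have "H (j + 1) \<subseteq> addgen I l" using H_Suc_sub[OF hi l(2,3)] that by simp
    hence "codim I (j + 1) = codim (colon I l) j"
      using codim_addgen[OF I(1) l(1), of "j + 1"] codim_eq_0_iff[OF hi, of "j + 1"] by simp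
    thus ?thesis using codim_mono[OF colon_sub[OF I(1)]] by metis
  qed
  have "codim I j \<le> codim I k" if "j \<ge> k" for j
    using that
  proof (induction j rule: int_ge_induct)
    case (step j)
    thus ?case using \<open>\<And>j. k \<le> j \<Longrightarrow> codim I (j + 1) \<le> codim I j\<close>[of j] by linarith
  qed simp
  thus ?thesis by (rule bdd_codim_eventuallyI)
qed

lemma finite_in_chain:
  assumes "C \<noteq> {}" "subset.chain UNIV C" "finite B" "\<And>b. b \<in> B \<Longrightarrow> p b \<in> \<Union>C"
  shows "\<exists>I\<in>C. \<forall>b\<in>B. p b \<in> I"
proof -
  have "p ` B \<subseteq> \<Union>C" using assms(4) by auto
  then obtain I where "I \<in> C" "p ` B \<subseteq> I"
    by (rule finite_subset_Union_chain[OF finite_imageI[OF assms(3)] _ assms(1,2)])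
  thus ?thesis by blast
qed

lemma finite_basis_H: "\<exists>B. finite B \<and> B \<subseteq> H k \<and> (\<forall>I. hideal I \<longrightarrow> B \<subseteq> I \<longrightarrow> H k \<subseteq> I)"
proof (intro exI conjI allI impI)
  let ?B = "mon ` {m. int (mon_degree m) = k}"
  show "finite ?B" using finite_mon by simp
  show "?B \<subseteq> H k" using mon_H by auto
  fix I assume "hideal I" "?B \<subseteq> I"
  hence "V.span ?B \<subseteq> I" by (intro V.span_minimal) (auto simp: V.subspace_def cscale_def hideal_add hideal_mult)
  thus "H k \<subseteq> I" by (simp add: H_span)
qed

lemma finite_mod_linear_finitary:
  assumes C: "C \<noteq> {}" "subset.chain UNIV C" "\<And>I. I \<in> C \<Longrightarrow> hideal I" and G: "finite_mod_linear (\<Union>C)"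
  shows "\<exists>I\<in>C. finite_mod_linear I"
proof -
  obtain l k where l: "l \<in> H 1" "k \<ge> 0" "H k \<subseteq> addgen (\<Union>C) l" using G by (auto simp: finite_mod_linear_def)
  obtain B where B: "finite B" "B \<subseteq> H k" "\<And>I. hideal I \<Longrightarrow> B \<subseteq> I \<Longrightarrow> H k \<subseteq> I"
    using finite_basis_H[of k] by blast
  have "\<forall>b\<in>B. \<exists>p. p \<in> \<Union>C \<and> (\<exists>a. b = p + a * l)"
  proof
    fix b assume "b \<in> B"
    hence "b \<in> addgen (\<Union>C) l" using B(2) l(3) by blast
    thus "\<exists>p. p \<in> \<Union>C \<and> (\<exists>a. b = p + a * l)" unfolding addgen_def by blast
  qed
  from bchoice[OF this] obtain p where p: "\<forall>b\<in>B. p b \<in> \<Union>C \<and> (\<exists>a. b = p b + a * l)" by blast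
  then obtain I where I: "I \<in> C" "\<forall>b\<in>B. p b \<in> I" using finite_in_chain[OF C(1,2) B(1), of p] by blast
  have "B \<subseteq> addgen I l" using p I(2) addgenI2 by blast
  hence "H k \<subseteq> addgen I l" by (rule B(3)[OF hideal_addgen[OF C(3)[OF I(1)] l(1)]])
  thus ?thesis using I(1) l by (auto simp: finite_mod_linear_def)
qed

definition finite_colength :: "poly4 set \<Rightarrow> bool" where
  "finite_colength I \<longleftrightarrow> (\<exists>k\<ge>0. H k \<subseteq> I)"

lemma finite_colength_finitary:
  assumes C: "C \<noteq> {}" "subset.chain UNIV C" "\<And>I. I \<in> C \<Longrightarrow> hideal I" and G: "finite_colength (\<Union>C)"
  shows "\<exists>I\<in>C. finite_colength I"
proof -
  obtain k where k: "k \<ge> 0" "H k \<subseteq> \<Union>C" using G by (auto simp: finite_colength_def)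
  obtain B where B: "finite B" "B \<subseteq> H k" "\<And>I. hideal I \<Longrightarrow> B \<subseteq> I \<Longrightarrow> H k \<subseteq> I"
    using finite_basis_H[of k] by blast
  obtain I where I: "I \<in> C" "\<forall>b\<in>B. b \<in> I" using finite_in_chain[OF C(1,2) B(1), of "\<lambda>b. b"] B(2) k(2) by blast
  thus ?thesis using B(3)[OF C(3)[OF I(1)]] k(1) unfolding finite_colength_def by blast
qed

text \<open>A monomial of degree \<open>k + l\<close> is a product of monomials of degrees
  \<open>k\<close> and \<open>l\<close>; the induction moves one variable at a time into the colon
  ideal.\<close>

lemma H_mult_sub:
  assumes "hideal I" "k \<ge> 0" "\<And>a b. a \<in> H k \<Longrightarrow> b \<in> H (int l) \<Longrightarrow> a * b \<in> I"
  shows "H (k + int l) \<subseteq> I"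
  using assms(1,3)
proof (induction l arbitrary: I)
  case 0
  show ?case using 0(2)[of _ 1] by auto
next
  case (Suc l)
  show ?case
  proof
    fix p assume p: "p \<in> H (k + int (Suc l))"
    have "mon m \<in> I" if "m \<in> Poly_Mapping.keys p" for m
    proof -
      have d: "int (mon_degree m) = k + int (Suc l)" using p that by (auto simp: H_def)
      hence "mon_degree m \<noteq> 0" using assms(2) by auto
      then obtain i m' where m': "mon m = mon m' * var i" "mon_degree m = Suc (mon_degree m')"
        using mon_split by blast
      have "H (k + int l) \<subseteq> colon I (var i)"
      proof (rule Suc.IH[OF hideal_colon[OF Suc.prems(1) H_var]])
        fix a b assume "a \<in> H k" "b \<in> H (int l)"
        thus "a * b \<in> colon I (var i)"
          using Suc.prems(2)[of a "b * var i"] H_mult[OF _ H_var, of b "int l" i]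
          by (simp add: colon_def mult.assoc add.commute)
      qed
      moreover have "mon m' \<in> H (k + int l)" using mon_H[of m'] d m'(2) by simp
      ultimately show ?thesis using m'(1) by (auto simp: colon_def)
    qed
    thus "p \<in> I" by (subst poly_eq_sum_mon) (intro hideal_sum hideal_mult Suc.prems(1))
  qed
qed

text \<open>By additivity of Hilbert functions, a homogeneous ideal maximal among those that contain \<open>J\<close> and are
  not finite modulo a linear form is prime; a maximal ideal of infinite colength above it and a variable
  outside it is a second, strictly larger point.\<close>

lemma bdd_codim_if_Proj_dim_0:
  assumes J: "hideal J" and I0: "\<And>P. hideal P \<Longrightarrow> J \<subseteq> P \<Longrightarrow> I0 \<subseteq> P" and dim: "Proj_dim I0 = 0"
  shows "bdd_codim J"
proof (rule ccontr)
  assume "\<not> bdd_codim J"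
  hence "\<not> finite_mod_linear J" using finite_mod_linear_bdd_codim[OF J] by blast
  then obtain P where P: "hideal P" "J \<subseteq> P" "\<not> finite_mod_linear P" and Pmax: "\<And>I. hideal I \<Longrightarrow> P \<subset> I \<Longrightarrow> finite_mod_linear I"
    using maximal_hideal[of J finite_mod_linear] finite_mod_linear_finitary J by metis
  have ext: "finite_mod_linear (addgen P a)" if "a \<in> H m" "a \<notin> P" for a m
    using that addgen_sub[of P a] addgen_gen[OF P(1), of a] by (intro Pmax hideal_addgen[OF P(1) that(1)]) auto
  \<comment> \<open>An element \<open>u\<close> killed by all variables enlarges \<open>P\<close>
    only in the degree of \<open>u\<close>. So if \<open>P + (u)\<close> were finite modulo
    \<open>l\<close>, then so would be \<open>P\<close>.\<close>
  have soc: "socfree P (range var)"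
  proof (rule socfreeI, rule ccontr)
    fix n u assume u: "u \<in> H n" "\<And>x. x \<in> range var \<Longrightarrow> x * u \<in> P" "u \<notin> P"
    obtain l k where l: "l \<in> H 1" "k \<ge> 0" "H k \<subseteq> addgen (addgen P u) l"
      using ext[OF u(1,3)] by (auto simp: finite_mod_linear_def)
    have hi: "hideal (addgen P u)" "hideal (addgen (addgen P u) l)" "hideal (addgen P l)"
      using P(1) u(1) l(1) by auto
    define k' where "k' = max k (n + 1)"
    have "H k' \<subseteq> addgen P l"
    proof
      fix q assume q: "q \<in> H k'"
      hence "q \<in> addgen (addgen P u) l" using H_Suc_sub[OF hi(2) l(2,3), of k'] by (auto simp: k'_def)
      then obtain b where b: "b \<in> H (k' - 1)" "q - b * l \<in> addgen P u"
        using addgen_homE[OF hi(1) l(1) _ q] by blast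
      have "q - b * l \<in> H k'" using q H_mult[OF b(1) l(1)] by (auto intro: H_diff)
      then obtain a where a: "a \<in> H (k' - n)" "(q - b * l) - a * u \<in> P"
        using addgen_homE[OF P(1) u(1) b(2)] by blast
      have "H (k' - n) \<subseteq> colon P u"
        by (rule H_sub_vars[OF hideal_colon[OF P(1) u(1)]]) (use u(2) in \<open>auto simp: colon_def k'_def\<close>)
      hence "a * u \<in> P" using a(1) by (auto simp: colon_def)
      hence "q - b * l \<in> P" using hideal_add[OF P(1) a(2)] by fastforce
      thus "q \<in> addgen P l" by (rule addgenI)
    qed
    moreover have "k' \<ge> 0" using l(2) by (simp add: k'_def)
    ultimately show False using P(3) l(1) by (auto simp: finite_mod_linear_def)
  qed
  have "socfree P {var 0, var 1, var 2, var 3}" using soc unfolding UNIV_4' by simp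
  then obtain s2 s3 s4 where s: "socfree P {var 0 + const s2 * var 1 + const s3 * var 2 + const s4 * var 3}"
    using socfree_combination[OF P(1) H_var H_var H_var] by blast
  define l where "l = var 0 + const s2 * var 1 + const s3 * var 2 + const s4 * var 3"
  have l: "l \<in> H 1" "socfree P {l}" using s by (auto simp: l_def intro!: H_add H_const_mult)
  have rec: "codim (addgen P l) k = codim P k - codim P (k - 1)" for k
    by (rule codim_regular[OF P(1) l])
  \<comment> \<open>The differences of the Hilbert function of \<open>S / P\<close> are the values
    for \<open>P + (l)\<close>, which never vanish in degrees \<open>\<ge> 0\<close> because
    \<open>P\<close> is not finite modulo \<open>l\<close>.\<close>
  have unb: "\<not> bdd_codim P"
  proof
    assume "bdd_codim P"
    then obtain B where B: "\<And>k. codim P k \<le> B" by (auto simp: bdd_codim_def)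
    have "codim (addgen P l) (int n) \<ge> 1" for n
    proof -
      have "\<not> H (int n) \<subseteq> addgen P l" using P(3) l(1) by (force simp: finite_mod_linear_def)
      hence "codim (addgen P l) (int n) \<noteq> 0" using codim_eq_0_iff[OF hideal_addgen[OF P(1) l(1)]] by blast
      thus ?thesis using codim_nonneg[of "addgen P l" "int n"] by linarith
    qed
    hence grow: "codim P (int n) \<ge> codim P (int n - 1) + 1" for n
      using rec[of "int n"] by (metis add.commute diff_add_cancel le_diff_eq)
    have "codim P (int n) \<ge> int n + 1" for n
    proof (induction n)
      case 0
      thus ?case using grow[of 0] codim_nonneg[of P "-1"] by simp
    next
      case (Suc n)
      thus ?case using grow[of "Suc n"] by simp
    qed
    from this[of "nat B"] B[of "int (nat B)"] show False by linarith
  qed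
  \<comment> \<open>Otherwise \<open>P + (a)\<close> and \<open>P : a\<close>, which contains
    \<open>P + (b)\<close>, would both have bounded Hilbert functions.\<close>
  have prime: "a \<in> P \<or> b \<in> P" if ab: "a \<in> H k" "b \<in> H m" "a * b \<in> P" for a b k m
  proof (rule ccontr)
    assume "\<not> ?thesis"
    hence "finite_mod_linear (addgen P a)" "finite_mod_linear (addgen P b)" using ext ab by auto
    hence "bdd_codim (addgen P a)" "bdd_codim (addgen P b)" using finite_mod_linear_bdd_codim hideal_addgen P(1) ab by blast+
    then obtain A B where AB: "\<And>j. codim (addgen P a) j \<le> A" "\<And>j. codim (addgen P b) j \<le> B"
      by (auto simp: bdd_codim_def)
    have "addgen P b \<subseteq> colon P a"
      using ab(3) by (intro addgen_minimal hideal_colon[OF P(1) ab(1)] colon_sub P(1))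
        (simp add: colon_def mult.commute)
    hence "codim (colon P a) j \<le> B" for j using codim_mono AB(2) order_trans by blast
    hence "codim P j \<le> A + B" for j
      using codim_addgen[OF P(1) ab(1), of j] AB(1)[of j] by (smt (verit))
    thus False using unb by (auto simp: bdd_codim_def)
  qed
  have "\<exists>i. var i \<notin> P"
  proof (rule ccontr)
    assume "\<nexists>i. var i \<notin> P"
    hence "H 1 \<subseteq> P" using H_sub_vars[OF P(1), of 1] by auto
    hence "H 1 \<subseteq> addgen P 0" using addgen_sub by blast
    thus False using P(3) by (auto simp: finite_mod_linear_def intro!: bexI[of _ 0] exI[of _ 1])
  qed
  then obtain i where i: "var i \<notin> P" by blast
  have hv: "hideal (addgen P (var i))" by (rule hideal_addgen[OF P(1) H_var])
  have "\<not> finite_colength (addgen P (var i))" using P(3) H_var by (auto simp: finite_mod_linear_def finite_colength_def)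
  then obtain P1 where P1: "hideal P1" "addgen P (var i) \<subseteq> P1" "\<not> finite_colength P1"
      and P1max: "\<And>I. hideal I \<Longrightarrow> P1 \<subset> I \<Longrightarrow> finite_colength I"
    using maximal_hideal[of "addgen P (var i)" finite_colength] finite_colength_finitary hv by metis
  have ext1: "finite_colength (addgen P1 a)" if "a \<in> H m" "a \<notin> P1" for a m
    using that addgen_sub[of P1 a] addgen_gen[OF P1(1), of a]
    by (intro P1max hideal_addgen[OF P1(1) that(1)]) auto
  have prime1: "a \<in> P1 \<or> b \<in> P1" if ab: "a \<in> H k" "b \<in> H m" "a * b \<in> P1" for a b k m
  proof (rule ccontr)
    assume "\<not> ?thesis"
    then obtain k' m' where km: "k' \<ge> 0" "H k' \<subseteq> addgen P1 a" "m' \<ge> 0" "H m' \<subseteq> addgen P1 b"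
      using ext1[OF ab(1)] ext1[OF ab(2)] by (auto simp: finite_colength_def)
    have "p * q \<in> P1" if pq: "p \<in> H k'" "q \<in> H m'" for p q
    proof -
      obtain p' c where p: "p = p' + c * a" "p' \<in> P1" using km(2) pq(1) by (auto simp: addgen_def)
      obtain q' d where q: "q = q' + d * b" "q' \<in> P1" using km(4) pq(2) by (auto simp: addgen_def)
      have "p * q = q * p' + c * a * q' + c * d * (a * b)" by (simp add: p(1) q(1) algebra_simps)
      thus ?thesis
        using hideal_add[OF P1(1) hideal_add[OF P1(1) hideal_mult[OF P1(1) p(2)] hideal_mult[OF P1(1) q(2)]]
          hideal_mult[OF P1(1) ab(3)]] by metis
    qed
    hence "H (k' + int (nat m')) \<subseteq> P1" using km by (intro H_mult_sub P1(1)) auto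
    thus False using P1(3) km by (auto simp: finite_colength_def)
  qed
  have "\<exists>j. var j \<notin> P1"
  proof (rule ccontr)
    assume "\<nexists>j. var j \<notin> P1"
    hence "H 1 \<subseteq> P1" using H_sub_vars[OF P1(1), of 1] by auto
    thus False using P1(3) zero_le_one by (auto simp: finite_colength_def)
  qed
  then obtain j where j: "var j \<notin> P1" by blast
  have sub: "P \<subseteq> P1" using addgen_sub P1(2) by blast
  have "var i \<in> P1" using addgen_gen[OF P(1), of "var i"] P1(2) by blast
  hence strict: "P \<subset> P1" using i sub by blast
  have "P \<in> Proj_points I0" using prime by (intro Proj_pointsI[OF P(1) I0[OF P(1,2)] i]) blast
  moreover have "P1 \<in> Proj_points I0"
    using prime1 P(2) sub by (intro Proj_pointsI[OF P1(1) I0[OF P1(1)] j]) blast+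
  ultimately have "ereal (real (length [P, P1] - 1)) \<le> Proj_dim I0"
    unfolding Proj_dim_def using strict by (intro SUP_upper) auto
  thus False using dim by simp
qed

subsection \<open>Graded free modules\<close>

text \<open>Elements of free modules are functions that vanish beyond the rank; as a type they form
  a vector space. The vectors of the resolution are their restrictions
  \<open>vec n v\<close>.\<close>

definition fscale :: "complex \<Rightarrow> (nat \<Rightarrow> poly4) \<Rightarrow> nat \<Rightarrow> poly4" where
  "fscale c v = (\<lambda>i. const c * v i)"

global_interpretation W: vector_space fscale
  by unfold_locales (auto simp: fscale_def algebra_simps fun_eq_iff)

global_interpretation WV: vector_space_pair fscale cscale ..
global_interpretation VW: vector_space_pair cscale fscale ..
global_interpretation WW: vector_space_pair fscale fscale ..

text \<open>The homogeneous elements of degree \<open>k\<close> of \<open>\<Oplus>\<^sub>i S(- a\<^sub>i)\<close>.\<close>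

definition F :: "int list \<Rightarrow> int \<Rightarrow> (nat \<Rightarrow> poly4) set" where
  "F a k = {v. (\<forall>i<length a. v i \<in> H (k - a ! i)) \<and> (\<forall>i\<ge>length a. v i = 0)}"

lemma subspace_F: "W.subspace (F a k)"
  by (auto simp: W.subspace_def F_def fscale_def intro: H_add H_const_mult)

lemma W_findim_sum:
  assumes "W.findim A" "W.findim B"
  shows "W.findim {a + b | a b. a \<in> A \<and> b \<in> B}"
proof -
  obtain A' B' where "finite A'" "A \<subseteq> W.span A'" "finite B'" "B \<subseteq> W.span B'"
    using assms unfolding W.findim_def by blast
  moreover from this have "{a + b | a b. a \<in> A \<and> b \<in> B} \<subseteq> W.span (A' \<union> B')"
    using W.span_mono[of A' "A' \<union> B'"] W.span_mono[of B' "A' \<union> B'"] by (auto intro!: W.span_add)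
  ultimately show ?thesis unfolding W.findim_def by blast
qed

lemma F_snoc:
  "v \<in> F (a @ [b]) k \<longleftrightarrow> v(length a := 0) \<in> F a k \<and> v (length a) \<in> H (k - b)"
  by (auto simp: F_def nth_append less_Suc_eq)

lemma findim_F: "W.findim (F a k)"
proof (induction a rule: rev_induct)
  case Nil
  have "F [] k \<subseteq> W.span {}" by (auto simp: F_def W.span_empty)
  thus ?case unfolding W.findim_def by blast
next
  case (snoc b a)
  let ?s = "\<lambda>p. (\<lambda>i. if i = length a then p else 0) :: nat \<Rightarrow> poly4"
  have lin: "Vector_Spaces.linear cscale fscale ?s"
    by unfold_locales (auto simp: fscale_def cscale_def fun_eq_iff)
  have "F (a @ [b]) k \<subseteq> {x + y | x y. x \<in> F a k \<and> y \<in> ?s ` H (k - b)}"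
  proof
    fix v assume v: "v \<in> F (a @ [b]) k"
    have "v = v(length a := 0) + ?s (v (length a))" by (auto simp: fun_eq_iff)
    thus "v \<in> {x + y | x y. x \<in> F a k \<and> y \<in> ?s ` H (k - b)}" using v unfolding F_snoc by blast
  qed
  thus ?case using W.findim_mono[OF W_findim_sum[OF snoc VW.findim_image[OF lin findim_H]]] by blast
qed

lemma dim_F: "int (W.dim (F a k)) = (\<Sum>i<length a. hilb (k - a ! i))"
proof (induction a rule: rev_induct)
  case Nil
  have "F [] k = W.span {}" by (auto simp: F_def W.span_empty)
  thus ?case using W.dim_span_eq_card_independent[OF W.independent_empty] by simp
next
  case (snoc b a)
  let ?p = "\<lambda>v. v (length a) :: poly4"
  have lin: "Vector_Spaces.linear fscale cscale ?p"
    by unfold_locales (auto simp: fscale_def cscale_def)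
  have im: "?p ` F (a @ [b]) k = H (k - b)"
  proof (intro equalityI subsetI)
    fix q assume "q \<in> H (k - b)"
    hence "(\<lambda>i. if i = length a then q else 0) \<in> F (a @ [b]) k" by (auto simp: F_def nth_append)
    thus "q \<in> ?p ` F (a @ [b]) k" by (rule image_eqI[rotated]) simp
  qed (auto simp: F_snoc)
  have ker: "{v \<in> F (a @ [b]) k. ?p v = 0} = F a k"
  proof (intro equalityI subsetI)
    fix v assume "v \<in> F a k"
    moreover from this have "v (length a) = 0" by (simp add: F_def)
    moreover from this have "v(length a := 0) = v" by auto
    ultimately show "v \<in> {v \<in> F (a @ [b]) k. ?p v = 0}" by (simp add: F_snoc)
  next
    fix v assume v: "v \<in> {v \<in> F (a @ [b]) k. ?p v = 0}"
    hence "v(length a := 0) = v" by auto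
    thus "v \<in> F a k" using v unfolding F_snoc by simp
  qed
  have "int (W.dim (F (a @ [b]) k)) = hilb (k - b) + int (W.dim (F a k))"
    using WV.rank_nullity[OF lin subspace_F findim_F, of "a @ [b]" k] unfolding im ker by (simp add: hilb_def)
  also have "\<dots> = (\<Sum>i<length (a @ [b]). hilb (k - (a @ [b]) ! i))"
    unfolding snoc by (simp add: nth_append)
  finally show ?case .
qed

definition mat_map :: "poly4 mat \<Rightarrow> (nat \<Rightarrow> poly4) \<Rightarrow> nat \<Rightarrow> poly4" where
  "mat_map M v = (\<lambda>i. if i < dim_row M then \<Sum>j<dim_col M. M $$ (i, j) * v j else 0)"

lemma linear_mat_map: "Vector_Spaces.linear fscale fscale (mat_map M)"
  by unfold_locales
    (auto simp: mat_map_def fscale_def fun_eq_iff algebra_simps sum.distrib sum_distrib_left)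

lemma mult_mat_vec_mat_map:
  assumes "M \<in> carrier_mat n m"
  shows "M *\<^sub>v vec m v = vec n (mat_map M v)"
  using assms by (intro eq_vecI) (auto simp: mat_map_def scalar_prod_def lessThan_atLeast0)

lemma graded_hom_entry:
  "graded_hom b a M \<Longrightarrow> i < length a \<Longrightarrow> j < length b \<Longrightarrow> M $$ (i, j) \<in> H (b ! j - a ! i)"
  by (auto simp: graded_hom_def H_def)

lemma graded_hom_carrier: "graded_hom b a M \<Longrightarrow> M \<in> carrier_mat (length a) (length b)"
  by (simp add: graded_hom_def)

lemma mat_map_F:
  assumes M: "graded_hom b a M" and v: "v \<in> F b k"
  shows "mat_map M v \<in> F a k"
  unfolding F_def
proof (intro CollectI conjI allI impI)
  fix i assume i: "i < length a"
  have "(\<Sum>j<length b. M $$ (i, j) * v j) \<in> H (k - a ! i)"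
  proof (rule H_sum)
    fix j assume "j \<in> {..<length b}"
    thus "M $$ (i, j) * v j \<in> H (k - a ! i)"
      using v graded_hom_entry[OF M i, of j] by (intro H_mult'[of _ "b ! j - a ! i" _ "k - b ! j"]) (auto simp: F_def)
  qed
  thus "mat_map M v i \<in> H (k - a ! i)" using graded_hom_carrier[OF M] i by (simp add: mat_map_def)
qed (use graded_hom_carrier[OF M] in \<open>simp add: mat_map_def\<close>)

text \<open>Taking homogeneous components, a homogeneous vector in the image of a graded matrix is the image of a
  homogeneous vector.\<close>

lemma image_piece:
  assumes M: "graded_hom b a M"
  shows "{v \<in> F a k. vec (length a) v \<in> mat_image M} = mat_map M ` F b k"
proof (intro equalityI subsetI)
  note MC = graded_hom_carrier[OF M]
  fix v assume v: "v \<in> {v \<in> F a k. vec (length a) v \<in> mat_image M}"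
  then obtain w where w: "w \<in> carrier_vec (length b)" "vec (length a) v = M *\<^sub>v w"
    using MC by (auto simp: mat_image_def)
  define u where "u = (\<lambda>j. if j < length b then hcomp (k - b ! j) (w $ j) else 0)"
  have uF: "u \<in> F b k" by (simp add: F_def u_def)
  have "mat_map M u i = v i" for i
  proof (cases "i < length a")
    case True
    have "v i = (\<Sum>j<length b. M $$ (i, j) * w $ j)"
      using arg_cong[OF w(2), of "\<lambda>v. vec_index v i"] True MC w(1)
      by (simp add: scalar_prod_def lessThan_atLeast0)
    moreover have "v i \<in> H (k - a ! i)" using v True by (simp add: F_def)
    hence "v i = hcomp (k - a ! i) (v i)" using hcomp_H by simp
    ultimately have "v i = (\<Sum>j<length b. hcomp (k - a ! i) (M $$ (i, j) * w $ j))"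
      using hcomp_sum by metis
    also have "\<dots> = (\<Sum>j<length b. M $$ (i, j) * u j)"
    proof (intro sum.cong refl)
      fix j assume "j \<in> {..<length b}"
      thus "hcomp (k - a ! i) (M $$ (i, j) * w $ j) = M $$ (i, j) * u j"
        using hcomp_mult_H[OF graded_hom_entry[OF M True, of j], of "k - a ! i" "w $ j"]
        by (simp add: u_def mult.commute)
    qed
    finally show ?thesis using True MC by (simp add: mat_map_def)
  next
    case False
    thus ?thesis using v MC by (simp add: mat_map_def F_def)
  qed
  thus "v \<in> mat_map M ` F b k" using uF by (metis ext image_eqI)
next
  fix v assume "v \<in> mat_map M ` F b k"
  then obtain u where u: "u \<in> F b k" "v = mat_map M u" by blast
  have "vec (length a) v = M *\<^sub>v vec (length b) u"
    unfolding u(2) mult_mat_vec_mat_map[OF graded_hom_carrier[OF M]] ..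
  thus "v \<in> {v \<in> F a k. vec (length a) v \<in> mat_image M}"
    using u mat_map_F[OF M u(1)] graded_hom_carrier[OF M] by (auto simp: mat_image_def)
qed

lemma kernel_piece:
  assumes M: "graded_hom b a M"
  shows "{v \<in> F b k. mat_map M v = 0} = {v \<in> F b k. vec (length b) v \<in> mat_kernel M}"
proof -
  have "mat_map M v = 0 \<longleftrightarrow> vec (length b) v \<in> mat_kernel M" for v
  proof -
    have "vec (length b) v \<in> mat_kernel M \<longleftrightarrow> vec (length a) (mat_map M v) = 0\<^sub>v (length a)"
      using graded_hom_carrier[OF M] by (auto simp: mat_kernel_def mult_mat_vec_mat_map[OF graded_hom_carrier[OF M]])
    also have "\<dots> \<longleftrightarrow> (\<forall>i<length a. mat_map M v i = 0)"
      by (auto simp: vec_eq_iff)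
    also have "\<dots> \<longleftrightarrow> mat_map M v = 0"
      using graded_hom_carrier[OF M] by (auto simp: fun_eq_iff mat_map_def)
    finally show ?thesis by blast
  qed
  thus ?thesis by blast
qed

lemma dim_exact:
  assumes M: "graded_hom b a M"
  shows "int (W.dim (mat_map M ` F b k)) = int (W.dim (F b k)) - int (W.dim {v \<in> F b k. vec (length b) v \<in> mat_kernel M})"
  using WW.rank_nullity[OF linear_mat_map[of M] subspace_F findim_F, of b k] kernel_piece[OF M, of k] by simp

subsection \<open>Four polynomials and their syzygies\<close>

definition syz :: "poly4 \<Rightarrow> poly4 \<Rightarrow> poly4 \<Rightarrow> poly4 \<Rightarrow> int \<Rightarrow> poly4 \<Rightarrow> poly4 \<Rightarrow> poly4 \<Rightarrow> poly4 \<Rightarrow> bool" where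
  "syz p1 p2 p3 p4 s a1 a2 a3 a4 \<longleftrightarrow> a1 \<in> H s \<and> a2 \<in> H s \<and> a3 \<in> H s \<and> a4 \<in> H s \<and>
     a1 * p1 + a2 * p2 + a3 * p3 + a4 * p4 = 0"

definition tuple4 :: "poly4 \<Rightarrow> poly4 \<Rightarrow> poly4 \<Rightarrow> poly4 \<Rightarrow> nat \<Rightarrow> poly4" where
  "tuple4 a1 a2 a3 a4 = (\<lambda>i. if i = 0 then a1 else if i = 1 then a2 else if i = 2 then a3 else if i = 3 then a4 else 0)"

definition syz_space :: "poly4 \<Rightarrow> poly4 \<Rightarrow> poly4 \<Rightarrow> poly4 \<Rightarrow> int \<Rightarrow> (nat \<Rightarrow> poly4) set" where
  "syz_space p1 p2 p3 p4 s = {v. syz p1 p2 p3 p4 s (v 0) (v 1) (v 2) (v 3) \<and> (\<forall>i\<ge>4. v i = 0)}"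

lemma less_4_iff: "(\<forall>i<(4::nat). P i) \<longleftrightarrow> P 0 \<and> P 1 \<and> P 2 \<and> P 3"
  by (auto simp: numeral_eq_Suc less_Suc_eq)

lemma F_4: "v \<in> F [b1, b2, b3, b4] k \<longleftrightarrow> v 0 \<in> H (k - b1) \<and> v 1 \<in> H (k - b2) \<and> v 2 \<in> H (k - b3) \<and>
    v 3 \<in> H (k - b4) \<and> (\<forall>i\<ge>4. v i = 0)"
  by (auto simp: F_def less_4_iff numeral_eq_Suc less_Suc_eq)

lemma syz_space_F: "syz_space p1 p2 p3 p4 s = {v \<in> F [0, 0, 0, 0] s. v 0 * p1 + v 1 * p2 + v 2 * p3 + v 3 * p4 = 0}"
  by (auto simp: syz_space_def F_4 syz_def)

lemma dim_F_4: "int (W.dim (F [b1, b2, b3, b4] k)) = hilb (k - b1) + hilb (k - b2) + hilb (k - b3) + hilb (k - b4)"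
  by (simp add: dim_F numeral_eq_Suc lessThan_Suc)

text \<open>Exactness of \<open>0 \<rightarrow> syzygies \<rightarrow> S(-e)^4 \<rightarrow> S
  \<rightarrow> S / J \<rightarrow> 0\<close> in degree \<open>k\<close>.\<close>

lemma codim_gen4:
  assumes p: "p1 \<in> H e" "p2 \<in> H e" "p3 \<in> H e" "p4 \<in> H e"
  shows "codim (gen [p4, p3, p2, p1]) k = hilb k - 4 * hilb (k - e) + int (W.dim (syz_space p1 p2 p3 p4 (k - e)))"
proof -
  let ?g = "\<lambda>v. v 0 * p1 + v 1 * p2 + v 2 * p3 + v 3 * p4 :: poly4"
  have lin: "Vector_Spaces.linear fscale cscale ?g"
    by unfold_locales (auto simp: fscale_def cscale_def algebra_simps)
  have im: "?g ` F [0, 0, 0, 0] (k - e) = gen [p4, p3, p2, p1] \<inter> H k"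
  proof (intro equalityI subsetI)
    fix q assume q: "q \<in> gen [p4, p3, p2, p1] \<inter> H k"
    have h: "hideal (gen [p3, p2, p1])" "hideal (gen [p2, p1])" "hideal (gen [p1])"
      by (rule hideal_gen, use p in auto)+
    obtain a4 where a4: "a4 \<in> H (k - e)" "q - a4 * p4 \<in> gen [p3, p2, p1]"
      using addgen_homE[OF h(1) p(4), of q k] q by auto
    have h4: "q - a4 * p4 \<in> H k" using q H_mult[OF a4(1) p(4)] by (auto intro: H_diff)
    obtain a3 where a3: "a3 \<in> H (k - e)" "q - a4 * p4 - a3 * p3 \<in> gen [p2, p1]"
      using addgen_homE[OF h(2) p(3) _ h4] a4(2) by auto
    have h3: "q - a4 * p4 - a3 * p3 \<in> H k" using h4 H_mult[OF a3(1) p(3)] by (auto intro: H_diff)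
    obtain a2 where a2: "a2 \<in> H (k - e)" "q - a4 * p4 - a3 * p3 - a2 * p2 \<in> gen [p1]"
      using addgen_homE[OF h(3) p(2) _ h3] a3(2) by auto
    have h2: "q - a4 * p4 - a3 * p3 - a2 * p2 \<in> H k" using h3 H_mult[OF a2(1) p(2)] by (auto intro: H_diff)
    obtain a1 where a1: "a1 \<in> H (k - e)" "q - a4 * p4 - a3 * p3 - a2 * p2 - a1 * p1 \<in> {0}"
      using addgen_homE[OF hideal_zero p(1) _ h2] a2(2) by auto
    have "tuple4 a1 a2 a3 a4 \<in> F [0, 0, 0, 0] (k - e)" using a1 a2 a3 a4 by (simp add: F_4 tuple4_def)
    moreover have "?g (tuple4 a1 a2 a3 a4) = q" using a1(2) by (simp add: tuple4_def algebra_simps)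
    ultimately show "q \<in> ?g ` F [0, 0, 0, 0] (k - e)" by blast
  next
    fix q assume "q \<in> ?g ` F [0, 0, 0, 0] (k - e)"
    then obtain v where v: "v \<in> F [0, 0, 0, 0] (k - e)" "q = ?g v" by blast
    have "q \<in> H k" unfolding v(2) using v(1) p by (intro H_add H_mult'[where k="k - e" and l=e]) (auto simp: F_4)
    moreover have "q \<in> gen [p4, p3, p2, p1]"
    proof -
      have hl: "hlist [p4, p3, p2, p1]" using p by auto
      have "set [p4, p3, p2, p1] \<subseteq> gen [p4, p3, p2, p1]" by (rule gen_gens[OF hl])
      thus ?thesis unfolding v(2) using hideal_gen[OF hl]
        by (simp del: gen.simps add: hideal_add hideal_mult)
    qed
    ultimately show "q \<in> gen [p4, p3, p2, p1] \<inter> H k" by simp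
  qed
  have ker: "{v \<in> F [0, 0, 0, 0] (k - e). ?g v = 0} = syz_space p1 p2 p3 p4 (k - e)"
    unfolding syz_space_F ..
  have "int (W.dim (F [0, 0, 0, 0] (k - e))) = int (V.dim (gen [p4, p3, p2, p1] \<inter> H k)) +
      int (W.dim (syz_space p1 p2 p3 p4 (k - e)))"
    using WV.rank_nullity[OF lin subspace_F findim_F, of "[0, 0, 0, 0]" "k - e"] unfolding im ker by simp
  thus ?thesis unfolding codim_def dim_F_4 by simp
qed

subsection \<open>The Hilbert polynomial from the Betti numbers\<close>

text \<open>Differences with step \<open>n\<close> of a bounded function stay bounded as
  \<open>n\<close> grows; the third difference is \<open>6 * a * n ^ 3\<close>, and the lower
  coefficients follow in turn.\<close>

lemma bounded_cubic:
  fixes a b c d B L0 :: int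
  assumes "\<And>L. L \<ge> L0 \<Longrightarrow> \<bar>a * L ^ 3 + b * L ^ 2 + c * L + d\<bar> \<le> B"
  shows "a = 0 \<and> b = 0 \<and> c = 0"
proof -
  define P where "P L = a * L ^ 3 + b * L ^ 2 + c * L + d" for L
  have PB: "\<bar>P L\<bar> \<le> B" if "L \<ge> L0" for L using assms[OF that] by (simp add: P_def)
  have aux: "x = 0" if "\<And>n::int. n \<ge> 1 \<Longrightarrow> \<bar>x * n\<bar> \<le> C" for x C :: int
  proof (rule ccontr)
    assume "x \<noteq> 0"
    hence "1 \<le> \<bar>x\<bar>" by simp
    hence "1 * (\<bar>C\<bar> + 1) \<le> \<bar>x\<bar> * (\<bar>C\<bar> + 1)" by (intro mult_right_mono) auto
    hence "\<bar>C\<bar> + 1 \<le> \<bar>x * (\<bar>C\<bar> + 1)\<bar>" unfolding abs_mult by simp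
    thus False using that[of "\<bar>C\<bar> + 1"] by linarith
  qed
  have le: "\<bar>x * n\<bar> \<le> \<bar>x * n ^ m\<bar>" if "n \<ge> 1" "m \<ge> 1" for x n :: int and m :: nat
  proof -
    have "n ^ 1 \<le> n ^ m" using that by (intro power_increasing) auto
    thus ?thesis using that by (simp add: abs_mult mult_left_mono)
  qed
  have "6 * a = 0"
  proof (rule aux[of _ "8 * B"])
    fix n :: int assume n: "n \<ge> 1"
    have "6 * a * n ^ 3 = P (L0 + 3 * n) - 3 * P (L0 + 2 * n) + 3 * P (L0 + n) - P L0"
      by (simp add: P_def power3_eq_cube power2_eq_square algebra_simps)
    moreover have "\<bar>P (L0 + 3 * n)\<bar> \<le> B" "\<bar>P (L0 + 2 * n)\<bar> \<le> B" "\<bar>P (L0 + n)\<bar> \<le> B" "\<bar>P L0\<bar> \<le> B"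
      using n by (auto intro!: PB)
    ultimately have "\<bar>6 * a * n ^ 3\<bar> \<le> 8 * B" by linarith
    thus "\<bar>6 * a * n\<bar> \<le> 8 * B" using le[OF n, of 3 "6 * a"] by linarith
  qed
  hence a: "a = 0" by simp
  have "2 * b = 0"
  proof (rule aux[of _ "4 * B"])
    fix n :: int assume n: "n \<ge> 1"
    have "2 * b * n ^ 2 = P (L0 + 2 * n) - 2 * P (L0 + n) + P L0"
      using a by (simp add: P_def power2_eq_square algebra_simps)
    moreover have "\<bar>P (L0 + 2 * n)\<bar> \<le> B" "\<bar>P (L0 + n)\<bar> \<le> B" "\<bar>P L0\<bar> \<le> B"
      using n by (auto intro!: PB)
    ultimately have "\<bar>2 * b * n ^ 2\<bar> \<le> 4 * B" by linarith
    thus "\<bar>2 * b * n\<bar> \<le> 4 * B" using le[OF n, of 2 "2 * b"] by linarith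
  qed
  hence b: "b = 0" by simp
  have "c = 0"
  proof (rule aux[of _ "2 * B"])
    fix n :: int assume n: "n \<ge> 1"
    have "c * n = P (L0 + n) - P L0"
      using a b by (simp add: P_def algebra_simps)
    moreover have "\<bar>P (L0 + n)\<bar> \<le> B" "\<bar>P L0\<bar> \<le> B"
      using n by (auto intro!: PB)
    ultimately show "\<bar>c * n\<bar> \<le> 2 * B" by linarith
  qed
  thus ?thesis using a b by simp
qed

definition power_sum :: "nat \<Rightarrow> int list \<Rightarrow> int" where
  "power_sum m xs = (\<Sum>i<length xs. (xs ! i) ^ m)"

text \<open>The expansion is centred at \<open>k + 2\<close> because
  \<open>(k + 1) * (k + 2) * (k + 3) = (k + 2) ^ 3 - (k + 2)\<close>.\<close>

lemma sum_hilb_list: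
  assumes "\<And>x. x \<in> set xs \<Longrightarrow> k - x \<ge> -3"
  shows "6 * (\<Sum>i<length xs. hilb (k - xs ! i)) =
    power_sum 0 xs * ((k + 2) ^ 3 - (k + 2)) - 3 * power_sum 1 xs * (k + 2) ^ 2 + 3 * power_sum 2 xs * (k + 2) - power_sum 3 xs + power_sum 1 xs"
proof -
  have "6 * hilb (k - xs ! i) = (k + 2) ^ 3 - (k + 2) - 3 * (k + 2) ^ 2 * (xs ! i) ^ 1 + 3 * (k + 2) * (xs ! i) ^ 2
      - (xs ! i) ^ 3 + (xs ! i) ^ 1" if "i < length xs" for i
    using assms[of "xs ! i"] that by (subst hilb_eq) (auto simp: power3_eq_cube power2_eq_square algebra_simps)
  hence "6 * (\<Sum>i<length xs. hilb (k - xs ! i)) = (\<Sum>i<length xs. (k + 2) ^ 3 - (k + 2) - 3 * (k + 2) ^ 2 * (xs ! i) ^ 1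
      + 3 * (k + 2) * (xs ! i) ^ 2 - (xs ! i) ^ 3 + (xs ! i) ^ 1)"
    by (simp add: sum_distrib_left)
  also have "\<dots> = int (length xs) * ((k + 2) ^ 3 - (k + 2)) - 3 * (k + 2) ^ 2 * power_sum 1 xs + 3 * (k + 2) * power_sum 2 xs
      - power_sum 3 xs + power_sum 1 xs"
    unfolding power_sum_def by (simp add: sum.distrib sum_subtractf sum_distrib_left)
  also have "int (length xs) = power_sum 0 xs" by (simp add: power_sum_def)
  finally show ?thesis by (simp add: mult_ac)
qed

text \<open>With \<open>L = k - e + 2\<close> and the alternating power sums \<open>s m\<close>,
  vanishing of the coefficients of \<open>L ^ 3\<close>, \<open>L ^ 2\<close> and \<open>L\<close>
  gives \<open>s 0 = 3\<close>, \<open>s 1 = e\<close> and \<open>s 2 = - e ^ 2\<close>. The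
  constant term then reduces to \<open>e ^ 3 - s 3\<close>, and this is
  \<open>6 * \<tau>\<close>.\<close>

lemma constant_Hilbert_polynomial:
  assumes codim: "\<And>k. codim J k = hilb k - 4 * hilb (k - e) + (\<Sum>i<length ds. hilb (k - e - ds ! i))
      - (\<Sum>i<length cs. hilb (k - e - cs ! i)) + (\<Sum>i<length bs. hilb (k - e - bs ! i))"
    and bdd_codim: "bdd_codim J"
  obtains k0 \<tau> where "\<And>k. k \<ge> k0 \<Longrightarrow> codim J k = \<tau>" "- power_sum 3 ds + power_sum 3 cs - power_sum 3 bs = 6 * \<tau> - e ^ 3"
proof -
  define s where "s m = power_sum m ds - power_sum m cs + power_sum m bs" for m
  define N where "N = (\<Sum>x\<in>set ds \<union> set cs \<union> set bs. \<bar>x\<bar>)"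
  \<comment> \<open>Large enough to keep all shifted arguments within the range of
    \<open>hilb_eq\<close>.\<close>
  define L0 where "L0 = N + \<bar>e\<bar> + 5"
  have N: "x \<le> N" if "x \<in> set ds \<union> set cs \<union> set bs" for x
    using member_le_sum[of x "set ds \<union> set cs \<union> set bs" abs] that by (simp add: N_def)
  have N0: "N \<ge> 0" unfolding N_def by (rule sum_nonneg) simp
  have poly: "6 * codim J (L + e - 2) = (s 0 - 3) * L ^ 3 + 3 * (e - s 1) * L ^ 2 + (3 * (e ^ 2 + s 2) - (s 0 - 3)) * L
      + (e ^ 3 - e - s 3 + s 1)" if L: "L \<ge> L0" for L
  proof -
    have "6 * (\<Sum>i<length xs. hilb (L - 2 - xs ! i)) = power_sum 0 xs * (L ^ 3 - L) - 3 * power_sum 1 xs * L ^ 2 + 3 * power_sum 2 xs * L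
        - power_sum 3 xs + power_sum 1 xs" if "set xs \<subseteq> set ds \<union> set cs \<union> set bs" for xs
      using sum_hilb_list[of xs "L - 2"] N that L by (fastforce simp: L0_def)
    from this[of ds] this[of cs] this[of bs]
    have sums: "6 * (\<Sum>i<length ds. hilb (L - 2 - ds ! i)) = power_sum 0 ds * (L ^ 3 - L) - 3 * power_sum 1 ds * L ^ 2
        + 3 * power_sum 2 ds * L - power_sum 3 ds + power_sum 1 ds"
      "6 * (\<Sum>i<length cs. hilb (L - 2 - cs ! i)) = power_sum 0 cs * (L ^ 3 - L) - 3 * power_sum 1 cs * L ^ 2
        + 3 * power_sum 2 cs * L - power_sum 3 cs + power_sum 1 cs"
      "6 * (\<Sum>i<length bs. hilb (L - 2 - bs ! i)) = power_sum 0 bs * (L ^ 3 - L) - 3 * power_sum 1 bs * L ^ 2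
        + 3 * power_sum 2 bs * L - power_sum 3 bs + power_sum 1 bs"
      by auto
    have h1: "6 * hilb (L + e - 2) = (L + e) ^ 3 - (L + e)"
      using L N0 by (subst hilb_eq) (auto simp: L0_def power3_eq_cube algebra_simps)
    have h2: "6 * hilb (L - 2) = L ^ 3 - L"
      using L N0 by (subst hilb_eq) (auto simp: L0_def power3_eq_cube algebra_simps)
    have eqs: "L + e - 2 - e = L - 2" by simp
    have "6 * codim J (L + e - 2) = 6 * hilb (L + e - 2) - 4 * (6 * hilb (L - 2)) + 6 * (\<Sum>i<length ds. hilb (L - 2 - ds ! i))
      - 6 * (\<Sum>i<length cs. hilb (L - 2 - cs ! i)) + 6 * (\<Sum>i<length bs. hilb (L - 2 - bs ! i))"
      unfolding codim[of "L + e - 2"] eqs by (simp add: ring_distribs)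
    also have "\<dots> = (s 0 - 3) * L ^ 3 + 3 * (e - s 1) * L ^ 2 + (3 * (e ^ 2 + s 2) - (s 0 - 3)) * L
      + (e ^ 3 - e - s 3 + s 1)"
      unfolding h1 h2 sums s_def by (simp add: power3_eq_cube power2_eq_square algebra_simps)
    finally show ?thesis .
  qed
  obtain B where B: "\<And>k. codim J k \<le> B" using bdd_codim by (auto simp: bdd_codim_def)
  have "s 0 - 3 = 0 \<and> 3 * (e - s 1) = 0 \<and> 3 * (e ^ 2 + s 2) - (s 0 - 3) = 0"
  proof (rule bounded_cubic[of L0 _ _ _ "e ^ 3 - e - s 3 + s 1" "6 * B"])
    fix L assume "L \<ge> L0"
    thus "\<bar>(s 0 - 3) * L ^ 3 + 3 * (e - s 1) * L ^ 2 + (3 * (e ^ 2 + s 2) - (s 0 - 3)) * L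
      + (e ^ 3 - e - s 3 + s 1)\<bar> \<le> 6 * B"
      using poly[of L] B[of "L + e - 2"] codim_nonneg[of J "L + e - 2"] by linarith
  qed
  hence s: "s 0 = 3" "s 1 = e" "e ^ 2 + s 2 = 0" by auto
  have const: "6 * codim J k = e ^ 3 - s 3" if "k \<ge> L0 + e" for k
    using poly[of "k - e + 2"] that s by simp
  show ?thesis
  proof (rule that[of "L0 + e" "codim J (L0 + e)"])
    show "codim J k = codim J (L0 + e)" if "k \<ge> L0 + e" for k
      using const[OF that] const[of "L0 + e"] by simp
    show "- power_sum 3 ds + power_sum 3 cs - power_sum 3 bs = 6 * codim J (L0 + e) - e ^ 3"
      using const[of "L0 + e"] by (simp add: s_def)
  qed
qed

section \<open>The resolution of the Jacobian algebra, degree by degree\<close>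

abbreviation Jac :: "poly4 \<Rightarrow> poly4 set" where
  "Jac f \<equiv> gen [partial 3 f, partial 2 f, partial 1 f, partial 0 f]"

lemma gradient_row_H:
  assumes "graded_hom (replicate 4 e) [0] (gradient_row f)"
  shows "partial i f \<in> H e"
proof -
  have "gradient_row f $$ (0, j) \<in> H e" if "j < 4" for j
    using graded_hom_entry[OF assms, of 0 j] that by simp
  hence "\<forall>j<4. gradient_row f $$ (0, j) \<in> H e" by blast
  hence "\<forall>i. partial i f \<in> H e"
    unfolding less_4_iff all_4 by (simp add: gradient_row_def mat_of_rows_list_def numeral_eq_Suc)
  thus ?thesis by blast
qed

lemma AR_piece:
  "{v \<in> F (replicate 4 e) k. vec 4 v \<in> AR f} =
    syz_space (partial 0 f) (partial 1 f) (partial 2 f) (partial 3 f) (k - e)"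
proof -
  have r: "replicate 4 e = [e, e, e, e]" by (simp add: numeral_eq_Suc)
  show ?thesis unfolding r syz_space_F by (auto simp: F_4 AR_def)
qed

lemma resolution_pieces:
  assumes M: "graded_hom b a M" and N: "graded_hom c b N" and ex: "mat_kernel M = mat_image N"
  shows "int (W.dim (mat_map M ` F b k)) = int (W.dim (F b k)) - int (W.dim (mat_map N ` F c k))"
  unfolding dim_exact[OF M] ex image_piece[OF N] ..

lemma resolution_codim:
  assumes "graded_betti d f ds cs bs" and e: "e = int d - 1"
  shows "partial i f \<in> H e"
    and "codim (Jac f) k = hilb k - 4 * hilb (k - e) + (\<Sum>i<length ds. hilb (k - e - ds ! i))
      - (\<Sum>i<length cs. hilb (k - e - cs ! i)) + (\<Sum>i<length bs. hilb (k - e - bs ! i))"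
proof -
  let ?sh = "map (\<lambda>a. e + a)"
  obtain A B C where A: "graded_hom (?sh ds) (replicate 4 e) A"
    and B: "graded_hom (?sh cs) (?sh ds) B" and C: "graded_hom (?sh bs) (?sh cs) C"
    and ex: "mat_image A = AR f" "mat_kernel A = mat_image B" "mat_kernel B = mat_image C"
      "mat_kernel C = {0\<^sub>v (length bs)}"
    and g: "graded_hom (replicate 4 e) [0] (gradient_row f)"
    using assms(1) unfolding graded_betti_def Let_def e by blast
  show p: "partial i f \<in> H e" for i by (rule gradient_row_H[OF g])
  have dF: "int (W.dim (F (?sh xs) k)) = (\<Sum>i<length xs. hilb (k - e - xs ! i))" for xs
    unfolding dim_F by (simp add: diff_diff_eq)
  have "{v \<in> F (?sh bs) k. vec (length (?sh bs)) v \<in> mat_kernel C} = {0}"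
    unfolding ex(4) by (auto simp: F_def vec_eq_iff fun_eq_iff not_less[symmetric]) blast
  hence 0: "W.dim {v \<in> F (?sh bs) k. vec (length (?sh bs)) v \<in> mat_kernel C} = 0"
    using W.dim_span_eq_card_independent[OF W.independent_empty] by (simp add: W.span_empty)
  have "mat_map A ` F (?sh ds) k = {v \<in> F (replicate 4 e) k. vec (length (replicate 4 e)) v \<in> AR f}"
    unfolding image_piece[OF A, symmetric] ex ..
  also have "\<dots> = syz_space (partial 0 f) (partial 1 f) (partial 2 f) (partial 3 f) (k - e)"
    using AR_piece[of e k f] by simp
  finally have "codim (Jac f) k = hilb k - 4 * hilb (k - e) + int (W.dim (mat_map A ` F (?sh ds) k))"
    using codim_gen4[OF p[of 0] p[of 1] p[of 2] p[of 3], of k] by simp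
  thus "codim (Jac f) k = hilb k - 4 * hilb (k - e) + (\<Sum>i<length ds. hilb (k - e - ds ! i))
      - (\<Sum>i<length cs. hilb (k - e - cs ! i)) + (\<Sum>i<length bs. hilb (k - e - bs ! i))"
    using resolution_pieces[OF A B ex(2), of k] resolution_pieces[OF B C ex(3), of k] dim_exact[OF C, of k] 0
    unfolding dF by linarith
qed

lemma one_notin_vars: "1 \<notin> gen [var 3, var 2, var 1, var 0]"
proof
  have step: "1 \<in> I" if "hideal I" "1 \<in> addgen I (var i)" for I i
    using addgen_homE[OF that(1) H_var that(2) H_1] H_neg[of "-1"] by fastforce
  have h: "hideal (gen [var 2, var 1, var 0])" "hideal (gen [var 1, var 0])" "hideal (gen [var 0])"
    by (rule hideal_gen, use H_var in \<open>simp, blast\<close>)+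
  assume "1 \<in> gen [var 3, var 2, var 1, var 0]"
  thus False using step[OF h(1)] step[OF h(2)] step[OF h(3)] step[OF hideal_zero] by auto
qed

lemma irrelevant_sub: "irrelevant_ideal \<subseteq> gen [var 3, var 2, var 1, var 0]"
proof -
  have hl: "hlist [var 3, var 2, var 1, var 0]" using H_var by (simp, blast)
  have "range var \<subseteq> set [var 3, var 2, var 1, var 0]" unfolding UNIV_4' by auto
  thus ?thesis unfolding irrelevant_ideal_def
    by (intro S.genideal_minimal ideal_hideal hideal_gen[OF hl] order_trans[OF _ gen_gens[OF hl]])
qed

text \<open>A relation among the generators with a unit coefficient contradicts minimality.\<close>

lemma minimal_kernel:
  assumes A: "graded_hom b a A" and B: "graded_hom c b B" and ex: "mat_kernel A = mat_image B"
    and min: "minimal_mat B" and v: "mat_map A v = 0" and j: "j < length b"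
  shows "v j \<noteq> 1"
proof
  assume v1: "v j = 1"
  have cA: "A \<in> carrier_mat (length a) (length b)" and cB: "B \<in> carrier_mat (length b) (length c)"
    using graded_hom_carrier A B by blast+
  have "A *\<^sub>v vec (length b) v = 0\<^sub>v (length a)"
    unfolding mult_mat_vec_mat_map[OF cA] v by auto
  hence "vec (length b) v \<in> mat_image B" using cA unfolding ex[symmetric] mat_kernel_def by auto
  then obtain w where w: "w \<in> carrier_vec (length c)" "vec (length b) v = B *\<^sub>v w"
    using cB by (auto simp: mat_image_def)
  have "v j = (\<Sum>l<length c. B $$ (j, l) * w $ l)"
    using arg_cong[OF w(2), of "\<lambda>v. vec_index v j"] j cB w(1)
    by (simp add: scalar_prod_def lessThan_atLeast0)
  also have "\<dots> \<in> gen [var 3, var 2, var 1, var 0]"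
  proof (rule hideal_sum)
    show hi: "hideal (gen [var 3, var 2, var 1, var 0])"
      by (rule hideal_gen) (use H_var in \<open>simp, blast\<close>)
    fix l assume l: "l \<in> {..<length c}"
    hence "B $$ (j, l) \<in> elements_mat B" using cB j by (auto simp: elements_mat_def intro!: bexI[of _ j] imageI)
    hence "B $$ (j, l) \<in> gen [var 3, var 2, var 1, var 0]"
      using min irrelevant_sub unfolding minimal_mat_def by blast
    thus "B $$ (j, l) * w $ l \<in> gen [var 3, var 2, var 1, var 0]" by (rule hideal_mult'[OF hi])
  qed
  finally show False using v1 one_notin_vars by simp
qed

text \<open>The syzygies are the first two columns of \<open>A\<close>. A zero column or a
  proportionality would be a relation with coefficient 1, excluded by \<open>minimal_kernel\<close>.
  Since \<open>ds\<close> is sorted, syzygies of degree below \<open>ds ! 0\<close> involve no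
  generator and those of degree below \<open>ds ! 1\<close> at most the first.\<close>

lemma resolution_syzygies:
  assumes gb: "graded_betti d f ds cs bs" and len: "length ds \<ge> 2"
  obtains a1 a2 a3 a4 b1 b2 b3 b4 where
    "syz (partial 0 f) (partial 1 f) (partial 2 f) (partial 3 f) (ds ! 0) a1 a2 a3 a4"
    "(a1, a2, a3, a4) \<noteq> (0, 0, 0, 0)"
    "syz (partial 0 f) (partial 1 f) (partial 2 f) (partial 3 f) (ds ! 1) b1 b2 b3 b4"
    "\<And>h. (b1, b2, b3, b4) \<noteq> (h * a1, h * a2, h * a3, h * a4)"
    "\<And>s c1 c2 c3 c4. syz (partial 0 f) (partial 1 f) (partial 2 f) (partial 3 f) s c1 c2 c3 c4 \<Longrightarrow>
      s < ds ! 0 \<Longrightarrow> (c1, c2, c3, c4) = (0, 0, 0, 0)"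
    "\<And>s c1 c2 c3 c4. syz (partial 0 f) (partial 1 f) (partial 2 f) (partial 3 f) s c1 c2 c3 c4 \<Longrightarrow>
      s < ds ! 1 \<Longrightarrow> \<exists>h. (c1, c2, c3, c4) = (h * a1, h * a2, h * a3, h * a4)"
proof -
  define e where "e = int d - 1"
  let ?sh = "map (\<lambda>a. e + a)"
  let ?syz = "syz (partial 0 f) (partial 1 f) (partial 2 f) (partial 3 f)"
  obtain A B where A: "graded_hom (?sh ds) (replicate 4 e) A"
    and B: "graded_hom (?sh cs) (?sh ds) B" and min: "minimal_mat B"
    and ex: "mat_image A = AR f" "mat_kernel A = mat_image B" and sorted: "sorted ds"
    using gb unfolding graded_betti_def Let_def e_def by blast
  have cA: "A \<in> carrier_mat 4 (length ds)" using graded_hom_carrier[OF A] by simp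
  have ds01: "ds ! 0 \<le> ds ! 1" using sorted len by (intro sorted_nth_mono) auto
  have piece: "mat_map A ` F (?sh ds) k = syz_space (partial 0 f) (partial 1 f) (partial 2 f) (partial 3 f) (k - e)" for k
    using image_piece[OF A, of k] AR_piece[of e k f] by (simp add: ex)
  define u where "u j = (\<lambda>i. if i = j then 1 else 0 :: poly4)" for j :: nat
  have uF: "u j \<in> F (?sh ds) (e + ds ! j)" if "j < length ds" for j
    using that by (auto simp: F_def u_def)
  have mu: "mat_map A (u j) = (\<lambda>i. if i < 4 then A $$ (i, j) else 0)" if "j < length ds" for j
    using that cA by (auto simp: mat_map_def u_def if_distrib sum.delta cong: if_cong)
  have col: "?syz (ds ! j) (A $$ (0, j)) (A $$ (1, j)) (A $$ (2, j)) (A $$ (3, j))" if "j < length ds" for j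
  proof -
    have "mat_map A (u j) \<in> syz_space (partial 0 f) (partial 1 f) (partial 2 f) (partial 3 f) (ds ! j)"
      using piece[of "e + ds ! j"] uF[OF that] by auto
    thus ?thesis unfolding syz_space_def mu[OF that] by simp
  qed
  have comb: "\<exists>w. (\<forall>j<length ds. w j \<in> H (s - ds ! j)) \<and>
      (\<forall>i<4. tuple4 c1 c2 c3 c4 i = (\<Sum>j<length ds. A $$ (i, j) * w j))" if "?syz s c1 c2 c3 c4" for s c1 c2 c3 c4
  proof -
    have "tuple4 c1 c2 c3 c4 \<in> syz_space (partial 0 f) (partial 1 f) (partial 2 f) (partial 3 f) ((e + s) - e)"
      using that by (simp add: syz_space_def tuple4_def)
    then obtain w where w: "w \<in> F (?sh ds) (e + s)" "tuple4 c1 c2 c3 c4 = mat_map A w"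
      unfolding piece[symmetric] by blast
    have "w j \<in> H (s - ds ! j)" if "j < length ds" for j using w(1) that by (simp add: F_def)
    moreover have "tuple4 c1 c2 c3 c4 i = (\<Sum>j<length ds. A $$ (i, j) * w j)" if "i < 4" for i
      using that cA unfolding w(2) by (simp add: mat_map_def)
    ultimately show ?thesis by blast
  qed
  show ?thesis
  proof (rule that[OF col[of 0] _ col[of 1]])
    show "(A $$ (0, 0), A $$ (1, 0), A $$ (2, 0), A $$ (3, 0)) \<noteq> (0, 0, 0, 0)"
    proof
      assume *: "(A $$ (0, 0), A $$ (1, 0), A $$ (2, 0), A $$ (3, 0)) = (0, 0, 0, 0)"
      have "\<forall>i<4. A $$ (i, 0) = 0" using * unfolding less_4_iff by simp
      hence "mat_map A (u 0) = 0" using len by (subst mu) (auto simp: fun_eq_iff)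
      thus False using minimal_kernel[OF A B ex(2) min, of "u 0" 0] len by (cases ds) (auto simp: u_def)
    qed
  next
    fix h
    show "(A $$ (0, 1), A $$ (1, 1), A $$ (2, 1), A $$ (3, 1)) \<noteq>
      (h * A $$ (0, 0), h * A $$ (1, 0), h * A $$ (2, 0), h * A $$ (3, 0))"
    proof
      assume *: "(A $$ (0, 1), A $$ (1, 1), A $$ (2, 1), A $$ (3, 1)) =
        (h * A $$ (0, 0), h * A $$ (1, 0), h * A $$ (2, 0), h * A $$ (3, 0))"
      have A1: "\<forall>i<4. A $$ (i, 1) = h * A $$ (i, 0)" using * unfolding less_4_iff by simp
      let ?v = "\<lambda>i. if i = 1 then 1 else if i = 0 then - h else (0 :: poly4)"
      have "mat_map A ?v i = 0" for i
      proof (cases "i < 4")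
        case True
        have "(\<Sum>j<length ds. A $$ (i, j) * ?v j) = (\<Sum>j\<in>{0, 1}. A $$ (i, j) * ?v j)"
          using len by (intro sum.mono_neutral_right) auto
        thus ?thesis using True A1 cA by (simp add: mat_map_def)
      qed (use cA in \<open>simp add: mat_map_def\<close>)
      hence "mat_map A ?v = 0" by (simp add: fun_eq_iff)
      thus False using minimal_kernel[OF A B ex(2) min, of ?v 1] len by simp
    qed
  next
    fix s c1 c2 c3 c4 assume c: "?syz s c1 c2 c3 c4" "s < ds ! 0"
    then obtain w where w: "\<And>j. j < length ds \<Longrightarrow> w j \<in> H (s - ds ! j)"
      "\<forall>i<4. tuple4 c1 c2 c3 c4 i = (\<Sum>j<length ds. A $$ (i, j) * w j)" using comb by blast
    have "w j = 0" if "j < length ds" for j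
      using w(1)[OF that] H_neg[of "s - ds ! j"] sorted_nth_mono[OF sorted, of 0 j] that c(2) by auto
    hence "\<forall>i<4. tuple4 c1 c2 c3 c4 i = 0" using w(2) by simp
    thus "(c1, c2, c3, c4) = (0, 0, 0, 0)" unfolding less_4_iff by (simp add: tuple4_def)
  next
    fix s c1 c2 c3 c4 assume c: "?syz s c1 c2 c3 c4" "s < ds ! 1"
    then obtain w where w: "\<And>j. j < length ds \<Longrightarrow> w j \<in> H (s - ds ! j)"
      "\<forall>i<4. tuple4 c1 c2 c3 c4 i = (\<Sum>j<length ds. A $$ (i, j) * w j)" using comb by blast
    have "w j = 0" if "j < length ds" "j \<noteq> 0" for j
      using w(1)[OF that(1)] H_neg[of "s - ds ! j"] sorted_nth_mono[OF sorted, of 1 j] that c(2) by auto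
    hence "(\<Sum>j<length ds. A $$ (i, j) * w j) = (\<Sum>j\<in>{0}. A $$ (i, j) * w j)" for i
      using len by (intro sum.mono_neutral_right) auto
    hence "\<forall>i<4. tuple4 c1 c2 c3 c4 i = A $$ (i, 0) * w 0" using w(2) by simp
    thus "\<exists>h. (c1, c2, c3, c4) = (h * A $$ (0, 0), h * A $$ (1, 0), h * A $$ (2, 0), h * A $$ (3, 0))"
      unfolding less_4_iff by (intro exI[of _ "w 0"]) (simp add: tuple4_def mult.commute)
  qed (use len in auto)
qed

subsection \<open>The lower bound for the total Tjurina number\<close>

lemma regular_combination:
  assumes I: "hideal I" and p: "p1 \<in> H n" "p2 \<in> H n" "p3 \<in> H n" "p4 \<in> H n" and socfree: "socfree I {p1, p2, p3, p4}"
    and J: "hideal J" "{p1, p2, p3, p4} \<subseteq> J"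
  obtains h where "h \<in> H n" "h \<in> J" "socfree I {h}"
proof -
  obtain s2 s3 s4 where s: "socfree I {p1 + const s2 * p2 + const s3 * p3 + const s4 * p4}"
    using socfree_combination[OF I p(2-4) socfree] by blast
  show ?thesis
  proof (rule that[OF _ _ s])
    show "p1 + const s2 * p2 + const s3 * p3 + const s4 * p4 \<in> H n" using p by (simp add: H_add H_const_mult)
    show "p1 + const s2 * p2 + const s3 * p3 + const s4 * p4 \<in> J"
      using J by (simp add: hideal_add hideal_mult)
  qed
qed

lemma lower_bound:
  assumes p: "p1 \<in> H e" "p2 \<in> H e" "p3 \<in> H e" "p4 \<in> H e" and e: "e \<ge> 0"
    and J: "bdd_codim (gen [p4, p3, p2, p1])" and a: "syz p1 p2 p3 p4 r a1 a2 a3 a4" "(a1, a2, a3, a4) \<noteq> (0, 0, 0, 0)"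
    and \<tau>: "\<And>k. k \<ge> k0 \<Longrightarrow> codim (gen [p4, p3, p2, p1]) k = \<tau>"
  shows "e ^ 2 * (e - r) \<le> \<tau>"
proof (cases "r \<ge> e")
  case True
  hence "e ^ 2 * (e - r) \<le> 0" by (intro mult_nonneg_nonpos) auto
  moreover have "0 \<le> \<tau>" using \<tau>[of k0] codim_nonneg[of "gen [p4, p3, p2, p1]" k0] by simp
  ultimately show ?thesis by linarith
next
  case False
  let ?J = "gen [p4, p3, p2, p1]"
  have hl: "hlist [p4, p3, p2, p1]" using p by auto
  have hJ: "hideal ?J" by (rule hideal_gen[OF hl])
  have "socfree {0} {p1, p2, p3, p4}"
    using socfree_gens[OF hideal_zero socfree_unmixed0[OF hJ J]] by (simp add: insert_commute)
  then obtain s2 s3 s4 where s: "socfree {0} {p1 + const s2 * p2 + const s3 * p3 + const s4 * p4}"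
    using socfree_combination[OF hideal_zero p(2-4)] by blast
  define g1 where "g1 = p1 + const s2 * p2 + const s3 * p3 + const s4 * p4"
  have g1: "g1 \<in> H e" "g1 \<noteq> 0" using s socfree_zero_neq p by (auto simp: g1_def intro!: H_add H_const_mult)
  have J1: "socfree I ?J \<Longrightarrow> hideal I \<Longrightarrow> socfree I {g1, p2, p3, p4}" for I
  proof -
    assume I: "socfree I ?J" "hideal I"
    have "p1 = g1 - const s2 * p2 - const s3 * p3 - const s4 * p4" by (simp add: g1_def)
    moreover have hl1: "hlist [p4, p3, p2, g1]" using p g1 by auto
    ultimately have "p1 \<in> gen [p4, p3, p2, g1]"
      using hideal_gen[OF hl1] gen_gens[OF hl1] by (metis hideal_diff hideal_mult insert_subset list.simps(15))
    hence "?J \<subseteq> gen [p4, p3, p2, g1]"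
      using gen_gens[OF hl1] by (intro gen_mono[OF hl1]) (simp del: gen.simps)
    hence "socfree I (gen [p4, p3, p2, g1])" by (rule socfree_mono[OF I(1)])
    thus ?thesis using socfree_gens[OF I(2)] by (fastforce simp: insert_commute simp del: gen.simps)
  qed
  have hG1: "hideal (gen [g1])" using g1 by auto
  have g1_in: "g1 \<in> gen [g1]" by (simp add: addgen_gen)
  have "socfree (gen [g1]) {p2, p3, p4}"
    by (rule socfree_drop[OF hG1 J1[OF socfree_unmixed1[OF g1 hJ J] hG1] g1_in])
  hence "socfree (gen [g1]) {p2, p3, p4, 0}" by (rule socfree_mono) auto
  then obtain t3 t4 t0 where t: "socfree (gen [g1]) {p2 + const t3 * p3 + const t4 * p4 + const t0 * 0}"
    using socfree_combination[OF hG1 p(3,4) H_0] by blast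
  define g2 where "g2 = p2 + const t3 * p3 + const t4 * p4"
  have g2: "g2 \<in> H e" "socfree (gen [g1]) {g2}" using t p by (auto simp: g2_def intro!: H_add H_const_mult)
  have hG2: "hideal (gen [g2, g1])" using g1 g2 by auto
  have g2_in: "g2 \<in> gen [g2, g1]" "g1 \<in> gen [g2, g1]"
    using addgen_gen[OF hG1, of g2] addgen_sub[of "gen [g1]" g2] g1_in by auto
  have s2: "socfree (gen [g2, g1]) {p2, p3, p4}"
    by (rule socfree_drop[OF hG2 J1[OF socfree_unmixed2[OF g1 g2 hJ J] hG2] g2_in(2)])
  have "socfree (gen [g2, g1]) {p3, p4}"
  proof (rule socfreeI)
    fix k u assume u: "u \<in> H k" "\<And>x. x \<in> {p3, p4} \<Longrightarrow> x * u \<in> gen [g2, g1]"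
    have "p2 * u = g2 * u - const t3 * (p3 * u) - const t4 * (p4 * u)" by (simp add: g2_def algebra_simps)
    moreover have "g2 * u - const t3 * (p3 * u) - const t4 * (p4 * u) \<in> gen [g2, g1]"
      using u hideal_mult'[OF hG2 g2_in(1)] hG2 by (simp add: hideal_diff hideal_mult del: gen.simps)
    ultimately have "p2 * u \<in> gen [g2, g1]" by simp
    thus "u \<in> gen [g2, g1]" using u(2) by (intro socfreeD[OF s2 u(1)]) blast
  qed
  then obtain w where w: "socfree (gen [g2, g1]) {p3 + const w * p4}"
    using socfree_pencil_ex[OF hG2 p(4), of p3 "{}"] by auto
  define g3 where "g3 = p3 + const w * p4"
  have g3: "g3 \<in> H e" "socfree (gen [g2, g1]) {g3}" using w p by (auto simp: g3_def intro!: H_add H_const_mult)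
  note reg = g1 g2 g3
  let ?J' = "gen [g3, g2, g1]"
  have hJ': "hideal ?J'" using reg by auto
  have cJ': "codim ?J' k = e * e * e" if "k \<ge> e + e + e - 3" for k
    by (rule codim_ci3[OF reg e e e that])
  have bJ': "bdd_codim ?J'" by (rule bdd_codim_ci3[OF reg e e e])
  have gJ': "g3 \<in> ?J'" "g2 \<in> ?J'" "g1 \<in> ?J'"
    using addgen_gen[OF hG2, of g3] addgen_sub[of "gen [g2, g1]" g3] g2_in by auto
  \<comment> \<open>The coefficients of the given syzygy with respect to
    \<open>g1, g2, g3, p4\<close>; the first one remains \<open>a1\<close>.\<close>
  define c2 c3 where "c2 = a2 - const s2 * a1" and "c3 = a3 - const s3 * a1 - const t3 * c2"
  define c4 where "c4 = a4 - const s4 * a1 - const t4 * c2 - const w * c3"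
  have aH: "a1 \<in> H r" "a2 \<in> H r" "a3 \<in> H r" "a4 \<in> H r" and a0: "a1 * p1 + a2 * p2 + a3 * p3 + a4 * p4 = 0"
    using a(1) by (auto simp: syz_def)
  have cH: "c2 \<in> H r" "c3 \<in> H r" "c4 \<in> H r"
    using aH by (auto simp: c2_def c3_def c4_def intro!: H_diff H_const_mult)
  have rel: "a1 * g1 + c2 * g2 + c3 * g3 + c4 * p4 = 0"
    using a0 unfolding c4_def c3_def c2_def g1_def g2_def g3_def by (simp add: algebra_simps)
  have low: "c = 0" if "c \<in> H r" "c \<in> gen [g1]" for c
    using addgen_homE[OF hideal_zero g1(1), of c r] that False H_neg[of "r - e"] by auto
  \<comment> \<open>With \<open>c4 = 0\<close> this would be a relation of a regular sequence of
    forms of degree \<open>e\<close>, whose coefficients cannot have degree \<open>r < e\<close>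
    unless they vanish.\<close>
  have c4: "c4 \<noteq> 0"
  proof
    assume c4: "c4 = 0"
    have "c3 * g3 = - a1 * g1 - c2 * g2" using rel c4 by (simp add: algebra_simps eq_neg_iff_add_eq_0)
    also have "\<dots> \<in> gen [g2, g1]" using g2_in hG2 by (simp add: hideal_diff hideal_mult hideal_uminus del: gen.simps)
    finally have "c3 \<in> gen [g2, g1]" using socfree1D[OF g3(2) cH(2)] by (simp add: mult.commute)
    hence "c3 \<in> addgen (gen [g1]) g2" by simp
    hence "c3 \<in> gen [g1]" using addgen_homE[OF hG1 g2(1) _ cH(2)] False H_neg[of "r - e"]
      by (metis diff_less_0_iff_less diff_zero mult_zero_left not_le singletonD)
    hence c3: "c3 = 0" using low cH by blast
    have "c2 * g2 = - a1 * g1" using rel c4 c3 by (simp add: algebra_simps eq_neg_iff_add_eq_0)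
    also have "\<dots> \<in> gen [g1]" using g1_in hG1 by (simp add: hideal_mult hideal_uminus del: gen.simps)
    finally have "c2 \<in> gen [g1]" using socfree1D[OF g2(2) cH(1)] by (simp add: mult.commute)
    hence c2: "c2 = 0" using low cH by blast
    hence "a1 = 0" using rel c4 c3 g1 by simp
    thus False using a(2) c2 c3 c4 unfolding c4_def c3_def c2_def by simp
  qed
  have r: "r \<ge> 0" using H_nonneg[OF cH(3) c4] .
  have sJ': "socfree I {g3, g2, g1, 0}" if "hideal I" "socfree I ?J'" for I
    using socfree_mono[OF socfree_gens[OF that], of "{g3, g2, g1, 0}"] by auto
  have sub4: "{g3, g2, g1, 0} \<subseteq> ?J'" using gJ' hJ' by (simp del: gen.simps)
  have hh: "hideal (gen [c4])" using cH by auto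
  \<comment> \<open>General elements of degree \<open>e\<close> in \<open>?J'\<close> complete
    \<open>c4\<close> to the complete intersection of degrees \<open>r, e, e\<close> inside
    \<open>?K\<close>; 0 again pads the list of generators.\<close>
  obtain h1 where h1: "h1 \<in> H e" "h1 \<in> ?J'" "socfree (gen [c4]) {h1}"
    using regular_combination[OF hh g3(1) g2(1) g1(1) H_0 sJ'[OF hh socfree_unmixed1[OF cH(3) c4 hJ' bJ']] hJ' sub4]
    by blast
  have hh1: "hideal (gen [h1, c4])" using cH h1 by auto
  obtain h2 where h2: "h2 \<in> H e" "h2 \<in> ?J'" "socfree (gen [h1, c4]) {h2}"
    using regular_combination[OF hh1 g3(1) g2(1) g1(1) H_0
        sJ'[OF hh1 socfree_unmixed2[OF cH(3) c4 h1(1,3) hJ' bJ']] hJ' sub4] by blast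
  let ?K = "colon ?J' p4"
  have hK: "hideal ?K" by (rule hideal_colon[OF hJ' p(4)])
  have "c4 * p4 = - (a1 * g1 + c2 * g2 + c3 * g3)" using rel
    by (subst eq_neg_iff_add_eq_0) (simp add: add_ac)
  also have "\<dots> \<in> ?J'" using gJ' hJ' by (intro hideal_uminus[OF hJ']) (simp add: hideal_add hideal_mult del: gen.simps)
  finally have "c4 \<in> ?K" by (simp add: colon_def)
  moreover have "h1 \<in> ?K" "h2 \<in> ?K" using h1 h2 colon_sub[OF hJ'] by blast+
  ultimately have sub: "gen [h2, h1, c4] \<subseteq> ?K" by (intro gen_minimal[OF hK]) auto
  hence K: "codim ?K k \<le> r * e * e" if "k \<ge> r + e + e - 3" for k
    using codim_mono[OF sub, of k] codim_ci3[OF cH(3) c4 h1(1,3) h2(1,3) r e e that] by linarith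
  have eqJ: "gen [p4, g3, g2, g1] \<subseteq> ?J"
  proof (rule gen_mono[OF hl])
    have "set [p4, p3, p2, p1] \<subseteq> ?J" by (rule gen_gens[OF hl])
    thus "set [p4, g3, g2, g1] \<subseteq> ?J"
      using hJ by (simp add: g1_def g2_def g3_def hideal_add hideal_mult del: gen.simps)
  qed
  define k where "k = max k0 (max (e + e + e - 3) (r + e + e - 3 + e))"
  have "\<tau> = codim ?J k" using \<tau>[of k] by (simp add: k_def)
  moreover have "codim ?J k \<ge> e * e * e - r * e * e"
  proof -
    have p3e: "p3 = g3 - const w * p4" by (simp add: g3_def)
    have p2e: "p2 = g2 - const t3 * p3 - const t4 * p4" by (simp add: g2_def)
    have p1e: "p1 = g1 - const s2 * p2 - const s3 * p3 - const s4 * p4" by (simp add: g1_def)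
    have hl2: "hlist [p4, g3, g2, g1]" using p reg by auto
    note h2 = hideal_gen[OF hl2]
    have in2: "p4 \<in> gen [p4, g3, g2, g1]" "g3 \<in> gen [p4, g3, g2, g1]" "g2 \<in> gen [p4, g3, g2, g1]"
      "g1 \<in> gen [p4, g3, g2, g1]" using gen_gens[OF hl2] by (simp_all del: gen.simps)
    have "p3 \<in> gen [p4, g3, g2, g1]" unfolding p3e by (intro hideal_diff[OF h2] hideal_mult[OF h2] in2)
    moreover from this have "p2 \<in> gen [p4, g3, g2, g1]" unfolding p2e by (intro hideal_diff[OF h2] hideal_mult[OF h2] in2)
    moreover from calculation have "p1 \<in> gen [p4, g3, g2, g1]" unfolding p1e by (intro hideal_diff[OF h2] hideal_mult[OF h2] in2)
    ultimately have "?J \<subseteq> gen [p4, g3, g2, g1]" using in2 by (intro gen_mono[OF hl2]) (simp del: gen.simps)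
    hence "codim ?J k = codim (addgen ?J' p4) k" using eqJ by (simp add: subset_antisym)
    also have "\<dots> = codim ?J' k - codim ?K (k - e)" by (rule codim_addgen[OF hJ' p(4)])
    also have "codim ?J' k = e * e * e" by (rule cJ') (simp add: k_def)
    finally show ?thesis using K[of "k - e"] by (simp add: k_def)
  qed
  ultimately show ?thesis by (simp add: power2_eq_square algebra_simps)
qed

subsection \<open>The upper bound in good coordinates\<close>

text \<open>Vanishing of the cross product makes two vectors proportional, by Cramer's rule: for a
  general combination \<open>q\<close> of the \<open>q_i\<close> and the same combination
  \<open>c\<close> of the \<open>b_i\<close>, \<open>q_i * c = b_i * q\<close> modulo
  \<open>g\<close>. Unmixedness of \<open>(q, g)\<close> gives \<open>c = w * q\<close> modulo
  \<open>g\<close>, and \<open>q\<close> cancels.\<close>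

lemma proportional_mod:
  assumes g: "g \<in> H e" "g \<noteq> 0" and q: "q2 \<in> H n" "q3 \<in> H n" "q4 \<in> H n" and bdd_codim: "bdd_codim (gen [q4, q3, q2, g])"
    and b: "b2 \<in> H m" "b3 \<in> H m" "b4 \<in> H m"
    and prp: "q2 * b3 - q3 * b2 \<in> gen [g]" "q4 * b2 - q2 * b4 \<in> gen [g]" "q3 * b4 - q4 * b3 \<in> gen [g]"
  obtains w where "w \<in> H (m - n)" "b2 - w * q2 \<in> gen [g]" "b3 - w * q3 \<in> gen [g]" "b4 - w * q4 \<in> gen [g]"
proof -
  let ?G = "gen [g]"
  have hG: "hideal ?G" using g by auto
  have hl: "hlist [q4, q3, q2, g]" using g q by auto
  note hN = hideal_gen[OF hl]
  have drop: "socfree I {q2, q3, q4, 0}" if I: "hideal I" "socfree I (gen [q4, q3, q2, g])" "g \<in> I" for I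
  proof -
    have "socfree I (insert g {q2, q3, q4})" using socfree_gens[OF I(1,2)] by (simp add: insert_commute)
    hence "socfree I {q2, q3, q4}" using socfree_drop I by blast
    thus ?thesis by (rule socfree_mono) auto
  qed
  have gG: "g \<in> ?G" by (simp add: addgen_gen)
  obtain s3 s4 s0 where s: "socfree ?G {q2 + const s3 * q3 + const s4 * q4 + const s0 * 0}"
    using socfree_combination[OF hG q(2,3) H_0 drop[OF hG socfree_unmixed1[OF g hN bdd_codim] gG]] by blast
  define q where "q = q2 + const s3 * q3 + const s4 * q4"
  define c where "c = b2 + const s3 * b3 + const s4 * b4"
  have qc: "q \<in> H n" "c \<in> H m" using q b by (auto simp: q_def c_def intro!: H_add H_const_mult)
  have sq: "socfree ?G {q}" using s by (simp add: q_def)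
  have hG2: "hideal (gen [q, g])" using g qc by auto
  have gG2: "g \<in> gen [q, g]" using addgen_sub[of ?G q] gG by auto
  have e2: "q2 * c - b2 * q \<in> ?G"
  proof -
    have "q2 * c - b2 * q = const s3 * (q2 * b3 - q3 * b2) - const s4 * (q4 * b2 - q2 * b4)"
      by (simp add: q_def c_def algebra_simps)
    thus ?thesis using prp hG by (simp add: hideal_diff hideal_mult del: gen.simps)
  qed
  have e3: "q3 * c - b3 * q \<in> ?G"
  proof -
    have "q3 * c - b3 * q = const s4 * (q3 * b4 - q4 * b3) - (q2 * b3 - q3 * b2)"
      by (simp add: q_def c_def algebra_simps)
    thus ?thesis using prp hG by (simp add: hideal_diff hideal_mult del: gen.simps)
  qed
  have e4: "q4 * c - b4 * q \<in> ?G"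
  proof -
    have "q4 * c - b4 * q = (q4 * b2 - q2 * b4) - const s3 * (q3 * b4 - q4 * b3)"
      by (simp add: q_def c_def algebra_simps)
    thus ?thesis using prp hG by (simp add: hideal_diff hideal_mult del: gen.simps)
  qed
  have "c \<in> gen [q, g]"
  proof (rule socfreeD[OF drop[OF hG2 socfree_unmixed2[OF g qc(1) sq hN bdd_codim] gG2] qc(2)])
    fix x assume "x \<in> {q2, q3, q4, 0}"
    thus "x * c \<in> gen [q, g]" using e2 e3 e4 hideal_0[OF hG2] by (auto intro: addgenI simp del: gen.simps(2) simp: gen.simps(2)[of q])
  qed
  hence "c \<in> addgen ?G q" by simp
  then obtain w where w: "w \<in> H (m - n)" "c - w * q \<in> ?G" using addgen_homE[OF hG qc(1) _ qc(2)] by blast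
  have fin: "b - w * x \<in> ?G" if "x * c - b * q \<in> ?G" "b \<in> H m" "x \<in> H n" for x b
  proof -
    have "q * (b - w * x) = x * (c - w * q) - (x * c - b * q)" by (simp add: algebra_simps)
    hence "q * (b - w * x) \<in> ?G" using hideal_diff[OF hG hideal_mult[OF hG w(2)] that(1)] by metis
    moreover have "b - w * x \<in> H m" using H_mult[OF w(1) that(3)] by (intro H_diff that) simp
    ultimately show ?thesis using socfree1D[OF sq] by blast
  qed
  show ?thesis using that[OF w(1) fin[OF e2 b(1) q(1)] fin[OF e3 b(2) q(2)] fin[OF e4 b(3) q(3)]] .
qed


text \<open>The two boundedness assumptions say that on the surface \<open>g1 = 0\<close> neither
  \<open>(g2, g3, g4)\<close> nor \<open>(a2, a3, a4)\<close> vanishes along a curve. This is what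
  \<open>proportional_mod\<close> requires of the vector by which one divides.\<close>

locale good_coordinates =
  fixes g1 g2 g3 g4 a1 a2 a3 a4 :: poly4 and e r :: int
  assumes gH: "g1 \<in> H e" "g2 \<in> H e" "g3 \<in> H e" "g4 \<in> H e" and g1: "g1 \<noteq> 0"
    and e: "e \<ge> 1" and r: "r \<ge> 0"
    and syz_a: "syz g1 g2 g3 g4 r a1 a2 a3 a4"
    and bdd_codim_J: "bdd_codim (gen [g4, g3, g2, g1])" and bdd_codim_N: "bdd_codim (gen [a4, a3, a2, g1])"
begin

abbreviation "G \<equiv> gen [g1]"

lemma aH: "a1 \<in> H r" "a2 \<in> H r" "a3 \<in> H r" "a4 \<in> H r"
  and rel_a: "a1 * g1 + a2 * g2 + a3 * g3 + a4 * g4 = 0"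
  using syz_a by (auto simp: syz_def)

lemma hG: "hideal G"
  using gH by auto

lemma g1_G: "g1 * x \<in> G" "x * g1 \<in> G"
  using addgen_gen_mult[OF hideal_zero, of x g1] by (simp_all add: mult.commute)

lemma G_homE: "x \<in> G \<Longrightarrow> x \<in> H k \<Longrightarrow> \<exists>u. u \<in> H (k - e) \<and> x = u * g1"
proof -
  assume x: "x \<in> G" "x \<in> H k"
  hence "x \<in> addgen {0} g1" by simp
  then obtain a where "a \<in> H (k - e)" "x - a * g1 \<in> {0}" by (rule addgen_homE[OF hideal_zero gH(1) _ x(2)])
  thus ?thesis by auto
qed

lemma socfree_G: "socfree G {g2, g3, g4}" "socfree G {a2, a3, a4}"
proof -
  have gG: "g1 \<in> G" using g1_G(1)[of 1] by simp
  have hl: "hlist [g4, g3, g2, g1]" "hlist [a4, a3, a2, g1]" using gH aH by auto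
  have "socfree G (insert g1 {g2, g3, g4})"
    using socfree_gens[OF hG socfree_unmixed1[OF gH(1) g1 hideal_gen[OF hl(1)] bdd_codim_J]] by (simp add: insert_commute)
  thus "socfree G {g2, g3, g4}" using socfree_drop[OF hG _ gG] by blast
  have "socfree G (insert g1 {a2, a3, a4})"
    using socfree_gens[OF hG socfree_unmixed1[OF gH(1) g1 hideal_gen[OF hl(2)] bdd_codim_N]] by (simp add: insert_commute)
  thus "socfree G {a2, a3, a4}" using socfree_drop[OF hG _ gG] by blast
qed

text \<open>\<open>cross b l\<close>: modulo \<open>g1\<close>, the cross product of the last three entries of the syzygies \<open>a\<close> and \<open>b\<close> is
  \<open>l\<close> times \<open>(g2, g3, g4)\<close>.\<close>

definition cross :: "poly4 \<Rightarrow> poly4 \<Rightarrow> poly4 \<Rightarrow> poly4 \<Rightarrow> bool" where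
  "cross b2 b3 b4 l \<longleftrightarrow> a3 * b4 - a4 * b3 - l * g2 \<in> G \<and> a4 * b2 - a2 * b4 - l * g3 \<in> G \<and>
     a2 * b3 - a3 * b2 - l * g4 \<in> G"

text \<open>For vectors with three entries, \<open>g \<times> (a \<times> b) = a (g \<cdot> b) - b
  (g \<cdot> a)\<close>, and both scalar products vanish modulo \<open>g1\<close>. So
  \<open>a \<times> b\<close> is parallel to \<open>(g2, g3, g4)\<close>.\<close>

lemma cross_exists:
  assumes b: "syz g1 g2 g3 g4 s b1 b2 b3 b4"
  obtains l where "l \<in> H (s + r - e)" "cross b2 b3 b4 l"
proof -
  have bH: "b1 \<in> H s" "b2 \<in> H s" "b3 \<in> H s" "b4 \<in> H s" and rel_b: "b1 * g1 + b2 * g2 + b3 * g3 + b4 * g4 = 0"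
    using b by (auto simp: syz_def)
  define x2 x3 x4 where "x2 = a3 * b4 - a4 * b3" and "x3 = a4 * b2 - a2 * b4" and "x4 = a2 * b3 - a3 * b2"
  have xH: "x2 \<in> H (r + s)" "x3 \<in> H (r + s)" "x4 \<in> H (r + s)"
    using aH bH by (auto simp: x2_def x3_def x4_def intro!: H_diff H_mult)
  have ra: "a2 * g2 + a3 * g3 + a4 * g4 = - a1 * g1" using rel_a by (simp add: eq_neg_iff_add_eq_0 algebra_simps)
  have rb: "b2 * g2 + b3 * g3 + b4 * g4 = - b1 * g1" using rel_b by (simp add: eq_neg_iff_add_eq_0 algebra_simps)
  have "g2 * x3 - g3 * x2 = a4 * (- b1 * g1) - b4 * (- a1 * g1)"
    unfolding ra[symmetric] rb[symmetric] x2_def x3_def by (simp add: algebra_simps)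
  also have "\<dots> = (b4 * a1 - a4 * b1) * g1" by (simp add: algebra_simps)
  also have "\<dots> \<in> G" by (rule g1_G)
  finally have p1: "g2 * x3 - g3 * x2 \<in> G" .
  have "g4 * x2 - g2 * x4 = a3 * (- b1 * g1) - b3 * (- a1 * g1)"
    unfolding ra[symmetric] rb[symmetric] x2_def x4_def by (simp add: algebra_simps)
  also have "\<dots> = (b3 * a1 - a3 * b1) * g1" by (simp add: algebra_simps)
  also have "\<dots> \<in> G" by (rule g1_G)
  finally have p2: "g4 * x2 - g2 * x4 \<in> G" .
  have "g3 * x4 - g4 * x3 = a2 * (- b1 * g1) - b2 * (- a1 * g1)"
    unfolding ra[symmetric] rb[symmetric] x3_def x4_def by (simp add: algebra_simps)
  also have "\<dots> = (b2 * a1 - a2 * b1) * g1" by (simp add: algebra_simps)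
  also have "\<dots> \<in> G" by (rule g1_G)
  finally have p3: "g3 * x4 - g4 * x3 \<in> G" .
  obtain w where "w \<in> H (r + s - e)" "x2 - w * g2 \<in> G" "x3 - w * g3 \<in> G" "x4 - w * g4 \<in> G"
    using proportional_mod[OF gH(1) g1 gH(2-4) bdd_codim_J xH p1 p2 p3] by metis
  thus ?thesis using that[of w] by (simp add: cross_def x2_def x3_def x4_def add.commute)
qed

lemma cross_zero_multiple:
  assumes b: "b2 \<in> H s" "b3 \<in> H s" "b4 \<in> H s" and c: "cross b2 b3 b4 0"
  obtains w where "w \<in> H (s - r)" "b2 - w * a2 \<in> G" "b3 - w * a3 \<in> G" "b4 - w * a4 \<in> G"
  using proportional_mod[OF gH(1) g1 aH(2-4) bdd_codim_N b] c unfolding cross_def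
  by (metis diff_zero mult_zero_left)

lemma syz_of_mod:
  assumes b: "b2 \<in> H s" "b3 \<in> H s" "b4 \<in> H s" "b2 * g2 + b3 * g3 + b4 * g4 \<in> G"
  obtains b1 where "syz g1 g2 g3 g4 s b1 b2 b3 b4"
proof -
  have "b2 * g2 + b3 * g3 + b4 * g4 \<in> H (s + e)" using b gH by (intro H_add H_mult)
  then obtain u where u: "u \<in> H (s + e - e)" "b2 * g2 + b3 * g3 + b4 * g4 = u * g1" using G_homE b(4) by blast
  have "- u * g1 + b2 * g2 + b3 * g3 + b4 * g4 = (b2 * g2 + b3 * g3 + b4 * g4) - u * g1"
    by (simp add: algebra_simps)
  hence "syz g1 g2 g3 g4 s (- u) b2 b3 b4"
    using u b H_uminus[of u s] by (simp add: syz_def)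
  thus ?thesis by (rule that)
qed

text \<open>The multiplier has the negative degree \<open>s + r - e\<close> and vanishes. As
  \<open>s < e\<close>, the resulting congruences modulo \<open>g1\<close> are equalities.\<close>

lemma low_degree_multiple:
  assumes b: "syz g1 g2 g3 g4 s b1 b2 b3 b4" and s: "s < e - r"
  shows "\<exists>h. (b1, b2, b3, b4) = (h * a1, h * a2, h * a3, h * a4)"
proof -
  have bH: "b1 \<in> H s" "b2 \<in> H s" "b3 \<in> H s" "b4 \<in> H s" and rel_b: "b1 * g1 + b2 * g2 + b3 * g3 + b4 * g4 = 0"
    using b by (auto simp: syz_def)
  obtain l where "l \<in> H (s + r - e)" "cross b2 b3 b4 l" using cross_exists[OF b] .
  hence "cross b2 b3 b4 0" using H_neg[of "s + r - e"] s by auto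
  then obtain w where w: "w \<in> H (s - r)" "b2 - w * a2 \<in> G" "b3 - w * a3 \<in> G" "b4 - w * a4 \<in> G"
    using cross_zero_multiple[OF bH(2-4)] by metis
  have z: "x = 0" if "x \<in> G" "x \<in> H s" for x
    using G_homE[OF that] H_neg[of "s - e"] s r by auto
  have "w * a \<in> H s" if "a \<in> H r" for a using H_mult[OF w(1) that] by simp
  hence eq: "b2 = w * a2" "b3 = w * a3" "b4 = w * a4"
    using z[OF w(2)] z[OF w(3)] z[OF w(4)] bH aH H_diff by (metis eq_iff_diff_eq_0)+
  have "(b1 - w * a1) * g1 = (b1 * g1 + b2 * g2 + b3 * g3 + b4 * g4) - w * (a1 * g1 + a2 * g2 + a3 * g3 + a4 * g4)"
    unfolding eq by (simp add: algebra_simps)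
  hence "b1 = w * a1" unfolding rel_a rel_b using g1 by simp
  thus ?thesis using eq by blast
qed

text \<open>The shift: a cross product of syzygies of degrees \<open>r\<close> and \<open>s\<close>
  has degree \<open>r + s\<close>, so its multiplier has degree
  \<open>j = s + r - e\<close>.\<close>

definition A :: "int \<Rightarrow> poly4 set" where
  "A j = {l \<in> H j. \<exists>b1 b2 b3 b4. syz g1 g2 g3 g4 (j + e - r) b1 b2 b3 b4 \<and> cross b2 b3 b4 l}"

text \<open>Descent: if \<open>y\<^sub>i v\<close> comes from a syzygy \<open>b\<^sub>i\<close> for three linear forms \<open>y\<^sub>i\<close>, then \<open>y\<^sub>2 b\<^sub>1 - y\<^sub>1 b\<^sub>2\<close> is a multiple
  \<open>w a\<close> modulo \<open>g1\<close>.  As \<open>g1\<close> and the \<open>y\<^sub>i\<close> are regular, \<open>w\<close> lies in \<open>(g1, y\<^sub>1, y\<^sub>2)\<close>, so that the \<open>b\<^sub>i\<close> can be corrected by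
  multiples of \<open>a\<close> to become \<open>y\<^sub>i\<close> times one syzygy.\<close>

lemma A_descent:
  assumes full: "H (j + 1) \<subseteq> A (j + 1)"
  shows "H j \<subseteq> A j"
proof
  fix v assume v: "v \<in> H j"
  define s where "s = j + e - r"
  obtain y1 y2 y3 y4 where y: "coords y1 y2 y3 y4" and sy: "socfree G {y1}" "socfree (gen [y1, g1]) {y2}"
    "socfree (gen [y2, y1, g1]) {y3, y4}" using exists_linear_regular2[OF gH(1) g1] .
  have yH: "y1 \<in> H 1" "y2 \<in> H 1" "y3 \<in> H 1" "y4 \<in> H 1" using coords_H[OF y] by auto
  have ex: "\<exists>b1 b2 b3 b4. syz g1 g2 g3 g4 (s + 1) b1 b2 b3 b4 \<and> cross b2 b3 b4 (y * v)" if "y \<in> H 1" for y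
  proof -
    have "y * v \<in> A (j + 1)" using H_mult[OF that v] full by (auto simp: add.commute)
    thus ?thesis by (simp add: A_def s_def algebra_simps)
  qed
  obtain b1 b2 b3 b4 where b: "syz g1 g2 g3 g4 (s + 1) b1 b2 b3 b4" "cross b2 b3 b4 (y1 * v)" using ex[OF yH(1)] by blast
  obtain c1 c2 c3 c4 where c: "syz g1 g2 g3 g4 (s + 1) c1 c2 c3 c4" "cross c2 c3 c4 (y2 * v)" using ex[OF yH(2)] by blast
  have bH: "b2 \<in> H (s + 1)" "b3 \<in> H (s + 1)" "b4 \<in> H (s + 1)" and cH: "c2 \<in> H (s + 1)" "c3 \<in> H (s + 1)" "c4 \<in> H (s + 1)"
    using b c by (auto simp: syz_def)
  have diff: "\<exists>w\<in>H (s + 2 - r). y * p2 - z * q2 - w * a2 \<in> G \<and> y * p3 - z * q3 - w * a3 \<in> G \<and> y * p4 - z * q4 - w * a4 \<in> G"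
    if yz: "y \<in> H 1" "z \<in> H 1" and p: "syz g1 g2 g3 g4 (s + 1) p1 p2 p3 p4" "cross p2 p3 p4 (z * v)"
      and q: "syz g1 g2 g3 g4 (s + 1) q1 q2 q3 q4" "cross q2 q3 q4 (y * v)" for y z p1 p2 p3 p4 q1 q2 q3 q4
  proof -
    have dH: "y * p2 - z * q2 \<in> H (s + 2)" "y * p3 - z * q3 \<in> H (s + 2)" "y * p4 - z * q4 \<in> H (s + 2)"
      using p(1) q(1) yz by (auto simp: syz_def intro!: H_diff H_mult'[where k = 1 and l = "s + 1"])
    have comb: "(a * (y * p - z * q) - a' * (y * p' - z * q')) - 0 * g \<in> G"
      if "a * p - a' * p' - z * v * g \<in> G" "a * q - a' * q' - y * v * g \<in> G" for a a' p p' q q' g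
    proof -
      have "(a * (y * p - z * q) - a' * (y * p' - z * q')) - 0 * g =
        y * (a * p - a' * p' - z * v * g) - z * (a * q - a' * q' - y * v * g)" by (simp add: algebra_simps)
      thus ?thesis using hideal_diff[OF hG hideal_mult[OF hG that(1)] hideal_mult[OF hG that(2)]] by metis
    qed
    have "cross (y * p2 - z * q2) (y * p3 - z * q3) (y * p4 - z * q4) 0"
      unfolding cross_def using p(2) q(2) unfolding cross_def by (intro conjI comb) blast+
    thus ?thesis using cross_zero_multiple[OF dH] by metis
  qed
  obtain w where w: "w \<in> H (s + 2 - r)" "y2 * b2 - y1 * c2 - w * a2 \<in> G" "y2 * b3 - y1 * c3 - w * a3 \<in> G"
    "y2 * b4 - y1 * c4 - w * a4 \<in> G" using diff[OF yH(2,1) b c] by blast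
  let ?Y = "gen [y2, y1, g1]"
  have hY: "hideal ?Y" "hideal (gen [y1, g1])" using yH gH by auto
  have GY: "G \<subseteq> ?Y" "y1 * x \<in> ?Y" "y2 * x \<in> ?Y" for x
    using addgen_sub[of G y1] addgen_sub[of "gen [y1, g1]" y2] addgen_gen_mult[OF hG, of x y1]
      addgen_gen_mult[OF hY(2), of x y2] by (auto simp: mult.commute)
  \<comment> \<open>A cocycle condition: the three differences formed from \<open>y1\<close>,
    \<open>y2\<close> and \<open>z\<close> cancel, so \<open>z * w = y2 * w1 - y1 * w2\<close>
    modulo \<open>g1\<close>, which lies in \<open>?Y\<close>.\<close>
  have wY: "z * w \<in> ?Y" if zH: "z \<in> H 1" for z
  proof -
    obtain d1 d2 d3 d4 where d: "syz g1 g2 g3 g4 (s + 1) d1 d2 d3 d4" "cross d2 d3 d4 (z * v)" using ex[OF zH] by blast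
    obtain w1 where w1: "w1 \<in> H (s + 2 - r)" "z * b2 - y1 * d2 - w1 * a2 \<in> G" "z * b3 - y1 * d3 - w1 * a3 \<in> G"
      "z * b4 - y1 * d4 - w1 * a4 \<in> G" using diff[OF zH yH(1) b d] by blast
    obtain w2 where w2: "w2 \<in> H (s + 2 - r)" "z * c2 - y2 * d2 - w2 * a2 \<in> G" "z * c3 - y2 * d3 - w2 * a3 \<in> G"
      "z * c4 - y2 * d4 - w2 * a4 \<in> G" using diff[OF zH yH(2) c d] by blast
    have cyc: "a * (z * w - y2 * w1 + y1 * w2) \<in> G"
      if "y2 * b - y1 * c - w * a \<in> G" "z * b - y1 * d - w1 * a \<in> G" "z * c - y2 * d - w2 * a \<in> G" for a b c d
    proof -
      have "a * (z * w - y2 * w1 + y1 * w2) =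
        y2 * (z * b - y1 * d - w1 * a) - z * (y2 * b - y1 * c - w * a) - y1 * (z * c - y2 * d - w2 * a)"
        by (simp add: algebra_simps)
      thus ?thesis using hideal_diff[OF hG hideal_diff[OF hG hideal_mult[OF hG that(2)] hideal_mult[OF hG that(1)]]
          hideal_mult[OF hG that(3)]] by metis
    qed
    have zwH: "z * w - y2 * w1 + y1 * w2 \<in> H (s + 3 - r)"
      using zH yH w(1) w1(1) w2(1) by (intro H_add H_diff H_mult'[where k = 1 and l = "s + 2 - r"]) auto
    have "z * w - y2 * w1 + y1 * w2 \<in> G"
    proof (rule socfreeD[OF socfree_G(2) zwH])
      fix x assume "x \<in> {a2, a3, a4}"
      thus "x * (z * w - y2 * w1 + y1 * w2) \<in> G"
        using cyc[OF w(2) w1(2) w2(2)] cyc[OF w(3) w1(3) w2(3)] cyc[OF w(4) w1(4) w2(4)] by blast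
    qed
    hence "(z * w - y2 * w1 + y1 * w2) + y2 * w1 - y1 * w2 \<in> ?Y"
      by (rule hideal_diff[OF hY(1) hideal_add[OF hY(1) subsetD[OF GY(1)] GY(3)] GY(2)])
    thus ?thesis by simp
  qed
  have "w \<in> ?Y" using wY yH by (intro socfreeD[OF sy(3) w(1)]) auto
  hence "w \<in> addgen (gen [y1, g1]) y2" by simp
  then obtain \<gamma> where \<gamma>: "\<gamma> \<in> H (s + 2 - r - 1)" "w - \<gamma> * y2 \<in> gen [y1, g1]"
    using addgen_homE[OF hY(2) yH(2) _ w(1)] by blast
  have "w - \<gamma> * y2 \<in> H (s + 2 - r)" using H_mult'[OF \<gamma>(1) yH(2), of "s + 2 - r"] w(1) by (auto intro: H_diff)
  then obtain \<beta> where \<beta>: "\<beta> \<in> H (s + 2 - r - 1)" "w - \<gamma> * y2 - \<beta> * y1 \<in> G"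
    using addgen_homE[OF hG yH(1), of "w - \<gamma> * y2" "s + 2 - r"] \<gamma>(2) by auto
  \<comment> \<open>Here \<open>\<gamma>\<close> is the correction: modulo \<open>(y1, g1)\<close>,
    \<open>y2 * (b - \<gamma> * a)\<close> vanishes, and \<open>y2\<close> is regular there, so
    \<open>b - \<gamma> * a\<close> is \<open>y1\<close> times some \<open>\<sigma>\<close> modulo
    \<open>g1\<close>.\<close>
  have part: "\<exists>\<sigma>. \<sigma> \<in> H s \<and> b - \<gamma> * a - \<sigma> * y1 \<in> G"
    if "y2 * b - y1 * c - w * a \<in> G" "b \<in> H (s + 1)" "a \<in> H r" for a b c
  proof -
    have bH: "b - \<gamma> * a \<in> H (s + 1)" using H_mult'[OF \<gamma>(1) that(3), of "s + 1"] that(2) by (auto intro: H_diff)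
    have "y2 * (b - \<gamma> * a) - (c + \<beta> * a) * y1 = (y2 * b - y1 * c - w * a) + a * (w - \<gamma> * y2 - \<beta> * y1)"
      by (simp add: algebra_simps)
    hence "y2 * (b - \<gamma> * a) - (c + \<beta> * a) * y1 \<in> G"
      using hideal_add[OF hG that(1) hideal_mult[OF hG \<beta>(2)]] by metis
    hence "y2 * (b - \<gamma> * a) \<in> gen [y1, g1]" using addgenI by simp
    hence "b - \<gamma> * a \<in> addgen G y1" using socfree1D[OF sy(2) bH] by simp
    thus ?thesis using addgen_homE[OF hG yH(1) _ bH] by (metis add_diff_cancel_right')
  qed
  obtain \<sigma>2 where s2: "\<sigma>2 \<in> H s" "b2 - \<gamma> * a2 - \<sigma>2 * y1 \<in> G" using part[OF w(2) bH(1) aH(2)] by blast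
  obtain \<sigma>3 where s3: "\<sigma>3 \<in> H s" "b3 - \<gamma> * a3 - \<sigma>3 * y1 \<in> G" using part[OF w(3) bH(2) aH(3)] by blast
  obtain \<sigma>4 where s4: "\<sigma>4 \<in> H s" "b4 - \<gamma> * a4 - \<sigma>4 * y1 \<in> G" using part[OF w(4) bH(3) aH(4)] by blast
  have "y1 * (\<sigma>2 * g2 + \<sigma>3 * g3 + \<sigma>4 * g4) =
      (b1 * g1 + b2 * g2 + b3 * g3 + b4 * g4) - \<gamma> * (a1 * g1 + a2 * g2 + a3 * g3 + a4 * g4) + (\<gamma> * a1 - b1) * g1
      - (g2 * (b2 - \<gamma> * a2 - \<sigma>2 * y1) + g3 * (b3 - \<gamma> * a3 - \<sigma>3 * y1) + g4 * (b4 - \<gamma> * a4 - \<sigma>4 * y1))"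
    by (simp add: algebra_simps)
  also have "\<dots> = (\<gamma> * a1 - b1) * g1
      - (g2 * (b2 - \<gamma> * a2 - \<sigma>2 * y1) + g3 * (b3 - \<gamma> * a3 - \<sigma>3 * y1) + g4 * (b4 - \<gamma> * a4 - \<sigma>4 * y1))"
    using rel_a b(1) by (simp add: syz_def)
  also have "\<dots> \<in> G"
    by (rule hideal_diff[OF hG g1_G(2) hideal_add[OF hG hideal_add[OF hG hideal_mult[OF hG s2(2)]
      hideal_mult[OF hG s3(2)]] hideal_mult[OF hG s4(2)]]])
  finally have "y1 * (\<sigma>2 * g2 + \<sigma>3 * g3 + \<sigma>4 * g4) \<in> G" .
  moreover have "\<sigma>2 * g2 + \<sigma>3 * g3 + \<sigma>4 * g4 \<in> H (s + e)"
    by (intro H_add H_mult s2(1) s3(1) s4(1) gH)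
  ultimately have "\<sigma>2 * g2 + \<sigma>3 * g3 + \<sigma>4 * g4 \<in> G" using socfree1D[OF sy(1)] by blast
  then obtain \<sigma>1 where \<sigma>: "syz g1 g2 g3 g4 s \<sigma>1 \<sigma>2 \<sigma>3 \<sigma>4" using syz_of_mod[OF s2(1) s3(1) s4(1)] by metis
  have crs: "a * \<sigma>' - a' * \<sigma>'' - v * g \<in> G"
    if "a * b' - a' * b'' - y1 * v * g \<in> G" "b' - \<gamma> * a' - \<sigma>' * y1 \<in> G" "b'' - \<gamma> * a - \<sigma>'' * y1 \<in> G"
      and hom: "a \<in> H r" "a' \<in> H r" "\<sigma>' \<in> H s" "\<sigma>'' \<in> H s" "g \<in> H e" for a a' b' b'' \<sigma>' \<sigma>'' g
  proof -
    have "y1 * (a * \<sigma>' - a' * \<sigma>'' - v * g) =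
      (a * b' - a' * b'' - y1 * v * g) - a * (b' - \<gamma> * a' - \<sigma>' * y1) + a' * (b'' - \<gamma> * a - \<sigma>'' * y1)"
      by (simp add: algebra_simps)
    also have "\<dots> \<in> G" by (rule hideal_add[OF hG hideal_diff[OF hG that(1) hideal_mult[OF hG that(2)]] hideal_mult[OF hG that(3)]])
    finally have "y1 * (a * \<sigma>' - a' * \<sigma>'' - v * g) \<in> G" .
    moreover have "a * \<sigma>' - a' * \<sigma>'' - v * g \<in> H (r + s)"
      using hom v by (intro H_diff H_mult'[where k = j and l = e] H_mult) (auto simp: s_def)
    ultimately show ?thesis using socfree1D[OF sy(1)] by blast
  qed
  have "cross \<sigma>2 \<sigma>3 \<sigma>4 v"
    unfolding cross_def
  proof (intro conjI)
    note b' = b(2)[unfolded cross_def]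
    show "a3 * \<sigma>4 - a4 * \<sigma>3 - v * g2 \<in> G"
      by (rule crs[OF conjunct1[OF b'] s4(2) s3(2) aH(3,4) s4(1) s3(1) gH(2)])
    show "a4 * \<sigma>2 - a2 * \<sigma>4 - v * g3 \<in> G"
      by (rule crs[OF conjunct1[OF conjunct2[OF b']] s2(2) s4(2) aH(4,2) s2(1) s4(1) gH(3)])
    show "a2 * \<sigma>3 - a3 * \<sigma>2 - v * g4 \<in> G"
      by (rule crs[OF conjunct2[OF conjunct2[OF b']] s3(2) s2(2) aH(2,3) s3(1) s2(1) gH(4)])
  qed
  thus "v \<in> A j" using v \<sigma> by (auto simp: A_def s_def)
qed

end

section \<open>Dimension count for the ideal of multipliers\<close>

lemma F_5: "v \<in> F [b1, b2, b3, b4, b5] k \<longleftrightarrow> v 0 \<in> H (k - b1) \<and> v 1 \<in> H (k - b2) \<and> v 2 \<in> H (k - b3) \<and>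
    v 3 \<in> H (k - b4) \<and> v 4 \<in> H (k - b5) \<and> (\<forall>i\<ge>5. v i = 0)"
  by (auto simp: F_def numeral_eq_Suc less_Suc_eq)

lemma W_dim_zero: "W.dim {0} = 0"
  using W.dim_span_eq_card_independent[OF W.independent_empty] by (simp add: W.span_empty)

lemma linear_proj: "Vector_Spaces.linear fscale cscale (\<lambda>v. v i)"
  by unfold_locales (auto simp: fscale_def cscale_def)

lemma dim_by_projection:
  assumes "W.subspace U" "W.findim U" "(\<lambda>v. v i) ` U = B" "\<And>v. v \<in> U \<Longrightarrow> v i = 0 \<Longrightarrow> v = 0"
  shows "W.dim U = V.dim B"
proof -
  have "{v \<in> U. v i = 0} = {0}" using assms(4) W.subspace_0[OF assms(1)] by auto
  thus ?thesis using WV.rank_nullity[OF linear_proj assms(1,2), of i] assms(3) W_dim_zero by simp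
qed

context good_coordinates
begin

lemma cross_add: "cross b2 b3 b4 l \<Longrightarrow> cross c2 c3 c4 m \<Longrightarrow> cross (b2 + c2) (b3 + c3) (b4 + c4) (l + m)"
proof -
  have "a * (x + x') - b * (y + y') - (l + m) * g = (a * x - b * y - l * g) + (a * x' - b * y' - m * g)"
    for a b x x' y y' l m g :: poly4 by (simp add: algebra_simps)
  thus "cross b2 b3 b4 l \<Longrightarrow> cross c2 c3 c4 m \<Longrightarrow> ?thesis" unfolding cross_def by (metis hideal_add[OF hG])
qed

lemma cross_mult: "cross b2 b3 b4 l \<Longrightarrow> cross (c * b2) (c * b3) (c * b4) (c * l)"
proof -
  have "a * (c * x) - b * (c * y) - c * l * g = c * (a * x - b * y - l * g)"
    for a b x y l g :: poly4 by (simp add: algebra_simps)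
  thus "cross b2 b3 b4 l \<Longrightarrow> ?thesis" unfolding cross_def by (metis hideal_mult[OF hG])
qed

lemma cross_multiple: "cross (h * a2) (h * a3) (h * a4) 0"
  using hideal_0[OF hG] by (simp add: cross_def mult_ac del: gen.simps)

lemma cross_cong:
  assumes "cross b2 b3 b4 l" "c2 - b2 \<in> G" "c3 - b3 \<in> G" "c4 - b4 \<in> G"
  shows "cross c2 c3 c4 l"
proof -
  have "a * x' - b * y' - l * g = (a * x - b * y - l * g) + a * (x' - x) - b * (y' - y)"
    for a b x x' y y' l g :: poly4 by (simp add: algebra_simps)
  thus ?thesis using assms unfolding cross_def
    by (metis hideal_add[OF hG] hideal_diff[OF hG] hideal_mult[OF hG])
qed

lemma dim_G: "int (V.dim (G \<inter> H k)) = hilb (k - e)"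
  using codim_ci1[OF gH(1) g1, of k] unfolding codim_def by simp

text \<open>The two projections of \<open>T\<close>, to the syzygies \<open>b\<close> and to the multipliers \<open>l\<close>, compare the Hilbert function
  of the syzygy module with that of the ideal of multipliers.\<close>

definition T :: "int \<Rightarrow> (nat \<Rightarrow> poly4) set" where
  "T s = {v \<in> F [0, 0, 0, 0, e - r] s. syz g1 g2 g3 g4 s (v 0) (v 1) (v 2) (v 3) \<and> cross (v 1) (v 2) (v 3) (v 4)}"

lemma subspace_T: "W.subspace (T s)"
proof -
  note F = subspace_F[of "[0, 0, 0, 0, e - r]" s, unfolded W.subspace_def]
  have c0: "cross 0 0 0 0" using hideal_0[OF hG] by (simp add: cross_def del: gen.simps)
  show ?thesis
    unfolding W.subspace_def
  proof (intro conjI ballI allI)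
    show "0 \<in> T s" using F c0 by (simp add: T_def syz_def)
    fix v assume v: "v \<in> T s"
    show "v + w \<in> T s" if w: "w \<in> T s" for w
    proof -
      have "(v 0 + w 0) * g1 + (v 1 + w 1) * g2 + (v 2 + w 2) * g3 + (v 3 + w 3) * g4 =
        (v 0 * g1 + v 1 * g2 + v 2 * g3 + v 3 * g4) + (w 0 * g1 + w 1 * g2 + w 2 * g3 + w 3 * g4)"
        by (simp add: algebra_simps)
      thus ?thesis using v w F cross_add by (auto simp: T_def syz_def H_add)
    qed
    fix c
    have "const c * v 0 * g1 + const c * v 1 * g2 + const c * v 2 * g3 + const c * v 3 * g4 =
        const c * (v 0 * g1 + v 1 * g2 + v 2 * g3 + v 3 * g4)"
      by (simp add: algebra_simps)
    hence "syz g1 g2 g3 g4 s (const c * v 0) (const c * v 1) (const c * v 2) (const c * v 3)"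
      using v by (auto simp: T_def syz_def H_const_mult)
    moreover have "cross (const c * v 1) (const c * v 2) (const c * v 3) (const c * v 4)"
      using v by (intro cross_mult) (simp add: T_def)
    ultimately show "fscale c v \<in> T s" using v F by (simp add: T_def) (simp add: fscale_def)
  qed
qed

lemma findim_T: "W.findim (T s)"
  by (rule W.findim_mono[OF findim_F]) (auto simp: T_def)

text \<open>Every syzygy has a multiplier, unique modulo \<open>g1\<close>: if
  \<open>l * g2\<close>, \<open>l * g3\<close>, \<open>l * g4\<close> lie in \<open>G\<close>, then
  so does \<open>l\<close>. The fibres contribute the dimension of \<open>G\<close> in degree
  \<open>s + r - e\<close>.\<close>

lemma dim_T: "int (W.dim (T s)) = int (W.dim (syz_space g1 g2 g3 g4 s)) + hilb (s + r - 2 * e)"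
proof -
  let ?p = "\<lambda>v. v(4 := 0) :: nat \<Rightarrow> poly4"
  have lin: "Vector_Spaces.linear fscale fscale ?p"
    by unfold_locales (auto simp: fscale_def fun_eq_iff)
  have im: "?p ` T s = syz_space g1 g2 g3 g4 s"
  proof (intro equalityI subsetI)
    fix v assume "v \<in> ?p ` T s"
    thus "v \<in> syz_space g1 g2 g3 g4 s" by (auto simp: T_def syz_space_def F_5)
  next
    fix v assume v: "v \<in> syz_space g1 g2 g3 g4 s"
    hence sv: "syz g1 g2 g3 g4 s (v 0) (v 1) (v 2) (v 3)" and v4: "\<And>i. i \<ge> 4 \<Longrightarrow> v i = 0"
      by (auto simp: syz_space_def)
    obtain l where l: "l \<in> H (s + r - e)" "cross (v 1) (v 2) (v 3) l" using cross_exists[OF sv] .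
    have "v(4 := l) \<in> T s"
      using sv v4 l by (auto simp: T_def F_5 syz_def algebra_simps)
    moreover have "?p (v(4 := l)) = v" using v4[of 4] by auto
    ultimately show "v \<in> ?p ` T s" by (metis image_eqI)
  qed
  have ker_eq: "{v \<in> T s. ?p v = 0} = {v \<in> T s. v 0 = 0 \<and> v 1 = 0 \<and> v 2 = 0 \<and> v 3 = 0}"
  proof -
    have "?p v = 0 \<longleftrightarrow> v 0 = 0 \<and> v 1 = 0 \<and> v 2 = 0 \<and> v 3 = 0" if "v \<in> T s" for v
    proof
      assume "v 0 = 0 \<and> v 1 = 0 \<and> v 2 = 0 \<and> v 3 = 0"
      hence "?p v i = 0" for i using that less_4_iff[of "\<lambda>i. v i = 0"]
        by (cases "i < 4"; cases "i = 4") (auto simp: T_def F_5)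
      thus "?p v = 0" by (simp add: fun_eq_iff)
    qed (auto simp: fun_eq_iff split: if_splits dest: spec[of _ 0] spec[of _ 1] spec[of _ 2] spec[of _ 3])
    thus ?thesis by blast
  qed
  have "W.dim {v \<in> T s. v 0 = 0 \<and> v 1 = 0 \<and> v 2 = 0 \<and> v 3 = 0} = V.dim (G \<inter> H (s + r - e))"
  proof (rule dim_by_projection[where i = 4])
    show "W.subspace {v \<in> T s. v 0 = 0 \<and> v 1 = 0 \<and> v 2 = 0 \<and> v 3 = 0}"
      using subspace_T[of s] by (auto simp: W.subspace_def fscale_def)
    show "W.findim {v \<in> T s. v 0 = 0 \<and> v 1 = 0 \<and> v 2 = 0 \<and> v 3 = 0}"
      by (rule W.findim_mono[OF findim_T]) auto
    show "(\<lambda>v. v 4) ` {v \<in> T s. v 0 = 0 \<and> v 1 = 0 \<and> v 2 = 0 \<and> v 3 = 0} = G \<inter> H (s + r - e)"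
    proof (intro equalityI subsetI)
      fix x assume "x \<in> (\<lambda>v. v 4) ` {v \<in> T s. v 0 = 0 \<and> v 1 = 0 \<and> v 2 = 0 \<and> v 3 = 0}"
      then obtain v where v: "v \<in> T s" "v 0 = 0" "v 1 = 0" "v 2 = 0" "v 3 = 0" "x = v 4" by blast
      have xH: "x \<in> H (s + r - e)" using v by (simp add: T_def F_5 algebra_simps)
      have "- x * g2 \<in> G \<and> - x * g3 \<in> G \<and> - x * g4 \<in> G"
        using v by (simp add: T_def cross_def del: gen.simps)
      hence "g2 * x \<in> G" "g3 * x \<in> G" "g4 * x \<in> G"
        using hideal_uminus[OF hG, of "- x * g2"] hideal_uminus[OF hG, of "- x * g3"] hideal_uminus[OF hG, of "- x * g4"]
        by (simp_all add: mult.commute del: gen.simps)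
      hence "x \<in> G" by (intro socfreeD[OF socfree_G(1) xH]) blast
      thus "x \<in> G \<inter> H (s + r - e)" using xH by simp
    next
      fix x assume x: "x \<in> G \<inter> H (s + r - e)"
      let ?v = "\<lambda>i. if i = 4 then x else (0 :: poly4)"
      have "- x * g \<in> G" for g using x hideal_mult'[OF hG, of "- x" g] hideal_uminus[OF hG, of x] by blast
      hence "?v \<in> T s" using x by (simp add: T_def F_5 syz_def cross_def algebra_simps del: gen.simps)
      thus "x \<in> (\<lambda>v. v 4) ` {v \<in> T s. v 0 = 0 \<and> v 1 = 0 \<and> v 2 = 0 \<and> v 3 = 0}"
        by (intro image_eqI[of _ _ ?v]) auto
    qed
    fix v assume v: "v \<in> {v \<in> T s. v 0 = 0 \<and> v 1 = 0 \<and> v 2 = 0 \<and> v 3 = 0}" "v 4 = 0"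
    have "v i = 0" for i using v less_4_iff[of "\<lambda>i. v i = 0"]
      by (cases "i < 4"; cases "i = 4") (auto simp: T_def F_5)
    thus "v = 0" by (simp add: fun_eq_iff)
  qed
  moreover have "hilb (s + r - e - e) = hilb (s + r - 2 * e)" by simp
  ultimately show ?thesis
    using WW.rank_nullity[OF lin subspace_T findim_T, of s] dim_G[of "s + r - e"] unfolding im ker_eq by simp
qed

text \<open>Multiplier 0 means a multiple of \<open>a\<close> plus Koszul syzygies between
  \<open>g1\<close> and \<open>g2, g3, g4\<close>. Multiples of \<open>g1 * a\<close> are themselves
  combinations of these Koszul syzygies; this redundancy is the subtracted term.\<close>

lemma dim_kernel_T: "int (W.dim {v \<in> T s. v 4 = 0}) = hilb (s - r) + 3 * hilb (s - e) - hilb (s - r - e)"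
proof -
  let ?U = "F [r, e, e, e] s"
  let ?f = "\<lambda>u. tuple4 (u 0 * a1 - (u 1 * g2 + u 2 * g3 + u 3 * g4)) (u 0 * a2 + u 1 * g1) (u 0 * a3 + u 2 * g1)
    (u 0 * a4 + u 3 * g1)"
  have lin: "Vector_Spaces.linear fscale fscale ?f"
    by unfold_locales (auto simp: fscale_def fun_eq_iff tuple4_def algebra_simps)
  have im: "?f ` ?U = {v \<in> T s. v 4 = 0}"
  proof (intro equalityI subsetI)
    fix v assume "v \<in> ?f ` ?U"
    then obtain u where u: "u \<in> ?U" "v = ?f u" by blast
    have uH: "u 0 \<in> H (s - r)" "u 1 \<in> H (s - e)" "u 2 \<in> H (s - e)" "u 3 \<in> H (s - e)"
      using u(1) by (auto simp: F_4)
    have vH: "u 0 * a1 - (u 1 * g2 + u 2 * g3 + u 3 * g4) \<in> H s" "u 0 * a2 + u 1 * g1 \<in> H s"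
      "u 0 * a3 + u 2 * g1 \<in> H s" "u 0 * a4 + u 3 * g1 \<in> H s"
      using H_mult[OF uH(1) aH(1)] H_mult[OF uH(1) aH(2)] H_mult[OF uH(1) aH(3)] H_mult[OF uH(1) aH(4)]
        H_mult[OF uH(2) gH(1)] H_mult[OF uH(3) gH(1)] H_mult[OF uH(4) gH(1)]
        H_mult[OF uH(2) gH(2)] H_mult[OF uH(3) gH(3)] H_mult[OF uH(4) gH(4)]
      by (auto intro!: H_diff H_add)
    have "(u 0 * a1 - (u 1 * g2 + u 2 * g3 + u 3 * g4)) * g1 + (u 0 * a2 + u 1 * g1) * g2 + (u 0 * a3 + u 2 * g1) * g3 +
      (u 0 * a4 + u 3 * g1) * g4 = u 0 * (a1 * g1 + a2 * g2 + a3 * g3 + a4 * g4)" by (simp add: algebra_simps)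
    hence "syz g1 g2 g3 g4 s (u 0 * a1 - (u 1 * g2 + u 2 * g3 + u 3 * g4)) (u 0 * a2 + u 1 * g1) (u 0 * a3 + u 2 * g1)
      (u 0 * a4 + u 3 * g1)" using vH rel_a by (simp add: syz_def)
    moreover have "cross (u 0 * a2 + u 1 * g1) (u 0 * a3 + u 2 * g1) (u 0 * a4 + u 3 * g1) 0"
      by (rule cross_cong[OF cross_multiple[of "u 0"]]) (simp_all add: g1_G del: gen.simps)
    ultimately show "v \<in> {v \<in> T s. v 4 = 0}"
      using vH unfolding u(2) by (simp add: T_def F_5 tuple4_def)
  next
    fix v assume v: "v \<in> {v \<in> T s. v 4 = 0}"
    hence sv: "syz g1 g2 g3 g4 s (v 0) (v 1) (v 2) (v 3)" and cr: "cross (v 1) (v 2) (v 3) 0"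
      and v5: "v 4 = 0" "\<And>i. i \<ge> 5 \<Longrightarrow> v i = 0"
      by (auto simp: T_def F_5)
    have v4: "v i = 0" if "i \<ge> 4" for i
      using v5 that by (cases "i = 4") auto
    have vH: "v 0 \<in> H s" "v 1 \<in> H s" "v 2 \<in> H s" "v 3 \<in> H s" and rel: "v 0 * g1 + v 1 * g2 + v 2 * g3 + v 3 * g4 = 0"
      using sv by (auto simp: syz_def)
    obtain w where w: "w \<in> H (s - r)" "v 1 - w * a2 \<in> G" "v 2 - w * a3 \<in> G" "v 3 - w * a4 \<in> G"
      using cross_zero_multiple[OF vH(2-4) cr] by metis
    have ex: "\<exists>u. u \<in> H (s - e) \<and> x = w * a + u * g1" if "x - w * a \<in> G" "x \<in> H s" "a \<in> H r" for x a
    proof -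
      have "x - w * a \<in> H s" using that(2) H_mult[OF w(1) that(3)] by (intro H_diff) auto
      from G_homE[OF that(1) this] show ?thesis by (metis add.commute diff_add_cancel)
    qed
    obtain u1 where u1: "u1 \<in> H (s - e)" "v 1 = w * a2 + u1 * g1" using ex[OF w(2) vH(2) aH(2)] by blast
    obtain u2 where u2: "u2 \<in> H (s - e)" "v 2 = w * a3 + u2 * g1" using ex[OF w(3) vH(3) aH(3)] by blast
    obtain u3 where u3: "u3 \<in> H (s - e)" "v 3 = w * a4 + u3 * g1" using ex[OF w(4) vH(4) aH(4)] by blast
    have "(v 0 - (w * a1 - (u1 * g2 + u2 * g3 + u3 * g4))) * g1 = (v 0 * g1 + v 1 * g2 + v 2 * g3 + v 3 * g4)
      - w * (a1 * g1 + a2 * g2 + a3 * g3 + a4 * g4)" unfolding u1(2) u2(2) u3(2) by (simp add: algebra_simps)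
    hence v0: "v 0 = w * a1 - (u1 * g2 + u2 * g3 + u3 * g4)" unfolding rel rel_a using g1 by simp
    have "tuple4 w u1 u2 u3 \<in> ?U" using w u1 u2 u3 by (simp add: F_4 tuple4_def)
    moreover have "v i = ?f (tuple4 w u1 u2 u3) i" for i
    proof -
      have "i = 0 \<or> i = 1 \<or> i = 2 \<or> i = 3 \<or> i \<ge> 4" by linarith
      thus ?thesis using v0 u1 u2 u3 v4 by (elim disjE) (simp_all add: tuple4_def)
    qed
    hence "v = ?f (tuple4 w u1 u2 u3)" by blast
    ultimately show "v \<in> ?f ` ?U" by blast
  qed
  let ?K = "{u \<in> ?U. ?f u = 0}"
  have K: "u \<in> ?K \<longleftrightarrow> u \<in> ?U \<and> u 0 * a1 = u 1 * g2 + u 2 * g3 + u 3 * g4 \<and> u 0 * a2 = - u 1 * g1 \<and>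
    u 0 * a3 = - u 2 * g1 \<and> u 0 * a4 = - u 3 * g1" for u
  proof -
    have t: "tuple4 x y z t = 0 \<longleftrightarrow> x = 0 \<and> y = 0 \<and> z = 0 \<and> t = 0" for x y z t
    proof
      assume "tuple4 x y z t = 0"
      hence "tuple4 x y z t i = 0" for i by simp
      from this[of 0] this[of 1] this[of 2] this[of 3] show "x = 0 \<and> y = 0 \<and> z = 0 \<and> t = 0" by (simp add: tuple4_def)
    qed (auto simp: tuple4_def fun_eq_iff)
    show ?thesis unfolding t by (auto simp: eq_neg_iff_add_eq_0)
  qed
  have "W.dim ?K = V.dim (G \<inter> H (s - r))"
  proof (rule dim_by_projection[where i = 0])
    interpret f: Vector_Spaces.linear fscale fscale ?f by (rule lin)
    show "W.subspace ?K" using subspace_F[of "[r, e, e, e]" s]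
      unfolding W.subspace_def by (auto simp only: mem_Collect_eq f.zero f.add f.scale add_0_left W.scale_zero_right)
    show "W.findim ?K" by (rule W.findim_mono[OF findim_F]) auto
    show "(\<lambda>u. u 0) ` ?K = G \<inter> H (s - r)"
    proof (intro equalityI subsetI)
      fix x assume "x \<in> (\<lambda>u. u 0) ` ?K"
      then obtain u where u: "u \<in> ?K" "x = u 0" by blast
      have xH: "x \<in> H (s - r)" using u by (simp add: F_4)
      have "x * a2 \<in> G" "x * a3 \<in> G" "x * a4 \<in> G"
        using u(1) g1_G(2)[of "- u 1"] g1_G(2)[of "- u 2"] g1_G(2)[of "- u 3"] unfolding K u(2) by metis+
      hence "x \<in> G" by (intro socfreeD[OF socfree_G(2) xH]) (auto simp: mult.commute simp del: gen.simps)
      thus "x \<in> G \<inter> H (s - r)" using xH by simp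
    next
      fix x assume x: "x \<in> G \<inter> H (s - r)"
      then obtain y where y: "y \<in> H (s - r - e)" "x = y * g1" using G_homE by blast
      have H: "- y * a \<in> H (s - e)" if "a \<in> H r" for a using H_mult'[OF H_uminus[OF y(1)] that] by simp
      have "tuple4 x (- y * a2) (- y * a3) (- y * a4) \<in> ?U" using x H aH by (simp add: F_4 tuple4_def)
      moreover have "x * a1 - (- y * a2 * g2 + - y * a3 * g3 + - y * a4 * g4) = y * (a1 * g1 + a2 * g2 + a3 * g3 + a4 * g4)"
        unfolding y(2) by (simp add: algebra_simps)
      hence "x * a1 = - y * a2 * g2 + - y * a3 * g3 + - y * a4 * g4" unfolding rel_a by simp
      ultimately have "tuple4 x (- y * a2) (- y * a3) (- y * a4) \<in> ?K"
        unfolding K by (simp add: tuple4_def y(2) mult_ac)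
      moreover have "tuple4 x (- y * a2) (- y * a3) (- y * a4) 0 = x" by (simp add: tuple4_def)
      ultimately show "x \<in> (\<lambda>u. u 0) ` ?K" by (metis (no_types, lifting) image_eqI)
    qed
    fix u assume u: "u \<in> ?K" "u 0 = 0"
    have z: "u 1 = 0" "u 2 = 0" "u 3 = 0" using u g1 unfolding K by auto
    have "u i = 0" for i
    proof -
      have "i = 0 \<or> i = 1 \<or> i = 2 \<or> i = 3 \<or> i \<ge> 4" by linarith
      thus ?thesis using z u by (elim disjE) (simp_all add: F_4)
    qed
    thus "u = 0" by (simp add: fun_eq_iff)
  qed
  hence "int (W.dim ?K) = hilb (s - r - e)" using dim_G[of "s - r"] by simp
  thus ?thesis
    using WW.rank_nullity[OF lin subspace_F findim_F, of "[r, e, e, e]" s] dim_F_4[of r e e e s] unfolding im by simp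
qed

lemma image_A: "(\<lambda>v. v 4) ` T s = A (s + r - e)"
proof (intro equalityI subsetI)
  fix x assume "x \<in> (\<lambda>v. v 4) ` T s"
  then obtain v where v: "v \<in> T s" "x = v 4" by blast
  have e1: "s - (e - r) = s + r - e" by simp
  have "v 4 \<in> H (s + r - e)" using v(1) unfolding T_def F_5 e1 by blast
  thus "x \<in> A (s + r - e)" using v unfolding A_def T_def by auto
next
  fix x assume "x \<in> A (s + r - e)"
  then obtain b1 b2 b3 b4 where b: "x \<in> H (s + r - e)" "syz g1 g2 g3 g4 s b1 b2 b3 b4" "cross b2 b3 b4 x"
    by (auto simp: A_def)
  have e1: "s - (e - r) = s + r - e" by simp
  have "(tuple4 b1 b2 b3 b4)(4 := x) \<in> T s" using b unfolding T_def F_5 e1 by (simp add: tuple4_def syz_def)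
  thus "x \<in> (\<lambda>v. v 4) ` T s" by (rule image_eqI[rotated]) simp
qed

lemma dim_A:
  "int (V.dim (A (s + r - e))) = 4 * hilb s - hilb (s + e) + codim (gen [g4, g3, g2, g1]) (s + e) + hilb (s + r - 2 * e)
     - hilb (s - r) - 3 * hilb (s - e) + hilb (s - r - e)"
proof -
  have "int (W.dim (T s)) = int (V.dim (A (s + r - e))) + int (W.dim {v \<in> T s. v 4 = 0})"
    using WV.rank_nullity[OF linear_proj[of 4] subspace_T[of s] findim_T[of s]] unfolding image_A by simp
  thus ?thesis using dim_T[of s] dim_kernel_T[of s] codim_gen4[OF gH, of "s + e"] by simp
qed

lemma A_sub: "A j \<subseteq> H j"
  by (auto simp: A_def)

lemma subspace_A: "V.subspace (A j)"
proof -
  have "V.subspace ((\<lambda>v. v 4) ` T (j + e - r))"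
    using WV.linear_subspace_image[OF linear_proj subspace_T] .
  thus ?thesis unfolding image_A by simp
qed

theorem upper_bound:
  assumes \<tau>: "\<And>k. k \<ge> k0 \<Longrightarrow> codim (gen [g4, g3, g2, g1]) k = \<tau>"
  shows "\<tau> \<le> e ^ 3 - r * e * (e - r)"
    and "\<tau> = e ^ 3 - r * e * (e - r) \<Longrightarrow> \<exists>b1 b2 b3 b4. syz g1 g2 g3 g4 (e - r) b1 b2 b3 b4 \<and>
      (\<forall>h. (b1, b2, b3, b4) \<noteq> (h * a1, h * a2, h * a3, h * a4))"
proof -
  define s0 where "s0 = max k0 (2 * e + r)"
  \<comment> \<open>The codimension of the multipliers in large degrees; its being nonnegative is
    the bound, its vanishing the case of equality.\<close>
  have id: "hilb (s + r - e) - int (V.dim (A (s + r - e))) = e ^ 3 - r * e * (e - r) - \<tau>" if "s \<ge> s0" for s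
  proof -
    have "codim (gen [g4, g3, g2, g1]) (s + e) = \<tau>" using \<tau>[of "s + e"] that e by (simp add: s0_def)
    hence "6 * (hilb (s + r - e) - int (V.dim (A (s + r - e)))) =
      6 * hilb (s + r - e) - 4 * (6 * hilb s) + 6 * hilb (s + e) - 6 * \<tau> - 6 * hilb (s + r - 2 * e)
      + 6 * hilb (s - r) + 3 * (6 * hilb (s - e)) - 6 * hilb (s - r - e)" unfolding dim_A by simp
    also have "\<dots> = 6 * (e ^ 3 - r * e * (e - r) - \<tau>)"
      using that e r by (subst hilb_eq, simp add: s0_def)+ (simp add: power3_eq_cube algebra_simps)
    finally show ?thesis by simp
  qed
  have le: "int (V.dim (A j)) \<le> hilb j" for j
    using V.dim_mono_findim[OF findim_H A_sub, of j] by (simp add: hilb_def)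
  show "\<tau> \<le> e ^ 3 - r * e * (e - r)" using id[of s0] le[of "s0 + r - e"] by simp
  assume eq: "\<tau> = e ^ 3 - r * e * (e - r)"
  have big: "H (s + r - e) \<subseteq> A (s + r - e)" if "s \<ge> s0" for s
  proof -
    have "V.dim (A (s + r - e)) = V.dim (H (s + r - e))" using id[OF that] eq by (simp add: hilb_def)
    thus ?thesis using V.dim_eq_imp_eq[OF findim_H A_sub subspace_A] by blast
  qed
  have "H j \<subseteq> A j" if "j \<le> s0 + r - e" for j
    using that
  proof (induction j rule: int_le_induct)
    case base
    show ?case by (rule big) simp
  next
    case (step j)
    thus ?case using A_descent[of "j - 1"] by simp
  qed
  moreover have "0 \<le> s0 + r - e" using e r by (simp add: s0_def)
  ultimately have "1 \<in> A 0" using H_1 by blast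
  then obtain b1 b2 b3 b4 where b: "syz g1 g2 g3 g4 (e - r) b1 b2 b3 b4" "cross b2 b3 b4 1" by (auto simp: A_def)
  have "(b1, b2, b3, b4) \<noteq> (h * a1, h * a2, h * a3, h * a4)" for h
  proof
    assume "(b1, b2, b3, b4) = (h * a1, h * a2, h * a3, h * a4)"
    hence "cross (h * a2) (h * a3) (h * a4) 1" using b(2) by simp
    hence "- g2 \<in> G" "- g3 \<in> G" "- g4 \<in> G" unfolding cross_def by (simp_all add: mult_ac del: gen.simps)
    hence "g2 \<in> G" "g3 \<in> G" "g4 \<in> G" using hideal_uminus[OF hG] by (metis minus_minus)+
    hence "1 \<in> G" by (intro socfreeD[OF socfree_G(1) H_1]) (auto simp del: gen.simps)
    then obtain u where "u \<in> H (0 - e)" "1 = u * g1" using G_homE[of 1 0] by auto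
    thus False using H_neg[of "0 - e"] e by auto
  qed
  thus "\<exists>b1 b2 b3 b4. syz g1 g2 g3 g4 (e - r) b1 b2 b3 b4 \<and>
      (\<forall>h. (b1, b2, b3, b4) \<noteq> (h * a1, h * a2, h * a3, h * a4))" using b(1) by blast
qed

end

subsection \<open>Greatest common divisors\<close>

type_synonym ipoly = "complex poly poly poly poly"

definition imono :: "monom4 \<Rightarrow> complex \<Rightarrow> ipoly" where
  "imono m c = monom (monom (monom (monom c (Poly_Mapping.lookup m 0)) (Poly_Mapping.lookup m 1))
     (Poly_Mapping.lookup m 2)) (Poly_Mapping.lookup m 3)"

text \<open>A ring isomorphism onto iterated univariate polynomials, where greatest common divisors
  exist; divisibility is transported along it.\<close>

definition iterated :: "poly4 \<Rightarrow> ipoly" where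
  "iterated p = (\<Sum>m\<in>Poly_Mapping.keys p. imono m (Poly_Mapping.lookup p m))"

lemma imono_0 [simp]: "imono m 0 = 0"
  by (simp add: imono_def)

lemma imono_add: "imono m (c + d) = imono m c + imono m d"
  by (simp add: imono_def add_monom)

lemma imono_mult: "imono (m + n) (c * d) = imono m c * imono n d"
  by (simp add: imono_def lookup_add mult_monom)

lemma iterated_add: "iterated (p + q) = iterated p + iterated q"
  unfolding iterated_def by (rule setsum_keys_plus_distrib) (simp_all add: imono_add)

lemma iterated_0 [simp]: "iterated 0 = 0"
  by (simp add: iterated_def)

lemma iterated_single: "iterated (Poly_Mapping.single m c) = imono m c"
  by (cases "c = 0") (simp_all add: iterated_def)

lemma iterated_sum: "iterated (sum f A) = (\<Sum>i\<in>A. iterated (f i))"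
  by (induction A rule: infinite_finite_induct) (auto simp: iterated_add)

lemma poly4_sum_single: "p = (\<Sum>m\<in>Poly_Mapping.keys p. Poly_Mapping.single m (Poly_Mapping.lookup p m))"
  by (rule poly_mapping_eqI)
     (simp add: lookup_sum lookup_single when_def in_keys_iff if_distrib sum.delta cong: if_cong)

lemma iterated_mult: "iterated (p * q) = iterated p * iterated q"
proof -
  let ?s = "\<lambda>p m. Poly_Mapping.single m (Poly_Mapping.lookup p m)"
  have "p * q = (\<Sum>m\<in>Poly_Mapping.keys p. \<Sum>n\<in>Poly_Mapping.keys q. ?s p m * ?s q n)"
    by (subst poly4_sum_single[of p], subst poly4_sum_single[of q]) (simp add: sum_product)
  hence "iterated (p * q) = (\<Sum>m\<in>Poly_Mapping.keys p. \<Sum>n\<in>Poly_Mapping.keys q. iterated (?s p m * ?s q n))"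
    by (simp add: iterated_sum)
  also have "\<dots> = iterated p * iterated q"
    by (simp only: mult_single iterated_single imono_mult iterated_def[of p] iterated_def[of q] sum_product)
  finally show ?thesis .
qed

lemma coeff_imono:
  "coeff (coeff (coeff (coeff (imono n c) (Poly_Mapping.lookup m 3)) (Poly_Mapping.lookup m 2))
    (Poly_Mapping.lookup m 1)) (Poly_Mapping.lookup m 0) = (if n = m then c else 0)"
proof -
  have "n = m \<longleftrightarrow> (\<forall>i. Poly_Mapping.lookup n i = Poly_Mapping.lookup m i)"
    by (auto intro: poly_mapping_eqI)
  thus ?thesis unfolding all_4 by (simp add: imono_def coeff_monom)
qed

lemma coeff_iterated:
  "coeff (coeff (coeff (coeff (iterated p) (Poly_Mapping.lookup m 3)) (Poly_Mapping.lookup m 2))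
    (Poly_Mapping.lookup m 1)) (Poly_Mapping.lookup m 0) = Poly_Mapping.lookup p m"
  by (simp add: iterated_def coeff_sum coeff_imono sum.delta' in_keys_iff)

lemma inj_iterated: "inj iterated"
  by (rule injI, rule poly_mapping_eqI) (metis coeff_iterated)

lemma surj_iterated: "\<exists>p. iterated p = q"
proof -
  define R where "R = range iterated"
  have sumR: "sum f A \<in> R" if "\<And>i. i \<in> A \<Longrightarrow> f i \<in> R" for f :: "nat \<Rightarrow> ipoly" and A
  proof -
    have "\<exists>g. \<forall>i\<in>A. f i = iterated (g i)" using that by (intro bchoice) (auto simp: R_def)
    then obtain g where "\<forall>i\<in>A. f i = iterated (g i)" by blast
    hence "sum f A = iterated (sum g A)" by (simp add: iterated_sum)
    thus ?thesis by (simp add: R_def)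
  qed
  have mono: "monom (monom (monom (monom c i) j) k) l \<in> R" for c i j k l
  proof -
    define m :: monom4 where "m = Abs_poly_mapping (\<lambda>v. if v = 0 then i else if v = 1 then j
        else if v = 2 then k else l)"
    have "Poly_Mapping.lookup m = (\<lambda>v. if v = 0 then i else if v = 1 then j
        else if v = 2 then k else l)"
      unfolding m_def by (rule lookup_Abs_poly_mapping) simp
    hence "iterated (Poly_Mapping.single m c) = monom (monom (monom (monom c i) j) k) l"
      by (simp add: iterated_single imono_def)
    thus ?thesis unfolding R_def by (metis rangeI)
  qed
  have ms: "monom (sum f A) i = (\<Sum>a\<in>A. monom (f a) i)" for f :: "nat \<Rightarrow> 'a :: comm_monoid_add" and A i
    by (induction A rule: infinite_finite_induct) (auto simp: add_monom[symmetric])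
  have 1: "monom (monom (monom p j) k) l \<in> R" for p j k l
    by (subst poly_as_sum_of_monoms[of p, symmetric]) (simp only: ms, intro sumR mono)
  have 2: "monom (monom p k) l \<in> R" for p k l
    by (subst poly_as_sum_of_monoms[of p, symmetric]) (simp only: ms, intro sumR 1)
  have 3: "monom p l \<in> R" for p l
    by (subst poly_as_sum_of_monoms[of p, symmetric]) (simp only: ms, intro sumR 2)
  have "q \<in> R"
    by (subst poly_as_sum_of_monoms[of q, symmetric]) (intro sumR 3)
  thus ?thesis by (auto simp: R_def)
qed

lemma iterated_dvd_iff: "iterated p dvd iterated q \<longleftrightarrow> p dvd q"
proof
  assume "iterated p dvd iterated q"
  then obtain c where "iterated q = iterated p * c" by (auto elim: dvdE)
  moreover obtain c' where "c = iterated c'" using surj_iterated by metis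
  ultimately have "iterated q = iterated (p * c')" by (simp add: iterated_mult)
  thus "p dvd q" using inj_iterated by (auto dest: injD)
qed (auto simp: iterated_mult elim!: dvdE)

text \<open>The last clause expresses coprimality of the \<open>b i\<close> in the form needed
  later: they have no common annihilator modulo any \<open>q\<close>.\<close>

lemma gcd4_cancel:
  fixes a :: "nat \<Rightarrow> ipoly"
  assumes "\<exists>i<4. a i \<noteq> 0"
  obtains g b where "g \<noteq> 0" "\<And>i. i < 4 \<Longrightarrow> a i = g * b i"
    "\<And>q u. (\<And>i. i < 4 \<Longrightarrow> q dvd u * b i) \<Longrightarrow> q dvd u"
proof -
  define G where "G a = gcd (gcd (a 0) (a 1)) (gcd (a 2) (a 3))" for a :: "nat \<Rightarrow> ipoly"
  have G_dvd: "G a dvd a i" if "i < 4" for a i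
  proof -
    have "\<forall>i<4. G a dvd a i" unfolding less_4_iff G_def
      by (intro conjI) (rule dvd_trans[OF gcd_dvd1 gcd_dvd1] dvd_trans[OF gcd_dvd1 gcd_dvd2]
        dvd_trans[OF gcd_dvd2 gcd_dvd1] dvd_trans[OF gcd_dvd2 gcd_dvd2])+
    thus ?thesis using that by blast
  qed
  have G_mult: "G (\<lambda>i. u * a i) = normalize (u * G a)" for u a
  proof -
    have "G (\<lambda>i. u * a i) = gcd (normalize (u * gcd (a 0) (a 1))) (normalize (u * gcd (a 2) (a 3)))"
      unfolding G_def by (simp only: gcd_mult_left)
    also have "\<dots> = gcd (u * gcd (a 0) (a 1)) (u * gcd (a 2) (a 3))" by (simp only: gcd.normalize_left_idem gcd.normalize_right_idem)
    also have "\<dots> = normalize (u * G a)" unfolding G_def by (simp only: gcd_mult_left)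
    finally show ?thesis .
  qed
  define g where "g = G a"
  have g0: "g \<noteq> 0" using assms G_dvd[of _ a] unfolding g_def by (metis dvd_0_left_iff)
  define b where "b i = a i div g" for i
  have ab: "a i = g * b i" if "i < 4" for i using G_dvd[OF that, of a] by (simp add: b_def g_def)
  have "G (\<lambda>i. g * b i) = G a" using ab by (simp add: G_def)
  hence "normalize (g * G b) = g" unfolding G_mult g_def .
  hence "g * G b dvd g * 1" by (metis mult_1_right normalize_dvd_iff dvd_refl dvd_normalize_iff)
  hence Gb: "G b dvd 1" using g0 by (simp only: dvd_mult_cancel_left) simp
  have "q dvd u" if "\<And>i. i < 4 \<Longrightarrow> q dvd u * b i" for q u
  proof -
    have "q dvd G (\<lambda>i. u * b i)" unfolding G_def using that by (intro gcd_greatest) auto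
    hence "q dvd u * G b" unfolding G_mult by simp
    also have "u * G b dvd u * 1" by (intro mult_dvd_mono dvd_refl Gb)
    finally show ?thesis by simp
  qed
  thus ?thesis using that g0 ab by blast
qed

lemma poly4_gcd:
  fixes a :: "nat \<Rightarrow> poly4"
  assumes "\<exists>i<4. a i \<noteq> 0"
  obtains g b where "g \<noteq> 0" "\<And>i. i < 4 \<Longrightarrow> a i = g * b i"
    "\<And>q u. (\<And>i. i < 4 \<Longrightarrow> q dvd u * b i) \<Longrightarrow> q dvd u"
proof -
  have "\<exists>i<4. iterated (a i) \<noteq> 0" using assms inj_iterated by (metis injD iterated_0)
  then obtain g b where g: "g \<noteq> 0" "\<And>i. i < 4 \<Longrightarrow> iterated (a i) = g * b i"
    "\<And>q u. (\<And>i. i < 4 \<Longrightarrow> q dvd u * b i) \<Longrightarrow> q dvd u" using gcd4_cancel[of "\<lambda>i. iterated (a i)"] by metis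
  obtain g' where g': "g = iterated g'" using surj_iterated by metis
  have "\<forall>i. \<exists>c. iterated c = b i" using surj_iterated by metis
  then obtain b' where b': "\<And>i. iterated (b' i) = b i" by metis
  show ?thesis
  proof (rule that[of g' b'])
    show "g' \<noteq> 0" using g g' by auto
    show "a i = g' * b' i" if "i < 4" for i
      using g(2)[OF that] inj_iterated unfolding g' b'[symmetric] iterated_mult[symmetric] by (rule injD[rotated])
    fix q u assume "\<And>i. i < 4 \<Longrightarrow> q dvd u * b' i"
    hence "\<And>i. i < 4 \<Longrightarrow> iterated q dvd iterated u * b i" by (metis b' iterated_dvd_iff iterated_mult)
    hence "iterated q dvd iterated u" by (rule g(3))
    thus "q dvd u" by (simp add: iterated_dvd_iff)
  qed
qed

lemma H_0_const:
  assumes "p \<in> H 0"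
  shows "p = const (Poly_Mapping.lookup p 0)"
proof (rule poly_mapping_eqI)
  fix m
  have "m = 0" if "mon_degree m = 0"
    using that by (intro poly_mapping_eqI) (simp add: mon_degree_def)
  thus "Poly_Mapping.lookup p m = Poly_Mapping.lookup (const (Poly_Mapping.lookup p 0)) m"
    using assms not_in_keys_iff_lookup_eq_zero[of m p]
    by (cases "m \<in> Poly_Mapping.keys p") (auto simp: const_def lookup_single H_def when_def)
qed

text \<open>A common factor of positive degree could be divided out, leaving a nonzero syzygy of
  degree below \<open>r\<close>; so the greatest common divisor of the entries is a
  constant.\<close>

lemma minimal_syzygy_primitive:
  assumes a: "syz p1 p2 p3 p4 r a1 a2 a3 a4" "(a1, a2, a3, a4) \<noteq> (0, 0, 0, 0)"
    and min: "\<And>s c1 c2 c3 c4. syz p1 p2 p3 p4 s c1 c2 c3 c4 \<Longrightarrow> s < r \<Longrightarrow> (c1, c2, c3, c4) = (0, 0, 0, 0)"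
    and q: "q dvd u * a1" "q dvd u * a2" "q dvd u * a3" "q dvd u * a4"
  shows "q dvd u"
proof -
  have t: "tuple4 a1 a2 a3 a4 0 = a1" "tuple4 a1 a2 a3 a4 1 = a2" "tuple4 a1 a2 a3 a4 2 = a3" "tuple4 a1 a2 a3 a4 3 = a4"
    by (simp_all add: tuple4_def)
  have "\<not> (\<forall>i<4. tuple4 a1 a2 a3 a4 i = 0)" unfolding less_4_iff t using a(2) by simp
  then obtain i0 where i0: "i0 < 4" "tuple4 a1 a2 a3 a4 i0 \<noteq> 0" by blast
  obtain g b where g: "g \<noteq> 0" "\<And>i. i < 4 \<Longrightarrow> tuple4 a1 a2 a3 a4 i = g * b i"
    "\<And>q u. (\<And>i. i < 4 \<Longrightarrow> q dvd u * b i) \<Longrightarrow> q dvd u" using poly4_gcd[of "tuple4 a1 a2 a3 a4"] i0 by metis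
  have eq: "a1 = g * b 0" "a2 = g * b 1" "a3 = g * b 2" "a4 = g * b 3"
    using g(2)[of 0] g(2)[of 1] g(2)[of 2] g(2)[of 3] unfolding t by auto
  have aH: "a1 \<in> H r" "a2 \<in> H r" "a3 \<in> H r" "a4 \<in> H r" and rel: "a1 * p1 + a2 * p2 + a3 * p3 + a4 * p4 = 0"
    using a(1) by (auto simp: syz_def)
  have "\<forall>i<4. tuple4 a1 a2 a3 a4 i \<in> H r" unfolding less_4_iff t using aH by simp
  hence "g * b i0 \<in> H r" "g * b i0 \<noteq> 0" using i0 g(2)[of i0] by auto
  then obtain k where k: "g \<in> H k" using homogeneous_factor by blast
  have k0: "k \<ge> 0" using H_nonneg[OF k g(1)] .
  have bH: "b 0 \<in> H (r - k)" "b 1 \<in> H (r - k)" "b 2 \<in> H (r - k)" "b 3 \<in> H (r - k)"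
    using aH unfolding eq by (auto intro!: H_dvd[OF _ k g(1)] simp: mult.commute)
  have "g * (b 0 * p1 + b 1 * p2 + b 2 * p3 + b 3 * p4) = 0" using rel unfolding eq by (simp add: algebra_simps)
  hence "b 0 * p1 + b 1 * p2 + b 2 * p3 + b 3 * p4 = 0" using g(1) by simp
  hence "syz p1 p2 p3 p4 (r - k) (b 0) (b 1) (b 2) (b 3)" using bH by (simp add: syz_def)
  hence "k = 0" using min[of "r - k" "b 0" "b 1" "b 2" "b 3"] k0 a(2) unfolding eq by force
  then obtain c where c: "g = const c" using H_0_const k by blast
  have "c \<noteq> 0" using g(1) c by auto
  have bq: "q dvd u * x" if "q dvd u * (g * x)" for x
  proof -
    have "q dvd const (inverse c) * (u * (g * x))" using that by simp
    also have "const (inverse c) * (u * (g * x)) = (const (inverse c) * const c) * (u * x)"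
      by (simp add: c mult_ac)
    also have "\<dots> = u * x" using \<open>c \<noteq> 0\<close> by (simp add: const_inverse)
    finally show ?thesis .
  qed
  have "\<forall>i<4. q dvd u * b i" unfolding less_4_iff using q bq unfolding eq by blast
  thus ?thesis using g(3) by blast
qed

subsection \<open>Existence of good coordinates\<close>

text \<open>A pencil requires equal degrees: \<open>y\<close> is multiplied by a power of a linear
  form regular modulo \<open>(q1, q2)\<close>, which does not change what it annihilates
  there.\<close>

lemma bdd_codim_of_two_more:
  assumes q: "q1 \<in> H a" "q1 \<noteq> 0" "q2 \<in> H b" "socfree (gen [q1]) {q2}" and nn: "a \<ge> 0" "b \<ge> 0" "m \<ge> n" "n \<ge> 0"
    and x: "x \<in> H m" "y \<in> H n" and socfree: "socfree (gen [q2, q1]) {x, y}"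
    and I: "hideal I" "{q1, q2, x, y} \<subseteq> I"
  shows "bdd_codim I"
proof -
  let ?Q = "gen [q2, q1]"
  have hQ: "hideal ?Q" using q by auto
  have cg: "hideal (gen [var 3, var 2, var 1, var 0])" "bdd_codim (gen [var 3, var 2, var 1, var 0])"
    using coords_gen[OF coords_var] by auto
  have sv: "socfree ?Q {var 0, var 1, var 2, var 3}"
    using socfree_gens[OF hQ socfree_unmixed2[OF q cg]] by (simp add: insert_commute)
  obtain l where l: "l \<in> H 1" "socfree ?Q {l}"
    using socfree_combination[OF hQ H_var H_var H_var sv] by (metis H_add H_const_mult H_var)
  define y' where "y' = l ^ nat (m - n) * y"
  have y': "y' \<in> H m" using H_mult[OF H_power[OF l(1)] x(2), of "nat (m - n)"] nn by (simp add: y'_def)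
  have "socfree ?Q {x, y'}"
  proof (rule socfreeI)
    fix k u assume u: "u \<in> H k" "\<And>z. z \<in> {x, y'} \<Longrightarrow> z * u \<in> ?Q"
    have "l ^ nat (m - n) * (y * u) \<in> ?Q" using u(2)[of y'] by (simp add: y'_def mult.assoc)
    hence "y * u \<in> ?Q" by (rule socfree_power[OF l(2,1) H_mult[OF x(2) u(1)]])
    moreover have "x * u \<in> ?Q" using u(2) by blast
    ultimately show "u \<in> ?Q" by (intro socfreeD[OF socfree u(1)]) blast
  qed
  then obtain s where s: "socfree ?Q {x + const s * y'}" using socfree_pencil_ex[OF hQ y', of x "{}"] by auto
  have h: "x + const s * y' \<in> H m" using x y' by (intro H_add H_const_mult)
  have "bdd_codim (gen [x + const s * y', q2, q1])" using bdd_codim_ci3[OF q h s] nn by simp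
  moreover have "y' \<in> I" using I unfolding y'_def by (intro hideal_mult) auto
  hence "gen [x + const s * y', q2, q1] \<subseteq> I"
    using I by (intro gen_minimal[OF I(1)]) (auto intro: hideal_add hideal_mult)
  ultimately show ?thesis by (rule bdd_codim_mono)
qed

lemma countable_root: "q \<noteq> 0 \<Longrightarrow> countable {s. p + const s * q = 0}"
proof (rule countable_subset[of _ "{SOME s. p + const s * q = 0}"], rule subsetI)
  assume q: "q \<noteq> 0"
  fix s assume s: "s \<in> {s. p + const s * q = 0}"
  define s' where "s' = (SOME s. p + const s * q = 0)"
  have "p + const s' * q = 0" using s unfolding s'_def by (auto intro: someI)
  moreover have "const (s - s') * q = (p + const s * q) - (p + const s' * q)" by (simp add: algebra_simps)
  ultimately have "const (s - s') * q = 0" using s by simp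
  hence "const (s - s') = 0" using q mult_eq_0_iff by blast
  hence "s = s'" by (simp only: const_eq_0_iff right_minus_eq)
  thus "s \<in> {SOME s. p + const s * q = 0}" by (simp add: s'_def)
qed simp

lemma gen1_dvd: "x \<in> gen [q] \<longleftrightarrow> q dvd x"
  by (auto simp: addgen_def dvd_def mult.commute)

text \<open>Modulo \<open>(p1, \<phi>)\<close>, two general combinations of the \<open>\<rho>\<^sub>i\<close>, only the pencils \<open>h = h0 + s g\<close> and \<open>p4 = \<rho>4 - s p3\<close>
  remain to be chosen; an element killed by members of both for uncountably many \<open>s\<close> would give one killed by \<open>g\<close>
  and by all \<open>\<rho>\<^sub>i\<close>, although these define a finite scheme.\<close>

lemma good_coordinates_exist:
  assumes f: "f1 \<in> H e" "f2 \<in> H e" "f3 \<in> H e" "f4 \<in> H e" and e: "e \<ge> 1" and r: "r \<ge> 0"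
    and J: "bdd_codim (gen [f4, f3, f2, f1])" and \<rho>: "syz f1 f2 f3 f4 r \<rho>1 \<rho>2 \<rho>3 \<rho>4" and \<rho>4: "\<rho>4 \<noteq> 0"
    and prim: "\<And>q u. q dvd u * \<rho>1 \<Longrightarrow> q dvd u * \<rho>2 \<Longrightarrow> q dvd u * \<rho>3 \<Longrightarrow> q dvd u * \<rho>4 \<Longrightarrow> q dvd u"
  obtains c1 c2 c3 s t g h where "g = f4 + const c1 * f1 + const c2 * f2 + const c3 * f3"
    "h = f3 - const t * f2 + const s * g" "gen [g, f2, f1, h] = gen [f4, f3, f2, f1]"
    "good_coordinates h f1 f2 g (\<rho>3 - const c3 * \<rho>4) (\<rho>1 - const c1 * \<rho>4)
      (\<rho>2 - const c2 * \<rho>4 + const t * (\<rho>3 - const c3 * \<rho>4)) (\<rho>4 - const s * (\<rho>3 - const c3 * \<rho>4)) e r"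
proof -
  have \<rho>H: "\<rho>1 \<in> H r" "\<rho>2 \<in> H r" "\<rho>3 \<in> H r" "\<rho>4 \<in> H r" and rel: "\<rho>1 * f1 + \<rho>2 * f2 + \<rho>3 * f3 + \<rho>4 * f4 = 0"
    using \<rho> by (auto simp: syz_def)
  let ?J = "gen [f4, f3, f2, f1]"
  have hJ: "hideal ?J" by (rule hideal_gen) (use f in auto)
  let ?R = "gen [\<rho>4, \<rho>3, \<rho>2, \<rho>1]"
  have hlR: "hlist [\<rho>4, \<rho>3, \<rho>2, \<rho>1]" using \<rho>H by auto
  have hR: "hideal ?R" by (rule hideal_gen[OF hlR])
  have Rg: "{\<rho>1, \<rho>2, \<rho>3, \<rho>4} \<subseteq> ?R" using gen_gens[OF hlR] by (simp del: gen.simps)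
  \<comment> \<open>Modulo a principal ideal, absence of a common annihilator is exactly
    primitivity.\<close>
  have psf: "socfree (gen [q]) {\<rho>1, \<rho>2, \<rho>3, \<rho>4}" for q
  proof (rule socfreeI)
    fix k u assume "u \<in> H k" and u: "\<And>x. x \<in> {\<rho>1, \<rho>2, \<rho>3, \<rho>4} \<Longrightarrow> x * u \<in> gen [q]"
    show "u \<in> gen [q]" unfolding gen1_dvd
      by (rule prim) (use u in \<open>simp_all add: gen1_dvd mult.commute del: gen.simps\<close>)
  qed
  have hq: "hideal (gen [\<rho>4])" using \<rho>H by auto
  \<comment> \<open>The ideal of the \<open>\<rho>\<close>s contains the complete intersection
    \<open>(\<rho>4, q2)\<close>. Choosing \<open>g\<close> regular modulo it will make
    \<open>g\<close> and the \<open>\<rho>\<close>s define a finite scheme.\<close>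
  obtain q2 where q2: "q2 \<in> H r" "q2 \<in> ?R" "socfree (gen [\<rho>4]) {q2}"
    using regular_combination[OF hq \<rho>H psf hR Rg] .
  let ?Q = "gen [q2, \<rho>4]"
  have hQ: "hideal ?Q" using \<rho>H q2 by auto
  have sQ: "socfree ?Q {f4, f3, f1, f2}" and s0: "socfree {0} {f4, f3, f1, f2}"
    using socfree_gens[OF hQ socfree_unmixed2[OF \<rho>H(4) \<rho>4 q2(1,3) hJ J]] socfree_gens[OF hideal_zero socfree_unmixed0[OF hJ J]]
    by (simp_all add: insert_commute)
  obtain c3 where c3: "socfree ?Q {f4 + const c3 * f3, f1, f2}" "socfree {0} {f4 + const c3 * f3, f1, f2}"
    using complex_avoid_countable[OF countable_Un[OF socfree_pencil1[OF hQ f(3) sQ] socfree_pencil1[OF hideal_zero f(3) s0]]]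
    by auto
  have "- \<rho>4 \<noteq> 0" using \<rho>4 by simp
  obtain c1 where c1: "socfree ?Q {f4 + const c3 * f3 + const c1 * f1, f2}" "socfree {0} {f4 + const c3 * f3 + const c1 * f1, f2}"
    "\<rho>1 + const c1 * (- \<rho>4) \<noteq> 0"
    using complex_avoid_countable[OF countable_Un[OF countable_Un[OF socfree_pencil1[OF hQ f(1) c3(1)]
      socfree_pencil1[OF hideal_zero f(1) c3(2)]] countable_root[OF \<open>- \<rho>4 \<noteq> 0\<close>, of \<rho>1]]]
    by auto
  \<comment> \<open>Replacing \<open>f4\<close> by \<open>g\<close> changes the other entries of the
    syzygy in this way.\<close>
  define p1 p3 where "p1 = \<rho>1 - const c1 * \<rho>4" and "p3 = \<rho>3 - const c3 * \<rho>4"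
  have p1: "p1 \<in> H r" "p1 \<noteq> 0" and p3: "p3 \<in> H r"
    using c1(3) \<rho>H by (auto simp: p1_def p3_def intro!: H_diff H_const_mult)
  have hp: "hideal (gen [p1])" using p1 by auto
  have p1in: "p1 * u \<in> gen [p1]" for u by (simp add: gen1_dvd del: gen.simps)
  have sp: "socfree (gen [p1]) {\<rho>2, - \<rho>4, p3}"
  proof (rule socfreeI)
    fix k u assume u: "u \<in> H k" "\<And>x. x \<in> {\<rho>2, - \<rho>4, p3} \<Longrightarrow> x * u \<in> gen [p1]"
    have 4: "\<rho>4 * u \<in> gen [p1]" using hideal_uminus[OF hp u(2)[of "- \<rho>4"]] by (simp del: gen.simps)
    have "\<rho>1 * u = p1 * u + const c1 * (\<rho>4 * u)" by (simp add: p1_def algebra_simps)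
    hence 1: "\<rho>1 * u \<in> gen [p1]" using hideal_add[OF hp p1in hideal_mult[OF hp 4]] by metis
    have "\<rho>3 * u = p3 * u + const c3 * (\<rho>4 * u)" by (simp add: p3_def algebra_simps)
    hence 3: "\<rho>3 * u \<in> gen [p1]" using hideal_add[OF hp u(2)[of p3] hideal_mult[OF hp 4]] by (metis insertI1 insertI2)
    show "u \<in> gen [p1]"
      by (rule socfreeD[OF psf u(1)]) (use 1 3 4 u(2)[of \<rho>2] in \<open>auto simp del: gen.simps\<close>)
  qed
  obtain c2 where c2: "socfree ?Q {f4 + const c3 * f3 + const c1 * f1 + const c2 * f2}"
    "socfree {0} {f4 + const c3 * f3 + const c1 * f1 + const c2 * f2}" "socfree (gen [p1]) {\<rho>2 + const c2 * (- \<rho>4), p3}"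
    using complex_avoid_countable[OF countable_Un[OF countable_Un[OF socfree_pencil1[OF hQ f(2) c1(1)]
      socfree_pencil1[OF hideal_zero f(2) c1(2)]] socfree_pencil1[OF hp H_uminus[OF \<rho>H(4)] sp]]]
    by auto
  define g where "g = f4 + const c1 * f1 + const c2 * f2 + const c3 * f3"
  have g_eq: "f4 + const c3 * f3 + const c1 * f1 + const c2 * f2 = g" by (simp add: g_def algebra_simps)
  have g: "g \<in> H e" "g \<noteq> 0" "socfree ?Q {g}"
    using f c2 socfree_zero_neq unfolding g_eq by (auto simp: g_def intro!: H_add H_const_mult)
  define p2 where "p2 = \<rho>2 - const c2 * \<rho>4"
  have p2: "p2 \<in> H r" using \<rho>H by (auto simp: p2_def intro!: H_diff H_const_mult)
  have "socfree (gen [p1]) {p2, p3}" using c2(3) by (simp add: p2_def)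
  then obtain t where t: "socfree (gen [p1]) {p2 + const t * p3}" using socfree_pencil_ex[OF hp p3, of p2 "{}"] by auto
  \<comment> \<open>The entry at \<open>f2\<close> once \<open>f3\<close> is replaced by
    \<open>f3 - t * f2\<close>.\<close>
  define \<phi> where "\<phi> = p2 + const t * p3"
  have \<phi>: "\<phi> \<in> H r" "socfree (gen [p1]) {\<phi>}" using t p2 p3 by (auto simp: \<phi>_def intro!: H_add H_const_mult)
  let ?Q' = "gen [\<phi>, p1]"
  have hQ': "hideal ?Q'" using p1 \<phi> by auto
  have hlQ': "hlist [\<phi>, p1]" using p1 \<phi> by auto
  have inQ': "\<phi> * u \<in> ?Q'" "p1 * u \<in> ?Q'" for u
    using gen_gens[OF hlQ'] hideal_mult'[OF hQ', of _ u] by (simp_all del: gen.simps)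
  let ?L = "[g, \<rho>4, \<rho>3, \<rho>2, \<rho>1]"
  have hlL: "hlist ?L" using g \<rho>H by auto
  have hL: "hideal (gen ?L)" by (rule hideal_gen[OF hlL])
  have "bdd_codim (gen [g, q2, \<rho>4])" using bdd_codim_ci3[OF \<rho>H(4) \<rho>4 q2(1,3) g(1,3)] r e by simp
  moreover have "gen [g, q2, \<rho>4] \<subseteq> gen ?L"
  proof (rule gen_minimal[OF hL])
    have "?R \<subseteq> gen ?L" using gen_gens[OF hlL] by (intro gen_mono[OF hlL]) (simp del: gen.simps)
    thus "set [g, q2, \<rho>4] \<subseteq> gen ?L" using q2(2) gen_gens[OF hlL] by (auto simp del: gen.simps)
  qed
  ultimately have bL: "bdd_codim (gen ?L)" by (rule bdd_codim_mono)
  define h0 where "h0 = f3 - const t * f2"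
  have h0: "h0 \<in> H e" using f by (auto simp: h0_def intro!: H_diff H_const_mult)
  have sQ': "socfree ?Q' {g, \<rho>4, p3}"
  proof (rule socfreeI)
    fix k u assume u: "u \<in> H k" "\<And>x. x \<in> {g, \<rho>4, p3} \<Longrightarrow> x * u \<in> ?Q'"
    have 4: "\<rho>4 * u \<in> ?Q'" and p: "p3 * u \<in> ?Q'" and gu: "g * u \<in> ?Q'" using u(2) by blast+
    have "\<rho>1 * u = p1 * u + const c1 * (\<rho>4 * u)" by (simp add: p1_def algebra_simps)
    hence 1: "\<rho>1 * u \<in> ?Q'" using hideal_add[OF hQ' inQ'(2) hideal_mult[OF hQ' 4]] by metis
    have "\<rho>3 * u = p3 * u + const c3 * (\<rho>4 * u)" by (simp add: p3_def algebra_simps)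
    hence 3: "\<rho>3 * u \<in> ?Q'" using hideal_add[OF hQ' p hideal_mult[OF hQ' 4]] by metis
    have "\<rho>2 * u = \<phi> * u + const c2 * (\<rho>4 * u) - const t * (p3 * u)" by (simp add: \<phi>_def p2_def algebra_simps)
    hence 2: "\<rho>2 * u \<in> ?Q'"
      using hideal_diff[OF hQ' hideal_add[OF hQ' inQ'(1) hideal_mult[OF hQ' 4]] hideal_mult[OF hQ' p]] by metis
    have "socfree ?Q' (set ?L)" by (rule socfree_gens[OF hQ' socfree_unmixed2[OF p1 \<phi> hL bL]])
    thus "u \<in> ?Q'" by (rule socfreeD[OF _ u(1)]) (use 1 2 3 4 gu in \<open>auto simp del: gen.simps\<close>)
  qed
  \<comment> \<open>The two pencils must share their parameter: adding \<open>s * g\<close> to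
    \<open>h0\<close> forces the entry at \<open>g\<close> to become
    \<open>\<rho>4 - s * p3\<close>. Hence the family version of the pencil lemma, indexed by
    \<open>bool\<close>.\<close>
  let ?p = "\<lambda>i :: bool. if i then h0 else \<rho>4" and ?q = "\<lambda>i. if i then g else - p3" and ?n = "\<lambda>i. if i then e else r"
  have qn: "?q i \<in> H (?n i)" for i using g(1) H_uminus[OF p3] by simp
  have "socfree ?Q' ({} \<union> ?p ` UNIV \<union> ?q ` UNIV)"
  proof (rule socfreeI)
    fix k u assume u: "u \<in> H k" "\<And>x. x \<in> {} \<union> ?p ` UNIV \<union> ?q ` UNIV \<Longrightarrow> x * u \<in> ?Q'"
    have "\<rho>4 \<in> ?p ` UNIV" "- p3 \<in> ?q ` UNIV" "g \<in> ?q ` UNIV"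
      using rangeI[of ?p False] rangeI[of ?q False] rangeI[of ?q True] by simp_all
    hence in3: "\<rho>4 * u \<in> ?Q'" "- p3 * u \<in> ?Q'" "g * u \<in> ?Q'" using u(2) by blast+
    note in3(1,3)
    moreover have "p3 * u \<in> ?Q'" using hideal_uminus[OF hQ' in3(2)] by (simp del: gen.simps)
    ultimately show "u \<in> ?Q'" by (intro socfreeD[OF sQ' u(1)]) blast
  qed
  from socfree_pencil[OF hQ' finite[of UNIV] qn this]
  have "countable {s. \<not> socfree ?Q' ({} \<union> (\<lambda>i. ?p i + const s * ?q i) ` UNIV)}" .
  from complex_avoid_countable[OF countable_Un[OF this countable_root[OF g(2), of h0]]]
  obtain s where s: "socfree ?Q' ({} \<union> (\<lambda>i. ?p i + const s * ?q i) ` UNIV)" "h0 + const s * g \<noteq> 0" by auto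
  define h where "h = h0 + const s * g"
  define p4 where "p4 = \<rho>4 - const s * p3"
  have hH: "h \<in> H e" "h \<noteq> 0" and p4: "p4 \<in> H r"
    using s(2) h0 g p3 \<rho>H by (auto simp: h_def p4_def intro!: H_add H_diff H_const_mult)
  have "(\<lambda>i. ?p i + const s * ?q i) ` UNIV = {h, p4}" by (auto simp: h_def p4_def UNIV_bool)
  hence shp: "socfree ?Q' {h, p4}" using s(1) by simp
  have hlN: "hlist [p4, \<phi>, p1, h]" using p1 p4 \<phi> hH by auto
  have hN: "hideal (gen [p4, \<phi>, p1, h])" by (rule hideal_gen[OF hlN])
  have inN: "{p1, \<phi>, h, p4} \<subseteq> gen [p4, \<phi>, p1, h]" using gen_gens[OF hlN] by (auto simp del: gen.simps)
  have bN: "bdd_codim (gen [p4, \<phi>, p1, h])"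
  proof (cases "r \<le> e")
    case True
    show ?thesis by (rule bdd_codim_of_two_more[OF p1 \<phi> r r True r hH(1) p4 shp hN inN])
  next
    case False
    have "socfree ?Q' {p4, h}" "{p1, \<phi>, p4, h} \<subseteq> gen [p4, \<phi>, p1, h]" using shp inN by (auto simp: insert_commute simp del: gen.simps)
    thus ?thesis using bdd_codim_of_two_more[OF p1 \<phi> r r _ _ p4 hH(1) _ hN] False e by simp
  qed
  have Jeq: "gen [g, f2, f1, h] = ?J"
  proof
    have hl: "hlist [g, f2, f1, h]" "hlist [f4, f3, f2, f1]" using g f hH by auto
    note hi = hideal_gen[OF hl(1)] hideal_gen[OF hl(2)]
    have i: "g \<in> gen [g, f2, f1, h]" "f2 \<in> gen [g, f2, f1, h]" "f1 \<in> gen [g, f2, f1, h]" "h \<in> gen [g, f2, f1, h]"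
      using gen_gens[OF hl(1)] by (simp_all del: gen.simps)
    have i': "f1 \<in> gen [f4, f3, f2, f1]" "f2 \<in> gen [f4, f3, f2, f1]" "f3 \<in> gen [f4, f3, f2, f1]" "f4 \<in> gen [f4, f3, f2, f1]"
      using gen_gens[OF hl(2)] by (simp_all del: gen.simps)
    have "f3 = h + const t * f2 - const s * g" by (simp add: h_def h0_def)
    hence i3: "f3 \<in> gen [g, f2, f1, h]"
      using hideal_diff[OF hi(1) hideal_add[OF hi(1) i(4) hideal_mult[OF hi(1) i(2)]] hideal_mult[OF hi(1) i(1)]] by metis
    have "f4 = g - const c1 * f1 - const c2 * f2 - const c3 * f3" by (simp add: g_def)
    hence "f4 \<in> gen [g, f2, f1, h]"
      using hideal_diff[OF hi(1) hideal_diff[OF hi(1) hideal_diff[OF hi(1) i(1) hideal_mult[OF hi(1) i(3)]] hideal_mult[OF hi(1) i(2)]]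
          hideal_mult[OF hi(1) i3]] by metis
    thus "gen [f4, f3, f2, f1] \<subseteq> gen [g, f2, f1, h]" using i i3 by (intro gen_mono[OF hl(1)]) (simp del: gen.simps)
    have g': "g \<in> gen [f4, f3, f2, f1]" unfolding g_def
      by (rule hideal_add[OF hi(2) hideal_add[OF hi(2) hideal_add[OF hi(2) i'(4) hideal_mult[OF hi(2) i'(1)]]
        hideal_mult[OF hi(2) i'(2)]] hideal_mult[OF hi(2) i'(3)]])
    have "h \<in> gen [f4, f3, f2, f1]" unfolding h_def h0_def
      by (rule hideal_add[OF hi(2) hideal_diff[OF hi(2) i'(3) hideal_mult[OF hi(2) i'(2)]] hideal_mult[OF hi(2) g']])
    thus "gen [g, f2, f1, h] \<subseteq> gen [f4, f3, f2, f1]" using i' g' by (intro gen_mono[OF hl(2)]) (simp del: gen.simps)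
  qed
  hence bJ: "bdd_codim (gen [g, f2, f1, h])" using J by simp
  have "p3 * h + p1 * f1 + \<phi> * f2 + p4 * g = \<rho>1 * f1 + \<rho>2 * f2 + \<rho>3 * f3 + \<rho>4 * f4"
    unfolding h_def h0_def p4_def \<phi>_def p1_def p2_def p3_def g_def by (simp add: algebra_simps)
  hence "syz h f1 f2 g r p3 p1 \<phi> p4" using rel p1 p3 p4 \<phi> by (simp add: syz_def)
  hence "good_coordinates h f1 f2 g p3 p1 \<phi> p4 e r"
    using hH f g e r bJ bN by unfold_locales auto
  thus ?thesis using that[OF g_def, of h t s] Jeq unfolding h_def h0_def p4_def \<phi>_def p1_def p2_def p3_def by blast
qed

section \<open>The upper bound for arbitrary generators\<close>

lemma upper_bound_syz:
  assumes f: "f1 \<in> H e" "f2 \<in> H e" "f3 \<in> H e" "f4 \<in> H e" and e: "e \<ge> 1"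
    and J: "bdd_codim (gen [f4, f3, f2, f1])" and \<rho>: "syz f1 f2 f3 f4 r \<rho>1 \<rho>2 \<rho>3 \<rho>4" and \<rho>4: "\<rho>4 \<noteq> 0"
    and min: "\<And>s c1 c2 c3 c4. syz f1 f2 f3 f4 s c1 c2 c3 c4 \<Longrightarrow> s < r \<Longrightarrow> (c1, c2, c3, c4) = (0, 0, 0, 0)"
    and b: "syz f1 f2 f3 f4 d b1 b2 b3 b4" "\<And>h. (b1, b2, b3, b4) \<noteq> (h * \<rho>1, h * \<rho>2, h * \<rho>3, h * \<rho>4)"
    and second: "\<And>s c1 c2 c3 c4. syz f1 f2 f3 f4 s c1 c2 c3 c4 \<Longrightarrow> s < d \<Longrightarrow>
      \<exists>h. (c1, c2, c3, c4) = (h * \<rho>1, h * \<rho>2, h * \<rho>3, h * \<rho>4)"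
    and \<tau>: "\<And>k. k \<ge> k0 \<Longrightarrow> codim (gen [f4, f3, f2, f1]) k = \<tau>"
  shows "\<tau> \<le> e ^ 3 - r * e * (e - r) \<and> (\<tau> = e ^ 3 - r * e * (e - r) \<longrightarrow> r + d = e)"
proof -
  have r: "r \<ge> 0" using \<rho> \<rho>4 H_nonneg by (auto simp: syz_def)
  have ne: "(\<rho>1, \<rho>2, \<rho>3, \<rho>4) \<noteq> (0, 0, 0, 0)" using \<rho>4 by simp
  have prim: "q dvd u" if "q dvd u * \<rho>1" "q dvd u * \<rho>2" "q dvd u * \<rho>3" "q dvd u * \<rho>4" for q u
    using minimal_syzygy_primitive[OF \<rho> ne min that] .
  obtain c1 c2 c3 s t g h where g: "g = f4 + const c1 * f1 + const c2 * f2 + const c3 * f3"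
    and h: "h = f3 - const t * f2 + const s * g"
    and Jeq: "gen [g, f2, f1, h] = gen [f4, f3, f2, f1]" and loc: "good_coordinates h f1 f2 g (\<rho>3 - const c3 * \<rho>4) (\<rho>1 - const c1 * \<rho>4)
      (\<rho>2 - const c2 * \<rho>4 + const t * (\<rho>3 - const c3 * \<rho>4)) (\<rho>4 - const s * (\<rho>3 - const c3 * \<rho>4)) e r"
    by (rule good_coordinates_exist[OF f e r J \<rho> \<rho>4 prim])
  interpret good_coordinates h f1 f2 g "\<rho>3 - const c3 * \<rho>4" "\<rho>1 - const c1 * \<rho>4"
    "\<rho>2 - const c2 * \<rho>4 + const t * (\<rho>3 - const c3 * \<rho>4)" "\<rho>4 - const s * (\<rho>3 - const c3 * \<rho>4)" e r by (rule loc)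
  have \<tau>': "codim (gen [g, f2, f1, h]) k = \<tau>" if "k \<ge> k0" for k using \<tau>[OF that] by (simp only: Jeq)
  have "r + d = e" if eq: "\<tau> = e ^ 3 - r * e * (e - r)"
  proof -
    obtain x1 x2 x3 x4 where x: "syz h f1 f2 g (e - r) x1 x2 x3 x4"
      "\<And>m. (x1, x2, x3, x4) \<noteq> (m * (\<rho>3 - const c3 * \<rho>4), m * (\<rho>1 - const c1 * \<rho>4),
        m * (\<rho>2 - const c2 * \<rho>4 + const t * (\<rho>3 - const c3 * \<rho>4)), m * (\<rho>4 - const s * (\<rho>3 - const c3 * \<rho>4)))"
      using upper_bound(2)[OF \<tau>' eq] by blast
    \<comment> \<open>The coefficient of \<open>g\<close>, and hence of \<open>f4\<close>, after
      \<open>h\<close> has been expanded.\<close>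
    define y where "y = x4 + const s * x1"
    have xH: "x1 \<in> H (e - r)" "x2 \<in> H (e - r)" "x3 \<in> H (e - r)" "x4 \<in> H (e - r)" and xr: "x1 * h + x2 * f1 + x3 * f2 + x4 * g = 0"
      using x(1) by (auto simp: syz_def)
    have "(x2 + const c1 * y) * f1 + (x3 - const t * x1 + const c2 * y) * f2 + (x1 + const c3 * y) * f3 + y * f4 =
      x1 * h + x2 * f1 + x3 * f2 + x4 * g" by (simp add: y_def g h algebra_simps)
    moreover have yH: "y \<in> H (e - r)" using xH by (auto simp: y_def intro!: H_add H_const_mult)
    ultimately have sx: "syz f1 f2 f3 f4 (e - r) (x2 + const c1 * y) (x3 - const t * x1 + const c2 * y) (x1 + const c3 * y) y"
      unfolding syz_def using xr xH by (auto intro!: H_add H_diff H_const_mult)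
    \<comment> \<open>The syzygy from the case of equality is not a multiple of
      \<open>\<rho>\<close>, but below degree \<open>d\<close> all are.\<close>
    have "\<not> e - r < d"
    proof
      assume "e - r < d"
      then obtain m where "(x2 + const c1 * y, x3 - const t * x1 + const c2 * y, x1 + const c3 * y, y) =
          (m * \<rho>1, m * \<rho>2, m * \<rho>3, m * \<rho>4)" using second[OF sx] by blast
      hence m: "x2 + const c1 * y = m * \<rho>1" "x3 - const t * x1 + const c2 * y = m * \<rho>2" "x1 + const c3 * y = m * \<rho>3"
        "y = m * \<rho>4" by auto
      have m1: "x1 = m * (\<rho>3 - const c3 * \<rho>4)" using m(3,4) by (simp add: algebra_simps eq_diff_eq)
      moreover have "x2 = m * (\<rho>1 - const c1 * \<rho>4)" using m(1,4) by (simp add: algebra_simps eq_diff_eq)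
      moreover have "x3 = m * \<rho>2 + const t * x1 - const c2 * y" using m(2) by (simp add: algebra_simps eq_diff_eq)
      hence "x3 = m * (\<rho>2 - const c2 * \<rho>4 + const t * (\<rho>3 - const c3 * \<rho>4))"
        unfolding m1 m(4) by (simp add: algebra_simps)
      moreover have "x4 = y - const s * x1" by (simp add: y_def)
      hence "x4 = m * (\<rho>4 - const s * (\<rho>3 - const c3 * \<rho>4))" unfolding m1 m(4) by (simp add: algebra_simps)
      ultimately show False using x(2) by blast
    qed
    \<comment> \<open>Conversely, \<open>b\<close> would be a multiple of \<open>\<rho>\<close> by
      \<open>low_degree_multiple\<close>.\<close>
    moreover have "\<not> d < e - r"
    proof
      assume d: "d < e - r"
      have bH: "b1 \<in> H d" "b2 \<in> H d" "b3 \<in> H d" "b4 \<in> H d" and br: "b1 * f1 + b2 * f2 + b3 * f3 + b4 * f4 = 0"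
        using b(1) by (auto simp: syz_def)
      define z1 where "z1 = b3 - const c3 * b4"
      have "z1 * h + (b1 - const c1 * b4) * f1 + (b2 - const c2 * b4 + const t * z1) * f2 + (b4 - const s * z1) * g =
        b1 * f1 + b2 * f2 + b3 * f3 + b4 * f4" by (simp add: z1_def g h algebra_simps)
      moreover have "z1 \<in> H d" using bH by (auto simp: z1_def intro!: H_diff H_const_mult)
      ultimately have "syz h f1 f2 g d z1 (b1 - const c1 * b4) (b2 - const c2 * b4 + const t * z1) (b4 - const s * z1)"
        unfolding syz_def using br bH by (auto intro!: H_add H_diff H_const_mult)
      from low_degree_multiple[OF this d] obtain m where m: "z1 = m * (\<rho>3 - const c3 * \<rho>4)"
        "b1 - const c1 * b4 = m * (\<rho>1 - const c1 * \<rho>4)"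
        "b2 - const c2 * b4 + const t * z1 = m * (\<rho>2 - const c2 * \<rho>4 + const t * (\<rho>3 - const c3 * \<rho>4))"
        "b4 - const s * z1 = m * (\<rho>4 - const s * (\<rho>3 - const c3 * \<rho>4))" by auto
      have b4: "b4 = m * \<rho>4" using m(4) unfolding m(1) by (simp add: algebra_simps)
      moreover have "b1 = m * \<rho>1" using m(2) unfolding b4 by (simp add: algebra_simps)
      moreover have "b3 = m * \<rho>3" using m(1) unfolding z1_def b4 by (simp add: algebra_simps)
      moreover have "b2 = m * \<rho>2" using m(3) unfolding m(1) b4 by (simp add: algebra_simps)
      ultimately show False using b(2) by blast
    qed
    ultimately show ?thesis by simp
  qed
  thus ?thesis using upper_bound(1)[OF \<tau>'] by blast
qed

text \<open>The generators are permuted so that a nonzero entry of the syzygy comes last; the ideal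
  and the conditions on syzygies do not change.\<close>

lemma upper_bound_syz_any:
  assumes f: "f1 \<in> H e" "f2 \<in> H e" "f3 \<in> H e" "f4 \<in> H e" and e: "e \<ge> 1"
    and J: "bdd_codim (gen [f4, f3, f2, f1])" and \<rho>: "syz f1 f2 f3 f4 r \<rho>1 \<rho>2 \<rho>3 \<rho>4" "(\<rho>1, \<rho>2, \<rho>3, \<rho>4) \<noteq> (0, 0, 0, 0)"
    and min: "\<And>s c1 c2 c3 c4. syz f1 f2 f3 f4 s c1 c2 c3 c4 \<Longrightarrow> s < r \<Longrightarrow> (c1, c2, c3, c4) = (0, 0, 0, 0)"
    and b: "syz f1 f2 f3 f4 d b1 b2 b3 b4" "\<And>h. (b1, b2, b3, b4) \<noteq> (h * \<rho>1, h * \<rho>2, h * \<rho>3, h * \<rho>4)"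
    and second: "\<And>s c1 c2 c3 c4. syz f1 f2 f3 f4 s c1 c2 c3 c4 \<Longrightarrow> s < d \<Longrightarrow>
      \<exists>h. (c1, c2, c3, c4) = (h * \<rho>1, h * \<rho>2, h * \<rho>3, h * \<rho>4)"
    and \<tau>: "\<And>k. k \<ge> k0 \<Longrightarrow> codim (gen [f4, f3, f2, f1]) k = \<tau>"
  shows "\<tau> \<le> e ^ 3 - r * e * (e - r) \<and> (\<tau> = e ^ 3 - r * e * (e - r) \<longrightarrow> r + d = e)"
proof -
  have hl: "hlist [f4, f3, f2, f1]" using f by auto
  consider "\<rho>4 \<noteq> 0" | "\<rho>3 \<noteq> 0" | "\<rho>2 \<noteq> 0" | "\<rho>1 \<noteq> 0" using \<rho>(2) by auto
  thus ?thesis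
  proof cases
    case 1
    show ?thesis by (rule upper_bound_syz[OF f e J \<rho>(1) 1 min b second \<tau>])
  next
    case 2
    have sw: "syz f1 f2 f4 f3 s x1 x2 x4 x3 \<longleftrightarrow> syz f1 f2 f3 f4 s x1 x2 x3 x4" for s x1 x2 x3 x4
      by (auto simp: syz_def add_ac)
    have gs: "gen [f3, f4, f2, f1] = gen [f4, f3, f2, f1]" by (rule gen_set_eq[symmetric, OF hl]) auto
    show ?thesis
      by (rule upper_bound_syz[of f1 e f2 f4 f3 r \<rho>1 \<rho>2 \<rho>4 \<rho>3 d b1 b2 b4 b3 k0])
        (use f e J \<rho>(1) 2 min b second \<tau> in \<open>unfold sw gs, (simp del: gen.simps; fail | fastforce simp del: gen.simps)+\<close>)
  next
    case 3
    have sw: "syz f1 f4 f3 f2 s x1 x4 x3 x2 \<longleftrightarrow> syz f1 f2 f3 f4 s x1 x2 x3 x4" for s x1 x2 x3 x4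
      by (auto simp: syz_def add_ac)
    have gs: "gen [f2, f3, f4, f1] = gen [f4, f3, f2, f1]" by (rule gen_set_eq[symmetric, OF hl]) auto
    show ?thesis
      by (rule upper_bound_syz[of f1 e f4 f3 f2 r \<rho>1 \<rho>4 \<rho>3 \<rho>2 d b1 b4 b3 b2 k0])
        (use f e J \<rho>(1) 3 min b second \<tau> in \<open>unfold sw gs, (simp del: gen.simps; fail | fastforce simp del: gen.simps)+\<close>)
  next
    case 4
    have sw: "syz f4 f2 f3 f1 s x4 x2 x3 x1 \<longleftrightarrow> syz f1 f2 f3 f4 s x1 x2 x3 x4" for s x1 x2 x3 x4
      by (auto simp: syz_def add_ac)
    have gs: "gen [f1, f3, f2, f4] = gen [f4, f3, f2, f1]" by (rule gen_set_eq[symmetric, OF hl]) auto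
    show ?thesis
      by (rule upper_bound_syz[of f4 e f2 f3 f1 r \<rho>4 \<rho>2 \<rho>3 \<rho>1 d b4 b2 b3 b1 k0])
        (use f e J \<rho>(1) 4 min b second \<tau> in \<open>unfold sw gs, (simp del: gen.simps; fail | fastforce simp del: gen.simps)+\<close>)
  qed
qed

section \<open>From the bounds on \<open>\<tau>\<close> to the Betti numbers\<close>

theorem corollary1p2:
  fixes f :: poly4 and d :: nat and ds cs bs :: "int list"
  assumes "d \<ge> 3"
    and "homogeneous d f"
    and "squarefree f"
    and "graded_betti d f ds cs bs"
    and "length ds \<ge> 3"
    and "isolated_singularities f"
  shows "let D = int d; d1 = ds ! 0; d2 = ds ! 1;
           M = - (\<Sum>i<length ds. (ds ! i) ^ 3) + (\<Sum>j<length cs. (cs ! j) ^ 3)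
               - (\<Sum>k<length bs. (bs ! k) ^ 3);
           U = 5 * (D - 1) ^ 3 - 6 * d1 * (D - d1 - 1) * (D - 1)
         in 5 * (D - 1) ^ 3 - 6 * d1 * (D - 1) ^ 2 \<le> M \<and> M \<le> U
            \<and> (d1 + d2 \<noteq> D - 1 \<longrightarrow> M < U)
            \<and> (real_of_int d1 > (real d - 1) / 2 \<longrightarrow> M < U)"
proof -
  define e where "e = int d - 1"
  have e: "e \<ge> 1" using assms(1) by (simp add: e_def)
  note pH = resolution_codim(1)[OF assms(4) e_def]
  have hl: "hlist [partial 3 f, partial 2 f, partial 1 f, partial 0 f]" using pH by (simp, blast)
  note hJ = hideal_gen[OF hl]
  have bJ: "bdd_codim (Jac f)"
  proof (rule bdd_codim_if_Proj_dim_0[OF hJ])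
    show "Proj_dim (jacobian_ideal f) = 0" using assms(6) by (simp add: isolated_singularities_def)
    \<comment> \<open>The concrete \<open>gen\<close> and the abstract \<open>genideal\<close> are
      compared through the homogeneous ideals that contain them.\<close>
    fix P assume P: "hideal P" "Jac f \<subseteq> P"
    have "range (\<lambda>i. partial i f) \<subseteq> P" using gen_gens[OF hl] P(2) unfolding UNIV_4' by auto
    thus "jacobian_ideal f \<subseteq> P" unfolding jacobian_ideal_def by (intro S.genideal_minimal ideal_hideal[OF P(1)])
  qed
  obtain k0 \<tau> where \<tau>: "\<And>k. k \<ge> k0 \<Longrightarrow> codim (Jac f) k = \<tau>" and M: "- power_sum 3 ds + power_sum 3 cs - power_sum 3 bs = 6 * \<tau> - e ^ 3"
    using constant_Hilbert_polynomial[OF resolution_codim(2)[OF assms(4) e_def] bJ] by metis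
  obtain a1 a2 a3 a4 b1 b2 b3 b4 where a:
    "syz (partial 0 f) (partial 1 f) (partial 2 f) (partial 3 f) (ds ! 0) a1 a2 a3 a4"
    "(a1, a2, a3, a4) \<noteq> (0, 0, 0, 0)"
    and b: "syz (partial 0 f) (partial 1 f) (partial 2 f) (partial 3 f) (ds ! 1) b1 b2 b3 b4"
    "\<And>h. (b1, b2, b3, b4) \<noteq> (h * a1, h * a2, h * a3, h * a4)"
    and min: "\<And>s c1 c2 c3 c4. syz (partial 0 f) (partial 1 f) (partial 2 f) (partial 3 f) s c1 c2 c3 c4 \<Longrightarrow>
      s < ds ! 0 \<Longrightarrow> (c1, c2, c3, c4) = (0, 0, 0, 0)"
    and second: "\<And>s c1 c2 c3 c4. syz (partial 0 f) (partial 1 f) (partial 2 f) (partial 3 f) s c1 c2 c3 c4 \<Longrightarrow>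
      s < ds ! 1 \<Longrightarrow> \<exists>h. (c1, c2, c3, c4) = (h * a1, h * a2, h * a3, h * a4)"
  proof -
    have "2 \<le> length ds" using assms(5) by simp
    thus ?thesis by (rule resolution_syzygies[OF assms(4) _ that])
  qed
  define r where "r = ds ! 0"
  define d2 where "d2 = ds ! 1"
  have low: "e ^ 2 * (e - r) \<le> \<tau>"
    using lower_bound[OF pH pH pH pH _ bJ a \<tau>] e by (simp add: r_def)
  have up: "\<tau> \<le> e ^ 3 - r * e * (e - r) \<and> (\<tau> = e ^ 3 - r * e * (e - r) \<longrightarrow> r + d2 = e)"
    unfolding r_def d2_def by (rule upper_bound_syz_any[OF pH pH pH pH e bJ a min b second \<tau>])
  have "r \<le> d2" using assms(4,5) unfolding r_def d2_def graded_betti_def by (intro sorted_nth_mono) auto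
  moreover have "2 * r > e" if "real_of_int r > (real d - 1) / 2"
  proof -
    have "real_of_int (2 * r) > real_of_int e" using that by (simp add: e_def)
    thus ?thesis by (simp only: of_int_less_iff)
  qed
  ultimately have half: "real_of_int r > (real d - 1) / 2 \<Longrightarrow> r + d2 \<noteq> e" by linarith
  \<comment> \<open>The alternating sum of cubes is \<open>6 * \<tau> - e ^ 3\<close>, so the stated
    bounds are those for \<open>\<tau>\<close> under
    \<open>x \<mapsto> 6 * x - e ^ 3\<close>.\<close>
  have "5 * e ^ 3 - 6 * r * e ^ 2 = 6 * (e ^ 2 * (e - r)) - e ^ 3"
    "5 * e ^ 3 - 6 * r * (e - r) * e = 6 * (e ^ 3 - r * e * (e - r)) - e ^ 3"
    by (simp_all add: power2_eq_square power3_eq_cube algebra_simps)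
  moreover have "A \<le> 6 * t - c \<and> 6 * t - c \<le> B \<and> (\<not> Z \<longrightarrow> 6 * t - c < B)"
    if "A = 6 * L - c" "B = 6 * U - c" "L \<le> t" "t \<le> U \<and> (t = U \<longrightarrow> Z)" for A B L U c t :: int and Z
    using that by auto
  ultimately have "5 * e ^ 3 - 6 * r * e ^ 2 \<le> 6 * \<tau> - e ^ 3 \<and> 6 * \<tau> - e ^ 3 \<le> 5 * e ^ 3 - 6 * r * (e - r) * e
    \<and> (r + d2 \<noteq> e \<longrightarrow> 6 * \<tau> - e ^ 3 < 5 * e ^ 3 - 6 * r * (e - r) * e)"
    using low up by blast
  moreover have dr: "int d - r - 1 = e - r" by (simp add: e_def)
  ultimately show ?thesis
    using M half unfolding Let_def power_sum_def r_def[symmetric] d2_def[symmetric] dr e_def[symmetric] by simp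
qed

end
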